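(* Let $T:\mathbb{R}[x_1,\dots,x_n]\to\mathbb{R}[x_1,\dots,x_m]$ be a linear operator of rank greater than $2$, mapping polynomials with non-negative coefficients to polynomials with non-negative coefficients, such that $T$ preserves real stability. Let $\alpha\in\mathbb{R}_+^n$ and $\beta\in\mathbb{R}_+^m$. Then for every real stable $p\in\mathbb{R}_+[x_1,\dots,x_n]$ with $\alpha\in\mathrm{Newt}(p)$, $$\frac{\mathrm{Cap}_\beta(T(p))}{\mathrm{Cap}_\alpha(p)}\ \ge\ e^{-\alpha}\alpha^\alpha\,\mathrm{Cap}_{(\alpha,\beta)}\big(\mathrm{Symb}^\infty(T)\big),$$ and this bound is tight for fixed $T,\alpha,\beta$: the infimum of the left-hand side over all real stable $p\in\mathbb{R}_+[x_1,\dots,x_n]$ with $\alpha\in\mathrm{Newt}(p)$ equals the right-hand side.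
   Context: $\mathbb{R}_+$ denotes the non-negative reals, and $\mathbb{R}_+[x_1,\dots,x_n]$ the polynomials with non-negative coefficients. A real polynomial is real stable if it is identically zero or does not vanish when all variables lie in the open upper half-plane. $T$ preserves real stability if $T(p)$ is real stable for every real stable $p\in\mathbb{R}[x_1,\dots,x_n]$. The rank of $T$ is the dimension of its image. Multi-index notation: $x^\alpha=\prod_kx_k^{\alpha_k}$, $\alpha^\alpha=\prod_k\alpha_k^{\alpha_k}$ with $0^0=1$, $e^{-\alpha}=\prod_ke^{-\alpha_k}$, $\mu!=\prod_k\mu_k!$. For a polynomial (or everywhere convergent power series) $p$ with non-negative coefficients, $\mathrm{Cap}_\alpha(p)=\inf_{x_1,\dots,x_n>0}p(x)/x^\alpha$. $\mathrm{Newt}(p)$ is the convex hull of the set of exponents of monomials with non-zero coefficient in $p$; for $\alpha\in\mathrm{Newt}(p)$ one has $\mathrm{Cap}_\alpha(p)>0$. The transcendental symbol of $T$ is $\mathrm{Symb}^\infty(T)(z,x)=\sum_{\mu\in\mathbb{Z}_+^n}\frac{1}{\mu!}z^\mu\,T(x^\mu)$, and $\mathrm{Cap}_{(\alpha,\beta)}(\mathrm{Symb}^\infty(T))=\inf_{z>0,\,x>0}\mathrm{Symb}^\infty(T)(z,x)/(z^\alpha x^\beta)$. *)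

theory Defs
  imports "HOL-Analysis.Analysis" "HOL-Library.Extended_Nat" "HOL-Analysis.Finite_Function_Topology"
begin

text \<open>
  Real polynomials in variables indexed by a finite type: a finitely supported assignment of
  coefficients to exponent vectors.  Its real vector space structure is the one of
  \<open>Finite_Function_Topology\<close>, its ring structure the one of \<open>Poly_Mapping\<close>.
\<close>

type_synonym 'n rpoly = "(nat ^ 'n) \<Rightarrow>\<^sub>0 real"

definition mono_eval :: "nat ^ 'n::finite \<Rightarrow> 'a::real_field ^ 'n \<Rightarrow> 'a" where
  "mono_eval \<mu> x = (\<Prod>k\<in>UNIV. (x $ k) ^ (\<mu> $ k))"

definition poly_eval :: "'n::finite rpoly \<Rightarrow> 'a::real_field ^ 'n \<Rightarrow> 'a" where
  "poly_eval p x = (\<Sum>\<mu>\<in>Poly_Mapping.keys p. of_real (Poly_Mapping.lookup p \<mu>) * mono_eval \<mu> x)"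

definition monomial :: "nat ^ 'n::finite \<Rightarrow> 'n rpoly" where
  "monomial \<mu> = Poly_Mapping.single \<mu> 1"

definition nonneg_coeffs :: "'n::finite rpoly \<Rightarrow> bool" where
  "nonneg_coeffs p \<longleftrightarrow> (\<forall>\<mu>. 0 \<le> Poly_Mapping.lookup p \<mu>)"

definition real_stable :: "'n::finite rpoly \<Rightarrow> bool" where
  "real_stable p \<longleftrightarrow>
     p = 0 \<or> (\<forall>z :: complex ^ 'n. (\<forall>k. 0 < Im (z $ k)) \<longrightarrow> poly_eval p z \<noteq> 0)"

definition preserves_real_stability :: "('n::finite rpoly \<Rightarrow> 'm::finite rpoly) \<Rightarrow> bool" where
  "preserves_real_stability T \<longleftrightarrow> (\<forall>p. real_stable p \<longrightarrow> real_stable (T p))"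

definition preserves_nonneg_coeffs :: "('n::finite rpoly \<Rightarrow> 'm::finite rpoly) \<Rightarrow> bool" where
  "preserves_nonneg_coeffs T \<longleftrightarrow> (\<forall>p. nonneg_coeffs p \<longrightarrow> nonneg_coeffs (T p))"

text \<open>
  The rank is an extended natural number: \<^const>\<open>dim\<close> of an infinite-dimensional space is a
  default value, so that case is separated.
\<close>

definition op_rank :: "('a::real_vector \<Rightarrow> 'b::real_vector) \<Rightarrow> enat" where
  "op_rank T = (if \<exists>B. finite B \<and> range T \<subseteq> span B then enat (dim (range T)) else \<infinity>)"

definition Newt :: "'n::finite rpoly \<Rightarrow> (real ^ 'n) set" where
  "Newt p = convex hull ((\<lambda>\<mu>. \<chi> k. real (\<mu> $ k)) ` Poly_Mapping.keys p)"

definition pos_vecs :: "(real ^ 'n::finite) set" where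
  "pos_vecs = {x. \<forall>k. 0 < x $ k}"

text \<open>Real exponents; only used for entrywise positive \<open>x\<close>, where \<open>x powr 0 = 1\<close>.\<close>

definition vpowr :: "real ^ 'n::finite \<Rightarrow> real ^ 'n \<Rightarrow> real" where
  "vpowr x \<alpha> = (\<Prod>k\<in>UNIV. (x $ k) powr (\<alpha> $ k))"

text \<open>The convention is \<open>0\<^sup>0 = 1\<close>, whereas \<open>0 powr 0 = 0\<close>.\<close>

definition self_power :: "real ^ 'n::finite \<Rightarrow> real" where
  "self_power \<alpha> = (\<Prod>k\<in>UNIV. if \<alpha> $ k = 0 then 1 else (\<alpha> $ k) powr (\<alpha> $ k))"

definition exp_neg :: "real ^ 'n::finite \<Rightarrow> real" where
  "exp_neg \<alpha> = (\<Prod>k\<in>UNIV. exp (- (\<alpha> $ k)))"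

definition Cap :: "real ^ 'n::finite \<Rightarrow> 'n rpoly \<Rightarrow> real" where
  "Cap \<alpha> p = (INF x\<in>pos_vecs. poly_eval p x / vpowr x \<alpha>)"

definition vfact :: "nat ^ 'n::finite \<Rightarrow> real" where
  "vfact \<mu> = (\<Prod>k\<in>UNIV. fact (\<mu> $ k))"

text \<open>
  The transcendental symbol as a function of \<open>(z, x)\<close>.  For operators of rank greater than two
  that preserve real stability and non-negativity of coefficients the series converges everywhere,
  so the default value of \<^const>\<open>infsum\<close> for divergent sums does not arise there.
\<close>

definition symb_inf ::
    "('n::finite rpoly \<Rightarrow> 'm::finite rpoly) \<Rightarrow> real ^ 'n \<Rightarrow> real ^ 'm \<Rightarrow> real" where
  "symb_inf T z x =
     (\<Sum>\<^sub>\<infinity>\<mu>\<in>UNIV. 1 / vfact \<mu> * mono_eval \<mu> z * poly_eval (T (monomial \<mu>)) x)"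

definition Cap_symb ::
    "real ^ 'n::finite \<Rightarrow> real ^ 'm::finite \<Rightarrow> ('n rpoly \<Rightarrow> 'm rpoly) \<Rightarrow> real" where
  "Cap_symb \<alpha> \<beta> T =
     (INF (z, x)\<in>pos_vecs \<times> pos_vecs. symb_inf T z x / (vpowr z \<alpha> * vpowr x \<beta>))"

end

theory Submission
  imports Defs "HOL-Computational_Algebra.Fundamental_Theorem_Algebra" "HOL-Real_Asymp.Real_Asymp"
begin

text \<open>
  Fix \<open>x > 0\<close> and let \<open>M(q) = T(q)(x)\<close>.  Since \<open>T\<close> has rank greater than two, it cannot send a real
  polynomial \<open>Re (c S)\<close>, \<open>c \<noteq> 0\<close>, with \<open>S\<close> strictly stable, to zero: perturbing \<open>S\<close>, all of the image of \<open>T\<close> (up to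
  a large degree) would consist of real stable polynomials, and evaluation at one point of the upper
  half-space would embed the image into the complex plane.  Hence \<open>T\<close> maps strictly stable complex polynomials to
  stable or to anti-stable ones, consistently along connected families, and a limit at the real
  point \<open>x\<close> gives \<open>Im (M(S) * cnj (M(x\<^sub>j S))) \<le> 0\<close> for stable \<open>S\<close>.

  This property passes to \<open>q \<mapsto> M(exp (z x\<^sub>j) q(x\<^sub>j \<mapsto> y + s x\<^sub>j))\<close>.  For
  \<open>f(s, y, z) = M(exp (z x\<^sub>j) p(x\<^sub>j \<mapsto> y + s x\<^sub>j))\<close> it yields the Rayleigh-type inequality
  \<open>f * \<partial>\<^sub>s f \<ge> \<partial>\<^sub>y f * \<partial>\<^sub>z f\<close>, so that \<open>ln f\<close> is a supersolution of a Hamilton--Jacobi equation.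
  Comparison with the solution starting from \<open>\<alpha>\<^sub>j ln (y z)\<close> bounds \<open>M(p) = f(1, 0, 0)\<close> from below by the capacity of
  \<open>f(0, y, z)\<close> times \<open>exp (-\<alpha>\<^sub>j) \<alpha>\<^sub>j\<close> to the power \<open>\<alpha>\<^sub>j\<close>.  After all variables have been treated, \<open>p(y)\<close> times
  the symbol remains.  Tightness is witnessed by \<open>p(x) = \<Prod>\<^sub>k (1 + z\<^sub>k x\<^sub>k / N)\<^sup>N\<close> as \<open>N\<close> tends to infinity.
\<close>

section \<open>Moment functionals\<close>

text \<open>The parameter s joins two ends: at s = 0 the variable x_j of p is replaced by y, so p
  and M no longer interact in that variable; at (s, y, z) = (1, 0, 0) the value is M(p) itself. The
  inequality between the derivatives is sharp: formally, for p = exp(a x_j) and M the evaluation at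
  x_j = b one has f = exp(a y + b z + a b s), which gives equality. This is why approximations of
  exponentials are extremal. Two obstacles shape the proof. First, \<open>T\<close> sees only real
  polynomials, and real stability does not tell the upper half-space from the lower one. For a
  perturbed problem one of two conjugate points works; which one may change with the perturbation,
  but both tend to the same real point. Second, exp(z x_j) is not a polynomial, so M must be
  extended to a series. No growth of M is assumed: testing the inequality for M on products with
  powers of 1 + x_1 + ... + x_n gives a log-concave sequence, hence geometric growth of the moments.
  The same bound makes the symbol converge.\<close>

type_synonym 'n cpoly = "(nat ^ 'n) \<Rightarrow>\<^sub>0 complex"

text \<open>The linear functional with prescribed values on monomials. The coefficient ring is left
  general, so that evaluation, evaluation after \<open>T\<close>, and the complex-linear extensions
  of both are instances.\<close>

definition mfun :: "('k \<Rightarrow> 'b::comm_semiring_1) \<Rightarrow> ('k \<Rightarrow>\<^sub>0 'b) \<Rightarrow> 'b" where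
  "mfun m S = (\<Sum>\<mu>\<in>Poly_Mapping.keys S. Poly_Mapping.lookup S \<mu> * m \<mu>)"

lemma mfun_superset:
  assumes "finite A" "Poly_Mapping.keys S \<subseteq> A"
  shows "mfun m S = (\<Sum>\<mu>\<in>A. Poly_Mapping.lookup S \<mu> * m \<mu>)"
  unfolding mfun_def using assms by (intro sum.mono_neutral_left) (auto simp: in_keys_iff)

lemma mfun_0 [simp]: "mfun m 0 = 0"
  by (simp add: mfun_def)

lemma mfun_add: "mfun m (S + S') = mfun m S + mfun m S'"
proof -
  let ?A = "Poly_Mapping.keys S \<union> Poly_Mapping.keys S'"
  have "Poly_Mapping.keys (S + S') \<subseteq> ?A" by (rule Poly_Mapping.keys_add)
  then show ?thesis
    by (subst (1 2 3) mfun_superset[where A = ?A])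
       (auto simp: lookup_add distrib_right sum.distrib)
qed

lemma mfun_sum: "mfun m (\<Sum>i\<in>I. F i) = (\<Sum>i\<in>I. mfun m (F i))"
  by (induction I rule: infinite_finite_induct) (simp_all add: mfun_add)

lemma mfun_single [simp]: "mfun m (Poly_Mapping.single \<mu> a) = a * m \<mu>"
  by (cases "a = 0") (simp_all add: mfun_def)

lemma mfun_add_moments: "mfun (\<lambda>\<mu>. m \<mu> + m' \<mu>) S = mfun m S + mfun m' S"
  by (simp add: mfun_def distrib_left sum.distrib)

lemma mfun_cmult_moments: "mfun (\<lambda>\<mu>. a * m \<mu>) S = a * mfun m S"
  by (simp add: mfun_def sum_distrib_left mult.left_commute)

lemma poly_mapping_expand:
  "S = (\<Sum>\<mu>\<in>Poly_Mapping.keys S. Poly_Mapping.single \<mu> (Poly_Mapping.lookup S \<mu>))"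
  by (rule poly_mapping_eqI)
     (auto simp: lookup_sum lookup_single when_def in_keys_iff)

lemma mfun_single_mult:
  fixes S :: "'k::comm_monoid_add \<Rightarrow>\<^sub>0 'b::comm_semiring_1"
  shows "mfun m (Poly_Mapping.single \<mu> a * S) = a * mfun (\<lambda>\<nu>. m (\<mu> + \<nu>)) S"
proof -
  have "Poly_Mapping.single \<mu> a * S =
      (\<Sum>\<nu>\<in>Poly_Mapping.keys S. Poly_Mapping.single (\<mu> + \<nu>) (a * Poly_Mapping.lookup S \<nu>))"
    by (subst poly_mapping_expand[of S]) (simp only: sum_distrib_left mult_single)
  then show ?thesis
    by (simp add: mfun_sum) (simp add: mfun_def sum_distrib_left mult.assoc)
qed

lemma mfun_mult:
  fixes S S' :: "'k::comm_monoid_add \<Rightarrow>\<^sub>0 'b::comm_semiring_1"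
  assumes "\<And>\<mu> \<nu>. m (\<mu> + \<nu>) = m \<mu> * m \<nu>"
  shows "mfun m (S * S') = mfun m S * mfun m S'"
proof -
  have "S * S' = (\<Sum>\<mu>\<in>Poly_Mapping.keys S. Poly_Mapping.single \<mu> (Poly_Mapping.lookup S \<mu>) * S')"
    by (subst (1) poly_mapping_expand[of S]) (simp add: sum_distrib_right)
  then show ?thesis
    by (simp add: mfun_sum mfun_single_mult assms mfun_cmult_moments)
       (simp add: mfun_def sum_distrib_right mult.assoc)
qed

abbreviation cC :: "complex \<Rightarrow> 'n::finite cpoly" where
  "cC a \<equiv> Poly_Mapping.single 0 a"

abbreviation cX :: "'n::finite \<Rightarrow> 'n cpoly" where
  "cX k \<equiv> Poly_Mapping.single (axis k 1) 1"

abbreviation ceval :: "'n::finite cpoly \<Rightarrow> complex ^ 'n \<Rightarrow> complex" where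
  "ceval S z \<equiv> mfun (\<lambda>\<mu>. mono_eval \<mu> z) S"

lemma mono_eval_add: "mono_eval (\<mu> + \<nu>) z = mono_eval \<mu> z * mono_eval \<nu> z"
  by (simp add: mono_eval_def power_add prod.distrib)

lemma mono_eval_zero [simp]: "mono_eval 0 z = 1"
  by (simp add: mono_eval_def)

lemma mono_eval_axis: "mono_eval (axis k l) z = z $ k ^ l"
  unfolding mono_eval_def axis_def
  by (subst prod.remove[of _ k]) (auto intro!: prod.neutral)

lemma ceval_mult: "ceval (S * S') z = ceval S z * ceval S' z"
  by (rule mfun_mult) (simp add: mono_eval_add)

lemma ceval_one [simp]: "ceval 1 z = 1"
  by (simp flip: single_one)

lemma ceval_power: "ceval (S ^ k) z = ceval S z ^ k"
  by (induction k) (simp_all add: ceval_mult)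

lemma ceval_prod: "ceval (\<Prod>i\<in>I. F i) z = (\<Prod>i\<in>I. ceval (F i) z)"
  by (induction I rule: infinite_finite_induct) (simp_all add: ceval_mult)

lemma mfun_lin_mult:
  "mfun m ((cC a + cC b * cX k) * S) = a * mfun m S + b * mfun (\<lambda>\<nu>. m (axis k 1 + \<nu>)) S"
  by (simp add: distrib_right mfun_add mfun_single_mult mult_single)

lemma ceval_lin: "ceval (cC a + cC b * cX k) z = a + b * z $ k"
  by (simp add: mfun_add ceval_mult mono_eval_axis)

definition upper :: "(complex ^ 'n::finite) set" where
  "upper = {z. \<forall>k. 0 < Im (z $ k)}"

definition complex_stable :: "'n::finite cpoly \<Rightarrow> bool" where
  "complex_stable S \<longleftrightarrow> (\<forall>z\<in>upper. ceval S z \<noteq> 0)"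

text \<open>For \<open>M(S) = mfun m S\<close> the condition reads \<open>Im (M(S) * cnj (M(x\<^sub>j S))) \<le> 0\<close>: it says that
  \<open>w \<mapsto> M((1 - w x\<^sub>j) S)\<close> has no zero in the upper half-plane, where \<open>(1 - w x\<^sub>j) S\<close> is again stable.\<close>

definition good_moments :: "(nat ^ 'n::finite \<Rightarrow> real) \<Rightarrow> bool" where
  "good_moments m \<longleftrightarrow> (\<forall>S j. complex_stable S \<longrightarrow>
     Im (mfun (\<lambda>\<mu>. of_real (m \<mu>)) S * cnj (mfun (\<lambda>\<mu>. of_real (m (axis j 1 + \<mu>))) S)) \<le> 0)"

lemma good_momentsD:
  assumes "good_moments m" "complex_stable S"
  shows "Im (mfun (\<lambda>\<mu>. of_real (m \<mu>)) S * cnj (mfun (\<lambda>\<mu>. of_real (m (axis j 1 + \<mu>))) S)) \<le> 0"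
  using assms unfolding good_moments_def by blast

lemma tendsto_mfun:
  fixes \<tau> :: "'k \<Rightarrow> 'b::{comm_semiring_1,real_normed_algebra_1}"
  assumes "\<And>\<mu>. ((\<lambda>n. \<tau>n n \<mu>) \<longlongrightarrow> \<tau> \<mu>) F"
  shows "((\<lambda>n. mfun (\<tau>n n) S) \<longlongrightarrow> mfun \<tau> S) F"
  unfolding mfun_def by (intro tendsto_intros assms)

text \<open>For fixed \<open>S\<close> the inequality involves finitely many moments, so pointwise
  convergence suffices and no uniformity in \<open>S\<close> is needed.\<close>

lemma good_moments_limit:
  fixes m :: "nat ^ 'n::finite \<Rightarrow> real"
  assumes good: "eventually (\<lambda>n. good_moments (mn n)) F"
    and lim: "\<And>\<mu>. ((\<lambda>n. mn n \<mu>) \<longlongrightarrow> m \<mu>) F" and F: "F \<noteq> bot"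
  shows "good_moments m"
  unfolding good_moments_def
proof (intro allI impI)
  fix S :: "'n cpoly" and j assume S: "complex_stable S"
  let ?h = "\<lambda>m. Im (mfun (\<lambda>\<mu>. of_real (m \<mu>)) S * cnj (mfun (\<lambda>\<mu>. of_real (m (axis j 1 + \<mu>))) S))"
  have "((\<lambda>n. ?h (mn n)) \<longlongrightarrow> ?h m) F"
    by (intro tendsto_intros tendsto_mfun lim)
  moreover have "eventually (\<lambda>n. ?h (mn n) \<le> 0) F"
    using good by eventually_elim (use S good_momentsD in blast)
  ultimately show "?h m \<le> 0"
    using F by (rule tendsto_upperbound)
qed

text \<open>Here \<open>m'\<close> represents S -> M(P S). Multiplication by \<open>P\<close> keeps
  stability and commutes with multiplication by x_j, so the inequality for \<open>m\<close> at
  \<open>P * S\<close> is the one for \<open>m'\<close> at \<open>S\<close>.\<close>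

lemma good_moments_pullback:
  fixes m m' :: "nat ^ 'n::finite \<Rightarrow> real" and P :: "'n cpoly"
  assumes good: "good_moments m"
    and P: "\<And>z. z \<in> upper \<Longrightarrow> ceval P z \<noteq> 0"
    and m': "\<And>S. mfun (\<lambda>\<mu>. of_real (m' \<mu>)) S = mfun (\<lambda>\<mu>. of_real (m \<mu>)) (P * S)"
  shows "good_moments m'"
  unfolding good_moments_def
proof (intro allI impI)
  fix S :: "'n cpoly" and j assume S: "complex_stable S"
  have "complex_stable (P * S)"
    using S P by (auto simp: complex_stable_def ceval_mult)
  moreover have "mfun (\<lambda>\<mu>. of_real (m' (axis j 1 + \<mu>))) S = mfun (\<lambda>\<mu>. of_real (m (axis j 1 + \<mu>))) (P * S)"
  proof -
    have "mfun (\<lambda>\<mu>. of_real (m' (axis j 1 + \<mu>))) S = mfun (\<lambda>\<mu>. of_real (m' \<mu>)) (cX j * S)"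
      by (simp add: mfun_single_mult)
    also have "\<dots> = mfun (\<lambda>\<mu>. of_real (m \<mu>)) (cX j * (P * S))"
      by (simp add: m' mult.left_commute)
    finally show ?thesis by (simp add: mfun_single_mult)
  qed
  ultimately show "Im (mfun (\<lambda>\<mu>. of_real (m' \<mu>)) S * cnj (mfun (\<lambda>\<mu>. of_real (m' (axis j 1 + \<mu>))) S)) \<le> 0"
    using good_momentsD[OF good] m' by metis
qed

section \<open>Affine substitution in one variable and its dual action on moments\<close>

definition upd :: "nat ^ 'n::finite \<Rightarrow> 'n \<Rightarrow> nat \<Rightarrow> nat ^ 'n" where
  "upd \<mu> j b = (\<chi> k. if k = j then b else \<mu> $ k)"

lemma upd_same [simp]: "upd \<mu> j (\<mu> $ j) = \<mu>"
  by (simp add: upd_def vec_eq_iff)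

lemma upd_nth [simp]: "upd \<mu> j b $ k = (if k = j then b else \<mu> $ k)"
  by (simp add: upd_def)

lemma upd_upd [simp]: "upd (upd \<mu> j b) j c = upd \<mu> j c"
  by (simp add: upd_def vec_eq_iff)

lemma axis_add_upd: "axis j l + upd \<mu> j b = upd \<mu> j (l + b)"
  by (simp add: upd_def vec_eq_iff axis_def)

lemma axis_add: "axis j l + \<mu> = upd \<mu> j (l + \<mu> $ j)"
  by (simp add: upd_def vec_eq_iff axis_def)

lemma upd_axis_other: "j \<noteq> i \<Longrightarrow> upd (axis i l + \<mu>) j b = axis i l + upd \<mu> j b"
  by (simp add: upd_def vec_eq_iff axis_def)

text \<open>\<open>slot_shift s y e k\<close> is the image of \<open>(y + s X)\<^sup>k\<close> under the functional \<open>X\<^sup>b \<mapsto> e b\<close>.\<close>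

fun slot_shift :: "'a \<Rightarrow> 'a \<Rightarrow> (nat \<Rightarrow> 'a::comm_semiring_1) \<Rightarrow> nat \<Rightarrow> 'a" where
  "slot_shift s y e 0 = e 0"
| "slot_shift s y e (Suc k) = y * slot_shift s y e k + s * slot_shift s y (\<lambda>b. e (Suc b)) k"

definition shift_moments :: "'n \<Rightarrow> 'a \<Rightarrow> 'a \<Rightarrow> (nat ^ 'n::finite \<Rightarrow> 'a::comm_semiring_1) \<Rightarrow> nat ^ 'n \<Rightarrow> 'a" where
  "shift_moments j s y m \<mu> = slot_shift s y (\<lambda>b. m (upd \<mu> j b)) (\<mu> $ j)"

lemma slot_shift_of_real: "slot_shift (of_real s) (of_real y) (\<lambda>b. of_real (e b)) k = of_real (slot_shift s y e k)"
  by (induction k arbitrary: e) simp_all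

text \<open>The substitution \<open>x\<^sub>j \<mapsto> y + s x\<^sub>j\<close>, dual to \<open>shift_moments\<close>.\<close>

definition subst_monomial :: "'n::finite \<Rightarrow> complex \<Rightarrow> complex \<Rightarrow> nat ^ 'n \<Rightarrow> 'n cpoly" where
  "subst_monomial j s y \<mu> = (cC y + cC s * cX j) ^ (\<mu> $ j) * Poly_Mapping.single (upd \<mu> j 0) 1"

definition subst_slot :: "'n::finite \<Rightarrow> complex \<Rightarrow> complex \<Rightarrow> 'n cpoly \<Rightarrow> 'n cpoly" where
  "subst_slot j s y S = (\<Sum>\<mu>\<in>Poly_Mapping.keys S. cC (Poly_Mapping.lookup S \<mu>) * subst_monomial j s y \<mu>)"

lemma mfun_lin_power:
  "mfun m ((cC y + cC s * cX j) ^ k * Poly_Mapping.single \<nu> 1) = slot_shift s y (\<lambda>b. m (axis j b + \<nu>)) k"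
proof (induction k arbitrary: m)
  case (Suc k)
  have "mfun m ((cC y + cC s * cX j) ^ Suc k * Poly_Mapping.single \<nu> 1)
      = mfun m ((cC y + cC s * cX j) * ((cC y + cC s * cX j) ^ k * Poly_Mapping.single \<nu> 1))"
    by (simp only: power_Suc mult.assoc)
  also have "\<dots> = y * slot_shift s y (\<lambda>b. m (axis j b + \<nu>)) k + s * slot_shift s y (\<lambda>b. m (axis j 1 + (axis j b + \<nu>))) k"
    unfolding mfun_lin_mult Suc.IH ..
  also have "(\<lambda>b. m (axis j 1 + (axis j b + \<nu>))) = (\<lambda>b. m (axis j (Suc b) + \<nu>))"
    by (simp add: axis_add)
  finally show ?case by simp
qed (simp add: axis_add)

lemma mfun_subst_slot: "mfun m (subst_slot j s y S) = mfun (shift_moments j s y m) S"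
  unfolding subst_slot_def mfun_sum mfun_single_mult subst_monomial_def add_0 mfun_lin_power axis_add_upd
  by (simp add: shift_moments_def mfun_def)

lemma shift_moments_mono_eval:
  fixes z :: "complex ^ 'n::finite"
  shows "shift_moments j s y (\<lambda>\<mu>. mono_eval \<mu> z) \<mu> = mono_eval \<mu> (\<chi> k. if k = j then y + s * z $ k else z $ k)"
proof -
  have *: "slot_shift s y (\<lambda>b. a * x ^ b) k = a * (y + s * x) ^ k" for a x :: complex and k
  proof (induction k arbitrary: a)
    case (Suc k)
    from Suc.IH[of "a * x"] have "slot_shift s y (\<lambda>b. a * x ^ Suc b) k = a * x * (y + s * x) ^ k"
      by (simp add: mult.assoc)
    then show ?case by (simp add: Suc.IH algebra_simps)
  qed simp
  have "mono_eval (upd \<mu> j b) z = (\<Prod>k\<in>UNIV-{j}. z $ k ^ \<mu> $ k) * z $ j ^ b" for b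
    unfolding mono_eval_def by (subst prod.remove[of _ j]) (auto intro!: prod.cong)
  moreover have "mono_eval \<mu> (\<chi> k. if k = j then y + s * z $ k else z $ k)
      = (\<Prod>k\<in>UNIV-{j}. z $ k ^ \<mu> $ k) * (y + s * z $ j) ^ \<mu> $ j"
    unfolding mono_eval_def by (subst prod.remove[of _ j]) (auto intro!: prod.cong)
  ultimately show ?thesis
    by (simp add: shift_moments_def *)
qed

lemma ceval_subst_slot:
  "ceval (subst_slot j s y S) z = ceval S (\<chi> k. if k = j then y + s * z $ k else z $ k)"
  unfolding mfun_subst_slot by (simp add: mfun_def shift_moments_mono_eval)

lemma complex_stable_subst_slot:
  assumes "complex_stable S" "0 < s" "0 \<le> Im y"
  shows "complex_stable (subst_slot j (of_real s) y S)"
proof -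
  have "(\<chi> k. if k = j then y + of_real s * z $ k else z $ k) \<in> upper" if "z \<in> upper" for z
    using that assms(2,3) by (auto simp: upper_def intro!: add_nonneg_pos mult_pos_pos)
  with assms(1) show ?thesis by (auto simp: complex_stable_def ceval_subst_slot)
qed

lemma shift_moments_axis_same:
  "shift_moments j s y m (axis j 1 + \<mu>)
    = y * shift_moments j s y m \<mu> + s * shift_moments j s y (\<lambda>\<mu>. m (axis j 1 + \<mu>)) \<mu>"
  by (simp add: shift_moments_def axis_add)

lemma shift_moments_axis_other:
  assumes "i \<noteq> j"
  shows "shift_moments j s y m (axis i 1 + \<mu>) = shift_moments j s y (\<lambda>\<mu>. m (axis i 1 + \<mu>)) \<mu>"
  using assms upd_axis_other[of j i 1 \<mu>] by (simp add: shift_moments_def axis_add)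

lemma good_moments_shift_pos:
  assumes good: "good_moments m" and s: "0 < s"
  shows "good_moments (shift_moments j s y m)"
  unfolding good_moments_def
proof (intro allI impI)
  fix S :: "'a cpoly" and i assume S: "complex_stable S"
  let ?s = "of_real s :: complex" and ?y = "of_real y :: complex"
  let ?cm = "\<lambda>\<mu>. of_real (m \<mu>) :: complex"
  define S' where "S' = subst_slot j ?s ?y S"
  have S': "complex_stable S'"
    unfolding S'_def using S s by (intro complex_stable_subst_slot) auto
  have shift: "of_real (shift_moments j s y m \<mu>) = shift_moments j ?s ?y (\<lambda>\<mu>. of_real (m \<mu>)) \<mu>" for m \<mu>
    by (simp add: shift_moments_def slot_shift_of_real)
  define A where "A = mfun ?cm S'"
  define B where "B = mfun (\<lambda>\<mu>. ?cm (axis i 1 + \<mu>)) S'"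
  have A: "mfun (\<lambda>\<mu>. of_real (shift_moments j s y m \<mu>)) S = A"
    by (simp add: shift A_def S'_def mfun_subst_slot)
  have AB: "Im (A * cnj B) \<le> 0"
    unfolding A_def B_def by (rule good_momentsD[OF good S'])
  show "Im (mfun (\<lambda>\<mu>. of_real (shift_moments j s y m \<mu>)) S *
      cnj (mfun (\<lambda>\<mu>. of_real (shift_moments j s y m (axis i 1 + \<mu>))) S)) \<le> 0"
  proof (cases "i = j")
    case True
    then have "mfun (\<lambda>\<mu>. of_real (shift_moments j s y m (axis i 1 + \<mu>))) S = ?y * A + ?s * B"
      by (simp only: shift A_def S'_def mfun_subst_slot B_def mfun_add_moments mfun_cmult_moments
          shift_moments_axis_same[of j ?s ?y ?cm])
    \<comment> \<open>The term \<open>?y * A\<close> only adds the real number y |A|^2, so the real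
      shift y may have any sign.\<close>
    then have "Im (A * cnj (mfun (\<lambda>\<mu>. of_real (shift_moments j s y m (axis i 1 + \<mu>))) S)) = s * Im (A * cnj B)"
      by (simp add: algebra_simps)
    then show ?thesis
      unfolding A using AB s by (simp only: mult_nonneg_nonpos less_imp_le)
  next
    case False
    then have "mfun (\<lambda>\<mu>. of_real (shift_moments j s y m (axis i 1 + \<mu>))) S = B"
      by (simp only: shift shift_moments_axis_other[OF False] S'_def mfun_subst_slot B_def)
    then show ?thesis unfolding A using AB by simp
  qed
qed

lemma continuous_slot_shift [continuous_intros]:
  fixes s y :: "'t::topological_space \<Rightarrow> 'b::{comm_semiring_1,real_normed_algebra_1}"
  assumes "continuous_on A s" "continuous_on A y" "\<And>b. continuous_on A (\<lambda>t. e t b)"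
  shows "continuous_on A (\<lambda>t. slot_shift (s t) (y t) (e t) k)"
  using assms(3)
proof (induction k arbitrary: e)
  case (Suc k)
  then show ?case using assms by (simp add: continuous_intros)
qed simp

text \<open>At s = 0 the substitution lands on the real point y, on the boundary of the half-plane,
  where a stable polynomial may vanish. That case is reached as a limit from s > 0.\<close>

lemma good_moments_shift:
  assumes good: "good_moments m" and s: "0 \<le> s"
  shows "good_moments (shift_moments j s y m)"
proof (cases "s = 0")
  case True
  show ?thesis
  proof (rule good_moments_limit[where F = "at_right 0" and mn = "\<lambda>s. shift_moments j s y m"])
    show "eventually (\<lambda>s. good_moments (shift_moments j s y m)) (at_right 0)"
      using eventually_at_right_less[of 0] by eventually_elim (rule good_moments_shift_pos[OF good])
    fix \<mu>
    have "continuous_on UNIV (\<lambda>s. shift_moments j s y m \<mu>)"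
      unfolding shift_moments_def by (intro continuous_intros)
    then show "((\<lambda>s. shift_moments j s y m \<mu>) \<longlongrightarrow> shift_moments j s y m \<mu>) (at_right 0)"
      unfolding True continuous_on_def
      by (auto intro: tendsto_mono[OF at_le])
  qed simp
next
  case False
  with s show ?thesis by (intro good_moments_shift_pos[OF good]) simp
qed

section \<open>Exponential shifts and the Rayleigh inequality\<close>

lemma mfun_mult_expand:
  fixes P S :: "'k::comm_monoid_add \<Rightarrow>\<^sub>0 'b::comm_semiring_1"
  shows "mfun m (P * S) = mfun (\<lambda>\<nu>. mfun m (P * Poly_Mapping.single \<nu> 1)) S"
proof -
  have *: "mfun m (P * Poly_Mapping.single \<nu> a) = a * mfun m (P * Poly_Mapping.single \<nu> 1)" for \<nu> a
  proof -
    have "P * Poly_Mapping.single \<nu> a = Poly_Mapping.single 0 a * (P * Poly_Mapping.single \<nu> 1)"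
      by (simp add: mult.left_commute mult_single)
    then show ?thesis by (simp add: mfun_single_mult)
  qed
  have "P * S = (\<Sum>\<nu>\<in>Poly_Mapping.keys S. P * Poly_Mapping.single \<nu> (Poly_Mapping.lookup S \<nu>))"
    by (subst (1) poly_mapping_expand[of S]) (simp add: sum_distrib_left)
  then have "mfun m (P * S) = (\<Sum>\<nu>\<in>Poly_Mapping.keys S. mfun m (P * Poly_Mapping.single \<nu> (Poly_Mapping.lookup S \<nu>)))"
    by (simp only: mfun_sum)
  also have "\<dots> = (\<Sum>\<nu>\<in>Poly_Mapping.keys S. Poly_Mapping.lookup S \<nu> * mfun m (P * Poly_Mapping.single \<nu> 1))"
    by (intro sum.cong refl *)
  finally show ?thesis
    by (simp only: mfun_def[of "\<lambda>\<nu>. mfun m (P * Poly_Mapping.single \<nu> 1)"])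
qed

lemma slot_shift_binomial: "slot_shift s y e k = (\<Sum>l\<le>k. of_nat (k choose l) * y ^ (k - l) * s ^ l * e l)"
proof (induction k arbitrary: e)
  case (Suc k)
  have "(\<Sum>l\<le>Suc k. of_nat (Suc k choose l) * y ^ (Suc k - l) * s ^ l * e l)
      = y ^ Suc k * e 0 + (\<Sum>l\<le>k. of_nat (Suc k choose Suc l) * y ^ (k - l) * s ^ Suc l * e (Suc l))"
    by (subst sum.atMost_Suc_shift) simp
  also have "\<dots> = y ^ Suc k * e 0 + (\<Sum>l\<le>k. of_nat (k choose Suc l) * y ^ (k - l) * s ^ Suc l * e (Suc l))
      + s * (\<Sum>l\<le>k. of_nat (k choose l) * y ^ (k - l) * s ^ l * e (Suc l))"
    by (simp add: sum.distrib distrib_right distrib_left sum_distrib_left mult_ac add_ac)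
  also have "y ^ Suc k * e 0 + (\<Sum>l\<le>k. of_nat (k choose Suc l) * y ^ (k - l) * s ^ Suc l * e (Suc l))
      = (\<Sum>l\<le>Suc k. of_nat (k choose l) * y ^ (Suc k - l) * s ^ l * e l)"
    by (subst sum.atMost_Suc_shift) simp
  also have "\<dots> = (\<Sum>l\<le>k. of_nat (k choose l) * y ^ (Suc k - l) * s ^ l * e l)"
    by (simp add: binomial_eq_0)
  also have "\<dots> = y * (\<Sum>l\<le>k. of_nat (k choose l) * y ^ (k - l) * s ^ l * e l)"
    by (simp add: sum_distrib_left Suc_diff_le mult_ac)
  finally show ?case using Suc.IH by simp
qed simp

text \<open>A majorant, uniform in n, of the coefficients of (1 + z x / n)^n by those of exp(z x).
  It dominates the limit in \<open>good_exp_moments\<close> and later compares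
  \<open>exp_approx\<close> with the symbol.\<close>

lemma binomial_over_power_le:
  assumes "0 \<le> (z::real)"
  shows "of_nat (n choose l) * (z / of_nat n) ^ l \<le> z ^ l / fact l"
proof (cases "n = 0")
  case False
  have "real ((n choose l) * fact l) \<le> real (n ^ l)"
    using binomial_fact_pow[of n l] by (simp only: of_nat_le_iff)
  then have "real (n choose l) / real n ^ l \<le> 1 / fact l"
    using False by (simp add: field_simps)
  from mult_right_mono[OF this, of "z ^ l"] show ?thesis
    using assms by (simp add: power_divide)
qed (use assms in \<open>cases l; simp\<close>)

lemma binomial_over_power_tendsto:
  "(\<lambda>n. of_nat (n choose l) * (z / of_nat n) ^ l) \<longlonglongrightarrow> z ^ l / (fact l :: real)"
proof -
  have "(\<lambda>n. (\<Prod>i=0..<l. 1 - of_nat i / real n) / fact l * z ^ l) \<longlonglongrightarrow> (\<Prod>i=0..<l. 1 - 0) / fact l * z ^ l"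
    by (intro tendsto_intros lim_const_over_n) auto
  moreover have "eventually (\<lambda>n. (\<Prod>i=0..<l. 1 - of_nat i / real n) / fact l * z ^ l
      = of_nat (n choose l) * (z / of_nat n) ^ l) sequentially"
    using eventually_gt_at_top[of 0]
  proof eventually_elim
    case (elim n)
    have "(\<Prod>i=0..<l. 1 - of_nat i / real n) = (\<Prod>i=0..<l. (real n - of_nat i) / real n)"
      using elim by (intro prod.cong) (auto simp: field_simps)
    also have "\<dots> = (\<Prod>i=0..<l. real n - of_nat i) / real n ^ l"
      by (simp add: prod_dividef)
    finally show ?case
      by (simp add: binomial_gbinomial gbinomial_prod_rev power_divide)
  qed
  ultimately show ?thesis
    using tendsto_cong by fastforce
qed

text \<open>The moments of S -> M(exp(z x_j) S), with the exponential expanded in powers of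
  x_j.\<close>

definition exp_moments :: "'n \<Rightarrow> real \<Rightarrow> (nat ^ 'n::finite \<Rightarrow> real) \<Rightarrow> nat ^ 'n \<Rightarrow> real" where
  "exp_moments j z m \<mu> = suminf (\<lambda>l. z ^ l / fact l * m (upd \<mu> j (\<mu> $ j + l)))"

text \<open>The bound, geometric in the total degree, makes the exponential series converge for
  every z, and it is inherited by the moments obtained from exponential weights and affine
  shifts.\<close>

definition admissible :: "(nat ^ 'n::finite \<Rightarrow> real) \<Rightarrow> bool" where
  "admissible m \<longleftrightarrow> good_moments m \<and> (\<forall>\<mu>. 0 \<le> m \<mu>) \<and>
     (\<exists>C \<rho>. 0 \<le> C \<and> 0 \<le> \<rho> \<and> (\<forall>\<mu>. m \<mu> \<le> C * \<rho> ^ (\<Sum>k\<in>UNIV. \<mu> $ k)))"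

lemma sum_upd: "(\<Sum>k\<in>UNIV. upd \<mu> j b $ k) = (\<Sum>k\<in>UNIV. upd \<mu> j 0 $ k) + b"
proof -
  have "(\<Sum>k\<in>UNIV. upd \<mu> j b $ k) = (\<Sum>k\<in>UNIV. upd \<mu> j 0 $ k + (if k = j then b else 0))"
    by (intro sum.cong) auto
  then show ?thesis by (simp add: sum.distrib)
qed

lemma admissible_slot_growth:
  assumes "admissible m"
  obtains A \<rho> where "0 \<le> A" "0 \<le> \<rho>" "\<And>l. m (upd \<mu> j (b + l)) \<le> A * \<rho> ^ l"
proof -
  from assms obtain C \<rho> where C: "0 \<le> C" "0 \<le> \<rho>" and *: "\<And>\<mu>. m \<mu> \<le> C * \<rho> ^ (\<Sum>k\<in>UNIV. \<mu> $ k)"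
    unfolding admissible_def by blast
  show thesis
  proof (rule that[of "C * \<rho> ^ ((\<Sum>k\<in>UNIV. upd \<mu> j 0 $ k) + b)" \<rho>])
    show "m (upd \<mu> j (b + l)) \<le> C * \<rho> ^ ((\<Sum>k\<in>UNIV. upd \<mu> j 0 $ k) + b) * \<rho> ^ l" for l
      using *[of "upd \<mu> j (b + l)"] by (simp only: sum_upd[of \<mu> j "b + l"] power_add mult.assoc)
  qed (use C in auto)
qed

lemma summable_exp_growth:
  fixes e :: "nat \<Rightarrow> real"
  assumes "\<And>l. 0 \<le> e l" "\<And>l. e l \<le> A * \<rho> ^ l"
  shows "summable (\<lambda>l. z ^ l / fact l * e l)"
proof (rule summable_comparison_test)
  show "\<exists>N. \<forall>n\<ge>N. norm (z ^ n / fact n * e n) \<le> A * ((\<bar>z\<bar> * \<rho>) ^ n /\<^sub>R fact n)"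
    using assms
    by (auto simp: abs_mult power_abs power_mult_distrib divide_inverse intro!: mult_left_mono
        order_trans[OF mult_left_mono[OF assms(2)]])
  show "summable (\<lambda>n. A * ((\<bar>z\<bar> * \<rho>) ^ n /\<^sub>R fact n))"
    by (intro summable_mult summable_exp_generic)
qed

lemma suminf_exp_growth_le:
  fixes e :: "nat \<Rightarrow> real"
  assumes "\<And>l. 0 \<le> e l" "\<And>l. e l \<le> A * \<rho> ^ l" "0 \<le> z"
  shows "suminf (\<lambda>l. z ^ l / fact l * e l) \<le> A * exp (z * \<rho>)"
proof -
  have "suminf (\<lambda>l. z ^ l / fact l * e l) \<le> suminf (\<lambda>l. A * ((z * \<rho>) ^ l /\<^sub>R fact l))"
  proof (intro suminf_le summable_mult summable_exp_generic summable_exp_growth[OF assms(1,2)])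
    show "z ^ l / fact l * e l \<le> A * ((z * \<rho>) ^ l /\<^sub>R fact l)" for l
      using mult_left_mono[OF assms(2)[of l], of "z ^ l / fact l"] assms(3)
      by (simp add: power_mult_distrib divide_inverse mult_ac)
  qed
  also have "\<dots> = A * exp (z * \<rho>)"
    unfolding exp_def by (rule suminf_mult) (rule summable_exp_generic)
  finally show ?thesis .
qed

lemma admissible_nonneg: "admissible m \<Longrightarrow> 0 \<le> m \<mu>"
  by (simp add: admissible_def)

text \<open>The weight exp(z x_j) is the limit of (1 + z x_j / n)^n, which has no zero in the upper
  half-space because z is real and non-negative. Tannery's theorem moves the limit through the
  series of moments.\<close>

lemma good_exp_moments:
  fixes m :: "nat ^ 'n::finite \<Rightarrow> real"
  assumes m: "admissible m" and z: "0 \<le> z"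
  shows "good_moments (exp_moments j z m)"
proof (rule good_moments_limit)
  let ?mn = "\<lambda>n \<mu>. slot_shift (z / real n) 1 (\<lambda>b. m (axis j b + \<mu>)) n"
  show "eventually (\<lambda>n. good_moments (?mn n)) sequentially"
  proof (intro always_eventually allI)
    fix n
    define \<eta> where "\<eta> = z / real n"
    have \<eta>: "0 \<le> \<eta>" using z by (simp add: \<eta>_def)
    show "good_moments (?mn n)"
    proof (rule good_moments_pullback[where P = "(cC 1 + cC (of_real \<eta>) * cX j) ^ n"])
      show "good_moments m" using m by (simp add: admissible_def)
      fix w :: "complex ^ 'n" assume "w \<in> upper"
      then have w: "0 < Im (w $ j)" by (simp add: upper_def)
      have "1 + of_real \<eta> * w $ j \<noteq> 0"
      proof
        assume *: "1 + of_real \<eta> * w $ j = 0"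
        then have "\<eta> * Im (w $ j) = 0" by (auto simp: complex_eq_iff)
        with w have "\<eta> = 0" by simp
        with * show False by simp
      qed
      then show "ceval ((cC 1 + cC (of_real \<eta>) * cX j) ^ n) w \<noteq> 0"
        by (simp only: ceval_power ceval_lin power_eq_0_iff simp_thms)
    next
      fix S :: "'n cpoly"
      show "mfun (\<lambda>\<mu>. of_real (?mn n \<mu>)) S
          = mfun (\<lambda>\<mu>. of_real (m \<mu>)) ((cC 1 + cC (of_real \<eta>) * cX j) ^ n * S)"
        unfolding mfun_mult_expand[of _ "(cC 1 + cC (of_real \<eta>) * cX j) ^ n"] mfun_lin_power
        by (simp add: \<eta>_def flip: slot_shift_of_real)
    qed
  qed
  fix \<mu> :: "nat ^ 'n"
  let ?e = "\<lambda>l. m (upd \<mu> j (\<mu> $ j + l))"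
  obtain A \<rho> where A: "0 \<le> A" "0 \<le> \<rho>" "\<And>l. ?e l \<le> A * \<rho> ^ l"
    using admissible_slot_growth[OF m, of \<mu> j "\<mu> $ j"] by blast
  have e: "0 \<le> ?e l" for l by (rule admissible_nonneg[OF m])
  have "(\<lambda>n. suminf (\<lambda>l. of_nat (n choose l) * (z / of_nat n) ^ l * ?e l)) \<longlonglongrightarrow> exp_moments j z m \<mu>"
    unfolding exp_moments_def
  proof (rule tannerys_theorem[THEN conjunct2, THEN conjunct2])
    show "(\<lambda>n. of_nat (n choose k) * (z / of_nat n) ^ k * ?e k) \<longlonglongrightarrow> z ^ k / fact k * ?e k" for k
      by (intro tendsto_mult_right binomial_over_power_tendsto)
    show "eventually (\<lambda>(k, n). norm (of_nat (n choose k) * (z / of_nat n) ^ k * ?e k)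
        \<le> z ^ k / fact k * ?e k) (at_top \<times>\<^sub>F sequentially)"
      using z e binomial_over_power_le[OF z]
      by (intro always_eventually) (auto simp del: times_divide_eq_left intro!: mult_right_mono)
    show "summable (\<lambda>k. z ^ k / fact k * ?e k)"
      by (rule summable_exp_growth[OF e A(3)])
  qed simp
  moreover have "?mn n \<mu> = suminf (\<lambda>l. of_nat (n choose l) * (z / of_nat n) ^ l * ?e l)" for n
  proof -
    have "suminf (\<lambda>l. of_nat (n choose l) * (z / of_nat n) ^ l * ?e l)
        = (\<Sum>l\<le>n. of_nat (n choose l) * (z / of_nat n) ^ l * ?e l)"
      by (rule suminf_finite) (auto simp: binomial_eq_0)
    then show ?thesis by (simp only: slot_shift_binomial power_one mult_1_right axis_add add.commute[of _ "\<mu> $ j"])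
  qed
  ultimately show "(\<lambda>n. ?mn n \<mu>) \<longlonglongrightarrow> exp_moments j z m \<mu>"
    by simp
qed simp

lemma admissible_exp_moments:
  fixes m :: "nat ^ 'n::finite \<Rightarrow> real"
  assumes m: "admissible m" and z: "0 \<le> z"
  shows "admissible (exp_moments j z m)"
proof -
  from m obtain C \<rho> where C: "0 \<le> C" "0 \<le> \<rho>" and *: "\<And>\<mu>. m \<mu> \<le> C * \<rho> ^ (\<Sum>k\<in>UNIV. \<mu> $ k)"
    unfolding admissible_def by blast
  have le: "m (upd \<mu> j (\<mu> $ j + l)) \<le> C * \<rho> ^ (\<Sum>k\<in>UNIV. \<mu> $ k) * \<rho> ^ l" for \<mu> l
    using *[of "upd \<mu> j (\<mu> $ j + l)"] sum_upd[of \<mu> j "\<mu> $ j + l"] sum_upd[of \<mu> j "\<mu> $ j"]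
    by (simp only: power_add mult.assoc upd_same add.assoc)
  have "exp_moments j z m \<mu> \<le> C * exp (z * \<rho>) * \<rho> ^ (\<Sum>k\<in>UNIV. \<mu> $ k)" for \<mu>
    unfolding exp_moments_def
    using suminf_exp_growth_le[OF admissible_nonneg[OF m] le z, of \<mu>]
    by (simp add: mult_ac)
  moreover have "0 \<le> exp_moments j z m \<mu>" for \<mu>
    unfolding exp_moments_def
    using z admissible_nonneg[OF m] by (intro suminf_nonneg summable_exp_growth[OF _ le]) auto
  ultimately show ?thesis
    unfolding admissible_def using good_exp_moments[OF m z] C by (meson exp_ge_zero mult_nonneg_nonneg)
qed

lemma slot_shift_nonneg:
  fixes e :: "nat \<Rightarrow> real"
  assumes "0 \<le> s" "0 \<le> y" "\<And>b. 0 \<le> e b"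
  shows "0 \<le> slot_shift s y e k"
  using assms(3) by (induction k arbitrary: e) (simp_all add: assms(1,2))

lemma slot_shift_growth:
  fixes e :: "nat \<Rightarrow> real"
  assumes "0 \<le> s" "0 \<le> y" "\<And>b. e b \<le> A * \<rho> ^ b"
  shows "slot_shift s y e k \<le> A * (y + s * \<rho>) ^ k"
  using assms(3)
proof (induction k arbitrary: e A)
  case (Suc k)
  have "slot_shift s y e k \<le> A * (y + s * \<rho>) ^ k"
    by (rule Suc.IH[OF Suc.prems])
  moreover have "slot_shift s y (\<lambda>b. e (Suc b)) k \<le> (A * \<rho>) * (y + s * \<rho>) ^ k"
    using Suc.prems[of "Suc b" for b] by (intro Suc.IH) (simp add: mult_ac)
  ultimately have "slot_shift s y e (Suc k) \<le> y * (A * (y + s * \<rho>) ^ k) + s * ((A * \<rho>) * (y + s * \<rho>) ^ k)"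
    using assms(1,2) by (auto intro!: add_mono mult_left_mono)
  then show ?case by (simp add: algebra_simps)
next
  case 0
  then show ?case using 0[of 0] by simp
qed

lemma admissible_shift_moments:
  fixes m :: "nat ^ 'n::finite \<Rightarrow> real"
  assumes m: "admissible m" and s: "0 \<le> s" and y: "0 \<le> y"
  shows "admissible (shift_moments j s y m)"
proof -
  from m obtain C \<rho> where C: "0 \<le> C" "0 \<le> \<rho>" and *: "\<And>\<mu>. m \<mu> \<le> C * \<rho> ^ (\<Sum>k\<in>UNIV. \<mu> $ k)"
    unfolding admissible_def by blast
  \<comment> \<open>In slot \<open>j\<close> the growth rate becomes \<open>y + s * \<rho>\<close>,
    in the other slots it is still \<open>\<rho>\<close>.\<close>
  define \<sigma> where "\<sigma> = max \<rho> (y + s * \<rho>)"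
  have \<sigma>: "\<rho> \<le> \<sigma>" "y + s * \<rho> \<le> \<sigma>" "0 \<le> \<sigma>" "0 \<le> y + s * \<rho>" using C s y by (auto simp: \<sigma>_def)
  have "shift_moments j s y m \<mu> \<le> C * \<sigma> ^ (\<Sum>k\<in>UNIV. \<mu> $ k)" for \<mu>
  proof -
    let ?r = "\<Sum>k\<in>UNIV. upd \<mu> j 0 $ k"
    have "m (upd \<mu> j b) \<le> C * \<rho> ^ ?r * \<rho> ^ b" for b
      using *[of "upd \<mu> j b"] by (simp only: sum_upd[of \<mu> j b] power_add mult.assoc)
    then have "shift_moments j s y m \<mu> \<le> C * \<rho> ^ ?r * (y + s * \<rho>) ^ (\<mu> $ j)"
      unfolding shift_moments_def by (intro slot_shift_growth s y)
    also have "\<dots> \<le> C * \<sigma> ^ ?r * \<sigma> ^ (\<mu> $ j)"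
      using C \<sigma> by (intro mult_mono mult_left_mono power_mono) auto
    also have "\<dots> = C * \<sigma> ^ (?r + \<mu> $ j)" by (simp add: power_add)
    also have "?r + \<mu> $ j = (\<Sum>k\<in>UNIV. \<mu> $ k)"
      using sum_upd[of \<mu> j "\<mu> $ j"] by simp
    finally show ?thesis .
  qed
  moreover have "0 \<le> shift_moments j s y m \<mu>" for \<mu>
    unfolding shift_moments_def using s y admissible_nonneg[OF m] by (intro slot_shift_nonneg) auto
  ultimately show ?thesis
    unfolding admissible_def using good_moments_shift[of m s j y] m s C(1) \<sigma>(3)
    by (auto simp: admissible_def)
qed

section \<open>Real polynomials inside complex ones, and the Rayleigh inequality\<close>

definition complexify :: "'n::finite rpoly \<Rightarrow> 'n cpoly" where
  "complexify p = (\<Sum>\<mu>\<in>Poly_Mapping.keys p. Poly_Mapping.single \<mu> (of_real (Poly_Mapping.lookup p \<mu>)))"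

lemma mfun_complexify: "mfun m (complexify p) = (\<Sum>\<mu>\<in>Poly_Mapping.keys p. of_real (Poly_Mapping.lookup p \<mu>) * m \<mu>)"
  by (simp add: complexify_def mfun_sum)

lemma mfun_complexify_of_real: "mfun (\<lambda>\<mu>. of_real (m \<mu>)) (complexify p) = of_real (mfun m p)"
  unfolding mfun_complexify by (simp add: mfun_def)

lemma ceval_complexify: "ceval (complexify p) z = poly_eval p z"
  by (simp add: mfun_complexify poly_eval_def)

lemma slot_shift_has_field_derivative_y:
  fixes s y :: "'b::real_normed_field"
  shows "((\<lambda>y. slot_shift s y e k) has_field_derivative of_nat k * slot_shift s y e (k - 1)) (at y)"
proof (induction k arbitrary: e)
  case (Suc k)
  have "((\<lambda>y. slot_shift s y e (Suc k)) has_field_derivative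
      (1 * slot_shift s y e k + (of_nat k * slot_shift s y e (k - 1)) * y) + s * (of_nat k * slot_shift s y (\<lambda>b. e (Suc b)) (k - 1))) (at y)"
    unfolding slot_shift.simps by (intro derivative_intros DERIV_mult DERIV_cmult Suc.IH)
  moreover have "(1 * slot_shift s y e k + (of_nat k * slot_shift s y e (k - 1)) * y) + s * (of_nat k * slot_shift s y (\<lambda>b. e (Suc b)) (k - 1))
     = of_nat (Suc k) * slot_shift s y e (Suc k - 1)"
    by (cases k) (simp_all add: algebra_simps)
  ultimately show ?case by simp
qed simp

lemma slot_shift_1_0 [simp]: "slot_shift 1 0 e k = e k"
  by (induction k arbitrary: e) simp_all

text \<open>The derivative at \<open>t = 0\<close> of the defining inequality of \<open>good_moments\<close> for \<open>p(x + \<i> t e\<^sub>j)\<close>.\<close>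

lemma rayleigh:
  fixes p :: "'n::finite rpoly" and m :: "nat ^ 'n \<Rightarrow> real"
  assumes good: "good_moments m" and p: "real_stable p" "p \<noteq> 0"
  shows "mfun (\<lambda>\<mu>. m (axis j 1 + \<mu>)) p * mfun (\<lambda>\<mu>. real (\<mu> $ j) * m (upd \<mu> j (\<mu> $ j - 1))) p
       \<le> mfun m p * mfun (\<lambda>\<mu>. real (\<mu> $ j) * m \<mu>) p"
proof -
  let ?cm = "\<lambda>\<mu>. of_real (m \<mu>) :: complex"
  let ?c = "\<lambda>\<mu>. of_real (Poly_Mapping.lookup p \<mu>) :: complex"
  let ?K = "Poly_Mapping.keys p"
  define A where "A y = (\<Sum>\<mu>\<in>?K. ?c \<mu> * slot_shift 1 y (\<lambda>b. ?cm (upd \<mu> j b)) (\<mu> $ j))" for y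
  define B where "B y = (\<Sum>\<mu>\<in>?K. ?c \<mu> * slot_shift 1 y (\<lambda>b. ?cm (upd \<mu> j (Suc b))) (\<mu> $ j))" for y
  define a0 where "a0 = mfun m p"
  define a1 where "a1 = mfun (\<lambda>\<mu>. real (\<mu> $ j) * m (upd \<mu> j (\<mu> $ j - 1))) p"
  define b0 where "b0 = mfun (\<lambda>\<mu>. m (axis j 1 + \<mu>)) p"
  define b1 where "b1 = mfun (\<lambda>\<mu>. real (\<mu> $ j) * m \<mu>) p"
  have A0: "A 0 = of_real a0" by (simp add: A_def a0_def mfun_def)
  have B0: "B 0 = of_real b0" by (simp add: B_def b0_def mfun_def axis_add)
  have A1: "(A has_field_derivative of_real a1) (at 0)"
  proof -
    have "(A has_field_derivative (\<Sum>\<mu>\<in>?K. ?c \<mu> * (of_nat (\<mu> $ j) * slot_shift 1 0 (\<lambda>b. ?cm (upd \<mu> j b)) (\<mu> $ j - 1)))) (at 0)"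
      unfolding A_def by (intro DERIV_sum DERIV_cmult slot_shift_has_field_derivative_y)
    then show ?thesis by (simp add: a1_def mfun_def)
  qed
  have B1: "(B has_field_derivative of_real b1) (at 0)"
  proof -
    have "(B has_field_derivative (\<Sum>\<mu>\<in>?K. ?c \<mu> * (of_nat (\<mu> $ j) * slot_shift 1 0 (\<lambda>b. ?cm (upd \<mu> j (Suc b))) (\<mu> $ j - 1)))) (at 0)"
      unfolding B_def by (intro DERIV_sum DERIV_cmult slot_shift_has_field_derivative_y)
    \<comment> \<open>Truncated subtraction at exponent 0 is harmless, since the factor in front
      vanishes there.\<close>
    moreover have "of_nat (\<mu> $ j) * ?cm (upd \<mu> j (Suc (\<mu> $ j - 1))) = of_nat (\<mu> $ j) * ?cm \<mu>" for \<mu>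
      by (cases "\<mu> $ j") (simp_all, metis upd_same)
    ultimately show ?thesis
      unfolding b1_def mfun_def slot_shift_1_0 by (simp only: of_real_sum of_real_mult of_real_of_nat_eq)
  qed
  have it: "((\<lambda>t. \<i> * of_real t) has_vector_derivative \<i>) (at 0)"
    by (auto intro!: derivative_eq_intros)
  have A2: "((\<lambda>t. A (\<i> * of_real t)) has_vector_derivative \<i> * of_real a1) (at 0)"
    using field_vector_diff_chain_at[OF it, of A] A1 by (simp add: o_def)
  have B2: "((\<lambda>t. B (\<i> * of_real t)) has_vector_derivative \<i> * of_real b1) (at 0)"
    using field_vector_diff_chain_at[OF it, of B] B1 by (simp add: o_def)
  define h where "h t = Im (A (\<i> * of_real t) * cnj (B (\<i> * of_real t)))" for t
  have "((\<lambda>t. A (\<i> * of_real t) * cnj (B (\<i> * of_real t))) has_vector_derivative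
      A (\<i> * of_real 0) * cnj (\<i> * of_real b1) + \<i> * of_real a1 * cnj (B (\<i> * of_real 0))) (at 0)"
    by (intro has_vector_derivative_mult A2 has_vector_derivative_cnj B2)
  then have "(h has_real_derivative Im (A (\<i> * of_real 0) * cnj (\<i> * of_real b1) + \<i> * of_real a1 * cnj (B (\<i> * of_real 0)))) (at 0)"
    unfolding h_def
    by (subst has_real_derivative_iff_has_vector_derivative)
       (rule bounded_linear.has_vector_derivative[OF bounded_linear_Im])
  then have deriv: "(h has_real_derivative (a1 * b0 - a0 * b1)) (at 0)"
    by (simp add: A0 B0)
  have h: "h t \<le> 0" if "0 < t" for t
  proof -
    let ?S = "subst_slot j (of_real 1) (\<i> * of_real t) (complexify p)"
    have "complex_stable (complexify p)"
      using p by (auto simp: complex_stable_def ceval_complexify real_stable_def upper_def)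
    then have "complex_stable ?S"
      using that by (intro complex_stable_subst_slot) auto
    from good_momentsD[OF good this, of j] show ?thesis
      by (simp add: h_def A_def B_def mfun_subst_slot mfun_complexify shift_moments_def axis_add_upd)
  qed
  \<comment> \<open>At 0 both functional values are real, so \<open>h 0 = 0\<close>; a positive
    derivative would make \<open>h\<close> positive just to the right, against stability for t >
    0.\<close>
  have "a1 * b0 - a0 * b1 \<le> 0"
  proof (rule ccontr)
    assume "\<not> ?thesis"
    then obtain d where "d > 0" "\<forall>t>0. t < d \<longrightarrow> h 0 < h (0 + t)"
      using DERIV_pos_inc_right[OF deriv] by auto
    then have "h 0 < h (d/2)" by simp
    moreover have "h 0 = 0" by (simp add: h_def A0 B0)
    ultimately show False using h[of "d/2"] \<open>d > 0\<close> by simp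
  qed
  then show ?thesis by (simp add: a0_def a1_def b0_def b1_def mult.commute)
qed

section \<open>Operators preserving real stability\<close>

lemma lookup_scaleR_pm: "Poly_Mapping.lookup (r *\<^sub>R p) \<mu> = r * Poly_Mapping.lookup p \<mu>"
  for p :: "'k \<Rightarrow>\<^sub>0 real"
proof -
  have "{k. r *\<^sub>R Poly_Mapping.lookup p k \<noteq> 0} \<subseteq> Poly_Mapping.keys p"
    by (auto simp: in_keys_iff)
  then have "finite {k. r *\<^sub>R Poly_Mapping.lookup p k \<noteq> 0}"
    by (rule finite_subset) simp
  then show ?thesis by (simp add: scaleR_poly_mapping_def)
qed

lemma mfun_complexify_superset:
  assumes "finite A" "Poly_Mapping.keys p \<subseteq> A"
  shows "mfun m (complexify p) = (\<Sum>\<mu>\<in>A. of_real (Poly_Mapping.lookup p \<mu>) * m \<mu>)"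
  unfolding mfun_complexify using assms by (intro sum.mono_neutral_left) (auto simp: in_keys_iff)

lemma mfun_complexify_add: "mfun m (complexify (p + q)) = mfun m (complexify p) + mfun m (complexify q)"
proof -
  let ?A = "Poly_Mapping.keys p \<union> Poly_Mapping.keys q"
  have "Poly_Mapping.keys (p + q) \<subseteq> ?A" by (rule Poly_Mapping.keys_add)
  then show ?thesis
    by (subst (1 2 3) mfun_complexify_superset[where A = ?A])
       (auto simp: lookup_add distrib_right sum.distrib)
qed

lemma mfun_complexify_scaleR: "mfun m (complexify (r *\<^sub>R p)) = of_real r * mfun m (complexify p)"
proof -
  have "Poly_Mapping.keys (r *\<^sub>R p) \<subseteq> Poly_Mapping.keys p"
    by (auto simp: in_keys_iff lookup_scaleR_pm)
  then show ?thesis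
    by (subst (1 2) mfun_complexify_superset[where A = "Poly_Mapping.keys p"])
       (auto simp: lookup_scaleR_pm sum_distrib_left mult.assoc)
qed

lemma linear_mfun_complexify: "linear (\<lambda>p. mfun m (complexify p))"
  by (rule linearI) (simp_all add: mfun_complexify_add mfun_complexify_scaleR scaleR_conv_of_real)

lemma linear_poly_eval: "linear (\<lambda>p. poly_eval p (z :: complex ^ 'n::finite))"
  using linear_mfun_complexify[of "\<lambda>\<mu>. mono_eval \<mu> z"] by (simp add: ceval_complexify)

lemma real_stable_scaleR_iff:
  assumes "r \<noteq> 0"
  shows "real_stable (r *\<^sub>R p) \<longleftrightarrow> real_stable p"
proof -
  have "poly_eval (r *\<^sub>R p) z = of_real r * poly_eval p z" for z :: "complex ^ 'a"
    using linear_cmul[OF linear_poly_eval[of z], of r p] by (simp add: scaleR_conv_of_real)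
  with assms show ?thesis by (simp add: real_stable_def)
qed

lemma rpoly_expand: "p = (\<Sum>\<mu>\<in>Poly_Mapping.keys p. Poly_Mapping.lookup p \<mu> *\<^sub>R monomial \<mu>)"
  by (rule poly_mapping_eqI)
     (auto simp: lookup_sum lookup_scaleR_pm monomial_def lookup_single when_def in_keys_iff
        if_distrib[of "(*) _"] cong: if_cong)

lemma op_rank_le_2:
  fixes T :: "'n::finite rpoly \<Rightarrow> 'm::finite rpoly"
  assumes T: "linear T" and stable: "\<And>p. real_stable (T p)"
  shows "op_rank T \<le> 2"
proof -
  define ev where "ev p = poly_eval p ((\<chi> k. \<i>) :: complex ^ 'm)" for p :: "'m rpoly"
  have ev: "linear ev" unfolding ev_def by (rule linear_poly_eval)
  have sub: "subspace (range T)" using T by (simp add: linear_subspace_image)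
  \<comment> \<open>Finiteness must come before any count, because \<open>op_rank\<close> reads off
    \<open>dim\<close> only if the image has a finite spanning set. The bound is the real dimension
    of the complex plane.\<close>
  obtain B where B: "B \<subseteq> range T" "independent B" "range T \<subseteq> span B"
    using real_vector.maximal_independent_subset by blast
  have "span B \<subseteq> range T" using B(1) sub by (simp add: span_minimal)
  then have span: "p \<in> range T" if "p \<in> span B" for p using that by blast
  have inj: "inj_on ev (span B)"
  proof (subst linear_inj_on_iff_eq_0[OF ev], simp, intro ballI impI)
    fix p assume "p \<in> span B" "ev p = 0"
    then show "p = 0" using stable span unfolding real_stable_def ev_def by force
  qed
  then have "independent (ev ` B)"
    using linear_independent_injective_image[OF ev B(2)] by simp
  then have fin: "finite (ev ` B)" "card (ev ` B) \<le> 2"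
    using independent_bound[of "ev ` B"] by auto
  have injB: "inj_on ev B" using inj by (rule inj_on_subset) (simp add: span_superset)
  then have fB: "finite B" using fin(1) finite_image_iff by blast
  have "card B \<le> 2" using fin(2) card_image[OF injB] by simp
  moreover have "dim (range T) \<le> card B" using B(3) fB by (rule real_vector.dim_le_card)
  ultimately have "dim (range T) \<le> 2" by simp
  moreover have "\<exists>B. finite B \<and> range T \<subseteq> span B" using fB B(3) by blast
  ultimately show ?thesis unfolding op_rank_def by (simp add: numeral_eq_enat)
qed

text \<open>The polynomial Re(c S) with c the conjugate of \<open>\<gamma>\<close>. As
  \<open>\<gamma>\<close> varies, these are the real combinations of the real and the imaginary part
  of \<open>S\<close>.\<close>

definition real_part_along :: "complex \<Rightarrow> 'n::finite cpoly \<Rightarrow> 'n rpoly" where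
  "real_part_along \<gamma> S = (\<Sum>\<mu>\<in>Poly_Mapping.keys S. Poly_Mapping.single \<mu> (Re (cnj \<gamma> * Poly_Mapping.lookup S \<mu>)))"

lemma lookup_real_part_along: "Poly_Mapping.lookup (real_part_along \<gamma> S) \<mu> = Re (cnj \<gamma> * Poly_Mapping.lookup S \<mu>)"
  by (auto simp: real_part_along_def lookup_sum lookup_single when_def in_keys_iff)

lemma lookup_complexify: "Poly_Mapping.lookup (complexify p) \<mu> = of_real (Poly_Mapping.lookup p \<mu>)"
  by (auto simp: complexify_def lookup_sum lookup_single when_def in_keys_iff)

lemma lookup_cC_mult: "Poly_Mapping.lookup (cC a * S) \<mu> = a * Poly_Mapping.lookup S \<mu>"
  by (simp add: map.rep_eq when_def flip: mult_map_scale_conv_mult)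

lemma keys_real_part_along: "Poly_Mapping.keys (real_part_along \<gamma> S) \<subseteq> Poly_Mapping.keys S"
  by (auto simp: in_keys_iff lookup_real_part_along)

text \<open>Writing a real part as half the sum with its conjugate shows when the functional can
  vanish: the two summands must have equal modulus.\<close>

lemma mfun_real_part_along:
  "mfun \<tau> (complexify (real_part_along \<gamma> S)) = (cnj \<gamma> * mfun \<tau> S + \<gamma> * cnj (mfun (\<lambda>\<mu>. cnj (\<tau> \<mu>)) S)) / 2"
proof -
  have *: "of_real (Re (cnj \<gamma> * c)) = (cnj \<gamma> * c + \<gamma> * cnj c) / 2" for c
    by (simp add: complex_eq_iff)
  have "mfun \<tau> (complexify (real_part_along \<gamma> S)) = (\<Sum>\<mu>\<in>Poly_Mapping.keys S.
      (cnj \<gamma> * (Poly_Mapping.lookup S \<mu> * \<tau> \<mu>) + \<gamma> * cnj (Poly_Mapping.lookup S \<mu> * cnj (\<tau> \<mu>))) / 2)"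
    by (subst mfun_complexify_superset[OF _ keys_real_part_along])
       (simp_all only: finite_keys lookup_real_part_along *, simp add: field_simps)
  also have "\<dots> = (cnj \<gamma> * mfun \<tau> S + \<gamma> * cnj (mfun (\<lambda>\<mu>. cnj (\<tau> \<mu>)) S)) / 2"
    unfolding mfun_def cnj_sum sum_distrib_left sum.distrib[symmetric] sum_divide_distrib ..
  finally show ?thesis .
qed

text \<open>Equal moduli make -B / A unimodular; the conjugate of a square root of it is the
  direction.\<close>

lemma exists_annihilating_direction:
  assumes "cmod A = cmod B"
  obtains \<gamma> where "\<gamma> \<noteq> 0" "cnj \<gamma> * A + \<gamma> * B = 0"
proof (cases "A = 0")
  case True
  with assms have "B = 0" by simp
  with True show ?thesis using that[of 1] by simp
next
  case False
  define \<omega> where "\<omega> = csqrt (- B / A)"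
  have \<omega>: "\<omega>\<^sup>2 = - B / A" by (simp add: \<omega>_def)
  have "cmod \<omega> ^ 2 = 1" using assms[symmetric] False by (simp flip: norm_power add: \<omega> norm_divide)
  then have "\<omega> * cnj \<omega> = 1" by (simp flip: complex_norm_square)
  then have "\<omega> * A + cnj \<omega> * B = cnj \<omega> * (\<omega>\<^sup>2 * A + B)"
    by (simp add: algebra_simps power2_eq_square)
  also have "\<omega>\<^sup>2 * A + B = 0" using False by (simp add: \<omega>)
  finally have "\<omega> * A + cnj \<omega> * B = 0" by simp
  moreover have "cnj \<omega> \<noteq> 0" using \<open>\<omega> * cnj \<omega> = 1\<close> by auto
  ultimately show ?thesis using that[of "cnj \<omega>"] by simp
qed

text \<open>The growth condition with the full degree \<open>N\<close> also excludes zeros at infinity, which makes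
  strict stability an open condition among polynomials of degree at most \<open>N\<close> in each variable.\<close>

definition strictly_stable :: "nat \<Rightarrow> 'n::finite cpoly \<Rightarrow> bool" where
  "strictly_stable N S \<longleftrightarrow> (\<exists>c>0. \<forall>z. (\<forall>k. 0 \<le> Im (z $ k)) \<longrightarrow>
     c * (\<Prod>k\<in>UNIV. (1 + cmod (z $ k)) ^ N) \<le> cmod (ceval S z))"

definition degree_box :: "nat \<Rightarrow> (nat ^ 'n::finite) set" where
  "degree_box N = {\<mu>. \<forall>k. \<mu> $ k \<le> N}"

lemma finite_degree_box [simp]: "finite (degree_box N :: (nat ^ 'n::finite) set)"
proof -
  have "degree_box N \<subseteq> vec_lambda ` (UNIV \<rightarrow>\<^sub>E {..N} :: ('n \<Rightarrow> nat) set)"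
  proof
    fix \<mu> :: "nat ^ 'n" assume "\<mu> \<in> degree_box N"
    then have "vec_nth \<mu> \<in> (UNIV \<rightarrow>\<^sub>E {..N})" by (auto simp: degree_box_def)
    then show "\<mu> \<in> vec_lambda ` (UNIV \<rightarrow>\<^sub>E {..N} :: ('n \<Rightarrow> nat) set)"
      by (metis image_eqI vec_nth_inverse)
  qed
  then show ?thesis by (rule finite_subset) (intro finite_imageI finite_PiE, auto)
qed

lemma finite_subset_degree_box:
  fixes F :: "(nat ^ 'n::finite) set"
  assumes "finite F"
  obtains N where "F \<subseteq> degree_box N"
proof
  show "F \<subseteq> degree_box (\<Sum>\<mu>\<in>F. \<Sum>k\<in>UNIV. \<mu> $ k)"
  proof
    fix \<mu> assume \<mu>: "\<mu> \<in> F"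
    have "\<mu> $ k \<le> (\<Sum>\<mu>\<in>F. \<Sum>k\<in>UNIV. \<mu> $ k)" for k
    proof -
      have "\<mu> $ k \<le> (\<Sum>k\<in>UNIV. \<mu> $ k)" by (rule member_le_sum) auto
      also have "\<dots> \<le> (\<Sum>\<mu>\<in>F. \<Sum>k\<in>UNIV. \<mu> $ k)"
        using \<mu> assms by (intro member_le_sum[of \<mu> F "\<lambda>\<mu>. \<Sum>k\<in>UNIV. \<mu> $ k"]) auto
      finally show ?thesis .
    qed
    then show "\<mu> \<in> degree_box (\<Sum>\<mu>\<in>F. \<Sum>k\<in>UNIV. \<mu> $ k)" by (simp add: degree_box_def)
  qed
qed

lemma norm_mono_eval_le:
  fixes z :: "complex ^ 'n::finite"
  assumes "\<mu> \<in> degree_box N"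
  shows "cmod (mono_eval \<mu> z) \<le> (\<Prod>k\<in>UNIV. (1 + cmod (z $ k)) ^ N)"
  unfolding mono_eval_def prod_norm[symmetric]
proof (intro prod_mono conjI)
  fix k
  have "cmod (z $ k ^ \<mu> $ k) \<le> (1 + cmod (z $ k)) ^ (\<mu> $ k)"
    by (simp add: norm_power power_mono)
  also have "\<dots> \<le> (1 + cmod (z $ k)) ^ N"
    using assms by (intro power_increasing) (auto simp: degree_box_def)
  finally show "cmod (z $ k ^ \<mu> $ k) \<le> (1 + cmod (z $ k)) ^ N" .
qed simp

text \<open>Every monomial of the box is dominated by the product in \<open>strictly_stable\<close>,
  hence so is \<open>G\<close>, with a constant \<open>M\<close>. The choice of
  \<open>\<epsilon>\<close> spends half of the lower bound c.\<close>

lemma strictly_stable_perturb: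
  assumes S: "strictly_stable N S" and G: "Poly_Mapping.keys G \<subseteq> degree_box N"
  obtains \<epsilon> :: real where "0 < \<epsilon>" "strictly_stable N (S + cC (of_real \<epsilon>) * G)"
proof -
  from S obtain c where c: "c > 0"
    and *: "\<And>z. (\<forall>k. 0 \<le> Im (z $ k)) \<Longrightarrow> c * (\<Prod>k\<in>UNIV. (1 + cmod (z $ k)) ^ N) \<le> cmod (ceval S z)"
    unfolding strictly_stable_def by blast
  define M where "M = 1 + (\<Sum>\<mu>\<in>Poly_Mapping.keys G. cmod (Poly_Mapping.lookup G \<mu>))"
  have M: "M > 0" unfolding M_def by (intro add_pos_nonneg sum_nonneg) auto
  have GM: "cmod (ceval G z) \<le> M * (\<Prod>k\<in>UNIV. (1 + cmod (z $ k)) ^ N)" for z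
  proof -
    let ?P = "\<Prod>k\<in>UNIV. (1 + cmod (z $ k)) ^ N"
    have "cmod (ceval G z) \<le> (\<Sum>\<mu>\<in>Poly_Mapping.keys G. cmod (Poly_Mapping.lookup G \<mu>) * ?P)"
      unfolding mfun_def using G
      by (intro sum_norm_le) (auto simp: norm_mult intro!: mult_left_mono norm_mono_eval_le)
    also have "\<dots> \<le> M * ?P"
      unfolding M_def by (simp add: distrib_right sum_distrib_right prod_nonneg)
    finally show ?thesis .
  qed
  define \<epsilon> where "\<epsilon> = c / (2 * M)"
  have \<epsilon>: "\<epsilon> > 0" "\<epsilon> * M = c / 2" using c M by (simp_all add: \<epsilon>_def)
  have "c / 2 * (\<Prod>k\<in>UNIV. (1 + cmod (z $ k)) ^ N) \<le> cmod (ceval (S + cC (of_real \<epsilon>) * G) z)"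
    if "\<forall>k. 0 \<le> Im (z $ k)" for z
  proof -
    let ?P = "\<Prod>k\<in>UNIV. (1 + cmod (z $ k)) ^ N"
    have "c * ?P - \<epsilon> * (M * ?P) \<le> cmod (ceval S z) - cmod (of_real \<epsilon> * ceval G z)"
      using *[OF that] GM[of z] \<epsilon> by (intro diff_mono) (auto simp: norm_mult)
    also have "\<dots> \<le> cmod (ceval S z + of_real \<epsilon> * ceval G z)"
      by (rule norm_diff_ineq)
    also have "c * ?P - \<epsilon> * (M * ?P) = c / 2 * ?P"
      using \<epsilon>(2) by (simp add: algebra_simps flip: mult.assoc)
    finally show ?thesis by (simp add: mfun_add mfun_single_mult)
  qed
  with c have "strictly_stable N (S + cC (of_real \<epsilon>) * G)"
    unfolding strictly_stable_def by (intro exI[of _ "c/2"]) auto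
  with \<epsilon>(1) show thesis by (rule that)
qed

text \<open>All roots lie in the open lower half-plane, hence closer to -i than to i; the linear
  factors multiply up, strictly as soon as there is one.\<close>

lemma norm_poly_minus_i_le:
  fixes s :: "complex poly"
  assumes "\<And>t. 0 \<le> Im t \<Longrightarrow> poly s t \<noteq> 0"
  shows "cmod (poly s (-\<i>)) \<le> cmod (poly s \<i>) \<and> (degree s \<noteq> 0 \<longrightarrow> cmod (poly s (-\<i>)) < cmod (poly s \<i>))"
  using assms
proof (induction "degree s" arbitrary: s)
  case 0
  then obtain a where "s = [:a:]" by (metis degree_eq_zeroE)
  then show ?case by simp
next
  case (Suc n)
  then have "\<not> constant (poly s)" by (simp add: constant_degree)
  then obtain r where r: "poly s r = 0" using fundamental_theorem_of_algebra by blast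
  then obtain q where q: "s = [:-r, 1:] * q" by (auto simp: poly_eq_0_iff_dvd elim: dvdE)
  have "s \<noteq> 0" using Suc.hyps(2) by auto
  then have "degree s = Suc (degree q)" using q by (simp add: degree_mult_eq del: mult_pCons_left)
  then have "n = degree q" using Suc.hyps(2) by simp
  then have IH: "cmod (poly q (-\<i>)) \<le> cmod (poly q \<i>)"
    using Suc.hyps(1)[of q] Suc.prems q by auto
  have "Im r < 0" using Suc.prems r by (meson not_le)
  then have lt: "cmod (-\<i> - r) < cmod (\<i> - r)"
    by (simp add: cmod_def power2_eq_square algebra_simps)
  have "poly q \<i> \<noteq> 0" using Suc.prems[of \<i>] q by auto
  then have "cmod (-\<i> - r) * cmod (poly q (-\<i>)) < cmod (\<i> - r) * cmod (poly q \<i>)"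
    using IH by (intro le_less_trans[OF mult_left_mono mult_strict_right_mono[OF lt]]) auto
  then show ?case by (simp add: q norm_mult[symmetric] algebra_simps)
qed

definition vcnj :: "complex ^ 'n \<Rightarrow> complex ^ 'n::finite" where
  "vcnj z = (\<chi> k. cnj (z $ k))"

lemma cnj_mono_eval: "cnj (mono_eval \<mu> z) = mono_eval \<mu> (vcnj z)"
  by (simp add: mono_eval_def vcnj_def)

lemma cnj_poly_eval: "cnj (poly_eval p z) = poly_eval p (vcnj z)"
  by (simp add: poly_eval_def cnj_mono_eval)

text \<open>On the complex line t -> Re z + t Im z the points z and its conjugate sit at i and -i,
  and the upper half-plane is mapped to the upper half-space. This reduces the claim to one
  variable. Strictness needs a non-constant restriction, which the growth condition with positive
  \<open>N\<close> provides.\<close>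

lemma strictly_stable_conj_less:
  fixes S :: "'n::finite cpoly"
  assumes S: "strictly_stable N S" and N: "0 < N" and z: "z \<in> upper"
  shows "cmod (ceval S (vcnj z)) < cmod (ceval S z)"
proof -
  from S obtain c where c: "c > 0"
    and *: "\<And>z. (\<forall>k. 0 \<le> Im (z $ k)) \<Longrightarrow> c * (\<Prod>k\<in>UNIV. (1 + cmod (z $ k)) ^ N) \<le> cmod (ceval S z)"
    unfolding strictly_stable_def by blast
  define line where "line t = (\<chi> k. of_real (Re (z $ k)) + t * of_real (Im (z $ k)))" for t :: complex
  define s where "s = (\<Sum>\<mu>\<in>Poly_Mapping.keys S. smult (Poly_Mapping.lookup S \<mu>)
      (\<Prod>k\<in>UNIV. [:of_real (Re (z $ k)), of_real (Im (z $ k)):] ^ (\<mu> $ k)))"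
  have s: "poly s t = ceval S (line t)" for t
    by (simp add: s_def poly_sum poly_prod mfun_def mono_eval_def line_def)
  have i: "line \<i> = z" "line (-\<i>) = vcnj z"
    by (simp_all add: line_def vcnj_def vec_eq_iff complex_eq_iff)
  have ge: "c * (\<Prod>k\<in>UNIV. (1 + cmod (line t $ k)) ^ N) \<le> cmod (poly s t)" if "0 \<le> Im t" for t
    unfolding s using that z by (intro *) (auto simp: line_def upper_def less_imp_le)
  have pos: "0 < (\<Prod>k\<in>UNIV. (1 + cmod (line t $ k)) ^ N)" for t
    by (intro prod_pos) (auto simp: add_pos_nonneg)
  have nz: "poly s t \<noteq> 0" if "0 \<le> Im t" for t
    using ge[OF that] c pos[of t] by (smt (verit) mult_pos_pos norm_zero)
  have "degree s \<noteq> 0"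
  proof
    assume "degree s = 0"
    then obtain a where a: "s = [:a:]" by (rule degree_eq_zeroE)
    obtain k :: 'n where "True" by simp
    define b where "b = Im (z $ k)"
    have b: "b > 0" using z by (simp add: upper_def b_def)
    \<comment> \<open>So far out that coordinate \<open>k\<close> has modulus at least |a| / c; the
      growth condition then gives c + |a| <= |a|.\<close>
    define t where "t = ((cmod a / c + \<bar>Re (z $ k)\<bar>) / b :: real)"
    have t: "0 \<le> t" "t * b = cmod a / c + \<bar>Re (z $ k)\<bar>" using b c by (simp_all add: t_def)
    let ?z = "line (of_real t)"
    have "cmod (?z $ k) \<ge> cmod a / c"
    proof -
      have "?z $ k = of_real (Re (z $ k) + t * b)" by (simp add: line_def b_def)
      then have "cmod (?z $ k) = \<bar>Re (z $ k) + t * b\<bar>" by (simp only: norm_of_real)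
      then show ?thesis using t(2) by linarith
    qed
    then have "1 + cmod a / c \<le> (1 + cmod (?z $ k)) ^ 1" by simp
    also have "\<dots> \<le> (1 + cmod (?z $ k)) ^ N" using N by (intro power_increasing) auto
    also have "\<dots> \<le> (\<Prod>k\<in>UNIV. (1 + cmod (?z $ k)) ^ N)"
    proof -
      have "1 \<le> (\<Prod>i\<in>UNIV - {k}. (1 + cmod (?z $ i)) ^ N)"
        by (intro prod_ge_1 one_le_power) auto
      from mult_left_mono[OF this, of "(1 + cmod (?z $ k)) ^ N"] show ?thesis
        by (simp add: prod.remove[of _ k])
    qed
    finally have "c * (1 + cmod a / c) \<le> c * (\<Prod>k\<in>UNIV. (1 + cmod (?z $ k)) ^ N)"
      using c by (intro mult_left_mono) auto
    also have "\<dots> \<le> cmod a" using ge[of "of_real t"] a by simp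
    finally show False using c by (simp add: distrib_left)
  qed
  then show ?thesis using norm_poly_minus_i_le[OF nz] s i by simp
qed

text \<open>The mechanism of the Hermite-Biehler theorem: at a zero, \<open>S\<close> would have
  equal moduli at z and at its conjugate.\<close>

lemma strictly_stable_real_part_along_nonzero:
  assumes "strictly_stable N S" "0 < N" "z \<in> upper" "\<gamma> \<noteq> 0"
  shows "poly_eval (real_part_along \<gamma> S) z \<noteq> 0"
proof
  assume "poly_eval (real_part_along \<gamma> S) z = 0"
  then have "cnj \<gamma> * ceval S z + \<gamma> * cnj (ceval S (vcnj z)) = 0"
    by (simp add: mfun_real_part_along cnj_mono_eval flip: ceval_complexify)
  then have "cmod (cnj \<gamma> * ceval S z) = cmod (\<gamma> * cnj (ceval S (vcnj z)))"
    by (metis add_eq_0_iff norm_minus_cancel)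
  then have "cmod (ceval S z) = cmod (ceval S (vcnj z))"
    using assms(4) by (simp add: norm_mult)
  with strictly_stable_conj_less[OF assms(1-3)] show False by simp
qed

lemma real_stable_real_part_along:
  assumes "strictly_stable N S" "0 < N" "\<gamma> \<noteq> 0"
  shows "real_stable (real_part_along \<gamma> S)"
  using strictly_stable_real_part_along_nonzero[OF assms(1,2) _ assms(3)]
  by (auto simp: real_stable_def upper_def)

text \<open>Through \<open>mfun\<close> this becomes the complex-linear extension of
  \<open>T\<close>, followed by evaluation at \<open>\<zeta>\<close>.\<close>

definition symbol_moments :: "('n::finite rpoly \<Rightarrow> 'm::finite rpoly) \<Rightarrow> complex ^ 'm \<Rightarrow> nat ^ 'n \<Rightarrow> complex" where
  "symbol_moments T \<zeta> \<mu> = poly_eval (T (monomial \<mu>)) \<zeta>"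

lemma mfun_symbol_moments:
  assumes "linear T"
  shows "mfun (symbol_moments T \<zeta>) (complexify p) = poly_eval (T p) \<zeta>"
proof -
  have lin: "linear (\<lambda>p. poly_eval (T p) \<zeta>)"
    using linear_compose[OF assms linear_poly_eval[of \<zeta>]] by (simp add: o_def)
  have "poly_eval (T p) \<zeta> = (\<Sum>\<mu>\<in>Poly_Mapping.keys p. Poly_Mapping.lookup p \<mu> *\<^sub>R poly_eval (T (monomial \<mu>)) \<zeta>)"
    by (subst rpoly_expand) (simp add: linear_sum[OF lin] linear_cmul[OF lin])
  then show ?thesis by (simp add: mfun_complexify symbol_moments_def scaleR_conv_of_real)
qed

text \<open>If \<open>T\<close> kills the real part of a strictly stable polynomial, then \<open>T\<close> applied to small real
  perturbations of it shows that \<open>T\<close> maps every polynomial in the degree degree_box to a real stable one.\<close>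

lemma real_part_along_kernel_imp_all_stable:
  assumes T: "linear T" "preserves_real_stability T"
    and S: "strictly_stable N S" "0 < N" and \<gamma>: "\<gamma> \<noteq> 0" and ker: "T (real_part_along \<gamma> S) = 0"
    and G: "Poly_Mapping.keys G \<subseteq> degree_box N"
  shows "real_stable (T G)"
proof -
  have "Poly_Mapping.keys (cC \<gamma> * complexify G) \<subseteq> degree_box N"
    using G by (auto simp: in_keys_iff lookup_cC_mult lookup_complexify)
  from strictly_stable_perturb[OF S(1) this]
  obtain \<epsilon> where \<epsilon>: "0 < \<epsilon>" "strictly_stable N (S + cC (of_real \<epsilon>) * (cC \<gamma> * complexify G))" .
  define r where "r = \<epsilon> * (cmod \<gamma>)\<^sup>2"
  have "real_part_along \<gamma> (S + cC (of_real \<epsilon>) * (cC \<gamma> * complexify G)) = real_part_along \<gamma> S + r *\<^sub>R G"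
  proof (rule poly_mapping_eqI)
    fix \<mu>
    have "Re (cnj \<gamma> * (c + of_real \<epsilon> * (\<gamma> * of_real g))) = Re (cnj \<gamma> * c) + r * g" for c g
      by (simp add: r_def cmod_def power2_eq_square algebra_simps)
    then show "Poly_Mapping.lookup (real_part_along \<gamma> (S + cC (of_real \<epsilon>) * (cC \<gamma> * complexify G))) \<mu>
        = Poly_Mapping.lookup (real_part_along \<gamma> S + r *\<^sub>R G) \<mu>"
      by (simp only: lookup_real_part_along lookup_add lookup_cC_mult lookup_complexify lookup_scaleR_pm)
  qed
  then have "real_stable (T (real_part_along \<gamma> S + r *\<^sub>R G))"
    using real_stable_real_part_along[OF \<epsilon>(2) S(2) \<gamma>] T(2) by (metis preserves_real_stability_def)
  then have "real_stable (r *\<^sub>R T G)"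
    using T(1) ker by (simp add: linear_add linear_cmul)
  then show ?thesis
    using \<epsilon>(1) \<gamma> by (simp add: real_stable_scaleR_iff r_def)
qed

text \<open>Equal moduli would give a direction for which the image under \<open>T\<close> vanishes
  at \<open>\<zeta>\<close>. Being real stable, that image is zero, and then \<open>G\<close> could
  not exist. Since equality is excluded, the order of the two moduli cannot change along a connected
  family.\<close>

lemma symbol_moments_norm_neq:
  assumes T: "linear T" "preserves_real_stability T"
    and S: "strictly_stable N S" "0 < N"
    and G: "Poly_Mapping.keys G \<subseteq> degree_box N" "\<not> real_stable (T G)"
    and \<zeta>: "\<zeta> \<in> upper"
  shows "cmod (mfun (symbol_moments T \<zeta>) S) \<noteq> cmod (mfun (symbol_moments T (vcnj \<zeta>)) S)"
proof
  assume "cmod (mfun (symbol_moments T \<zeta>) S) = cmod (mfun (symbol_moments T (vcnj \<zeta>)) S)"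
  then have "cmod (mfun (symbol_moments T \<zeta>) S) = cmod (cnj (mfun (symbol_moments T (vcnj \<zeta>)) S))"
    by simp
  then obtain \<gamma> where \<gamma>: "\<gamma> \<noteq> 0"
    and 0: "cnj \<gamma> * mfun (symbol_moments T \<zeta>) S + \<gamma> * cnj (mfun (symbol_moments T (vcnj \<zeta>)) S) = 0"
    by (rule exists_annihilating_direction)
  have "(\<lambda>\<mu>. cnj (symbol_moments T \<zeta> \<mu>)) = symbol_moments T (vcnj \<zeta>)"
    by (simp add: symbol_moments_def cnj_poly_eval fun_eq_iff)
  then have "poly_eval (T (real_part_along \<gamma> S)) \<zeta> = 0"
    using 0 by (simp add: mfun_real_part_along flip: mfun_symbol_moments[OF T(1)])
  moreover have "real_stable (T (real_part_along \<gamma> S))"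
    using real_stable_real_part_along[OF S \<gamma>] T(2) by (simp add: preserves_real_stability_def)
  ultimately have "T (real_part_along \<gamma> S) = 0"
    using \<zeta> by (auto simp: real_stable_def upper_def)
  then show False using real_part_along_kernel_imp_all_stable[OF T S \<gamma> _ G(1)] G(2) by simp
qed


text \<open>Coefficientwise convergence with uniformly bounded support, expressed through functionals so
  that no coefficient of a product has to be computed.\<close>

definition coeff_conv :: "(nat \<Rightarrow> 'n::finite cpoly) \<Rightarrow> 'n cpoly \<Rightarrow> bool" where
  "coeff_conv F S \<longleftrightarrow> (\<forall>\<tau>n \<tau>. (\<forall>\<mu>. (\<lambda>n. \<tau>n n \<mu>) \<longlonglongrightarrow> \<tau> \<mu>) \<longrightarrow> (\<lambda>n. mfun (\<tau>n n) (F n)) \<longlonglongrightarrow> mfun \<tau> S)"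

lemma coeff_convD:
  "coeff_conv F S \<Longrightarrow> (\<And>\<mu>. (\<lambda>n. \<tau>n n \<mu>) \<longlonglongrightarrow> \<tau> \<mu>) \<Longrightarrow> (\<lambda>n. mfun (\<tau>n n) (F n)) \<longlonglongrightarrow> mfun \<tau> S"
  by (simp add: coeff_conv_def)

lemma coeff_conv_const: "coeff_conv (\<lambda>n. S) S"
  by (simp add: coeff_conv_def tendsto_mfun)

lemma coeff_conv_sum: "(\<And>i. i \<in> I \<Longrightarrow> coeff_conv (\<lambda>n. F n i) (S i)) \<Longrightarrow> coeff_conv (\<lambda>n. \<Sum>i\<in>I. F n i) (\<Sum>i\<in>I. S i)"
  unfolding coeff_conv_def mfun_sum by (intro allI impI tendsto_sum) blast

lemma coeff_conv_cC_mult: "coeff_conv F S \<Longrightarrow> coeff_conv (\<lambda>n. cC a * F n) (cC a * S)"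
  unfolding coeff_conv_def mfun_single_mult by (auto intro!: tendsto_mult_left)

lemma coeff_conv_lin_mult:
  assumes "coeff_conv F S" "a \<longlonglongrightarrow> a'" "b \<longlonglongrightarrow> b'"
  shows "coeff_conv (\<lambda>n. (cC (a n) + cC (b n) * cX k) * F n) ((cC a' + cC b' * cX k) * S)"
  unfolding coeff_conv_def mfun_lin_mult
  by (intro allI impI tendsto_add tendsto_mult assms(2,3) coeff_convD[OF assms(1)]) simp_all

lemma coeff_conv_lin_power_mult:
  assumes "coeff_conv F S" "a \<longlonglongrightarrow> a'" "b \<longlonglongrightarrow> b'"
  shows "coeff_conv (\<lambda>n. (cC (a n) + cC (b n) * cX k) ^ l * F n) ((cC a' + cC b' * cX k) ^ l * S)"
proof (induction l)
  case (Suc l)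
  then show ?case using coeff_conv_lin_mult[OF Suc assms(2,3)] by (simp only: power_Suc mult.assoc)
qed (simp add: assms(1))

text \<open>Up to the nonvanishing factor \<open>(1 - \<i> \<delta> x\<^sub>k)\<^sup>N\<close> per variable, this is the substitution of the
  Moebius map \<open>(x\<^sub>k + \<i> \<delta>) / (1 - \<i> \<delta> x\<^sub>k)\<close>, which sends the closed upper half-plane and infinity into
  a compact part of the open upper half-plane.\<close>

definition cayley :: "nat \<Rightarrow> real \<Rightarrow> 'n::finite cpoly \<Rightarrow> 'n cpoly" where
  "cayley N \<delta> S = (\<Sum>\<mu>\<in>Poly_Mapping.keys S. cC (Poly_Mapping.lookup S \<mu>) *
     (\<Prod>k\<in>UNIV. (cC (\<i> * of_real \<delta>) + cC 1 * cX k) ^ (\<mu> $ k)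
        * (cC 1 + cC (- \<i> * of_real \<delta>) * cX k) ^ (N - \<mu> $ k)))"

lemma prod_cX_power: "(\<Prod>k\<in>UNIV. cX k ^ (\<mu> $ k)) = Poly_Mapping.single \<mu> 1"
proof -
  have pow: "cX k ^ l = Poly_Mapping.single (axis k l) 1" for k :: 'a and l
  proof (induction l)
    case 0
    have "axis k 0 = (0 :: nat ^ 'a)" by (simp add: axis_eq_0_iff)
    then show ?case by (simp only: power_0 single_one)
  next
    case (Suc l)
    have "axis k 1 + axis k l = (axis k (Suc l) :: nat ^ 'a)" by (simp add: vec_eq_iff axis_def)
    then show ?case using Suc by (simp add: mult_single)
  qed
  have "(\<Prod>k\<in>I. Poly_Mapping.single (axis k (\<mu> $ k)) 1) = (Poly_Mapping.single (\<Sum>k\<in>I. axis k (\<mu> $ k)) 1 :: 'a cpoly)"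
    for I
    by (induction I rule: infinite_finite_induct) (simp_all add: mult_single)
  moreover have "(\<Sum>k\<in>UNIV. axis k (\<mu> $ k)) = \<mu>"
    by (simp add: vec_eq_iff axis_def)
  ultimately show ?thesis by (simp only: pow)
qed

lemma coeff_conv_cayley:
  assumes "\<delta> \<longlonglongrightarrow> 0"
  shows "coeff_conv (\<lambda>n. cayley N (\<delta> n) S) S"
proof -
  let ?F = "\<lambda>\<delta> \<mu> k. (cC (\<i> * of_real \<delta>) + cC 1 * cX k) ^ (\<mu> $ k)
        * (cC 1 + cC (- \<i> * of_real \<delta>) * cX k) ^ (N - \<mu> $ k)"
  let ?G = "\<lambda>\<mu> k. (cC 0 + cC 1 * cX k) ^ (\<mu> $ k) * (cC 1 + cC 0 * cX k) ^ (N - \<mu> $ k)"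
  have a: "(\<lambda>n. \<i> * complex_of_real (\<delta> n)) \<longlonglongrightarrow> 0" and b: "(\<lambda>n. - \<i> * complex_of_real (\<delta> n)) \<longlonglongrightarrow> 0"
    using tendsto_mult_left[OF tendsto_of_real[OF assms], of \<i>] 
      tendsto_mult_left[OF tendsto_of_real[OF assms], of "- \<i>"] by simp_all
  have prod: "coeff_conv (\<lambda>n. \<Prod>k\<in>I. ?F (\<delta> n) \<mu> k) (\<Prod>k\<in>I. ?G \<mu> k)" for I and \<mu> :: "nat ^ 'a"
  proof (induction I rule: infinite_finite_induct)
    case (insert k I)
    have "coeff_conv (\<lambda>n. ?F (\<delta> n) \<mu> k * (\<Prod>k\<in>I. ?F (\<delta> n) \<mu> k)) (?G \<mu> k * (\<Prod>k\<in>I. ?G \<mu> k))"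
      unfolding mult.assoc by (intro coeff_conv_lin_power_mult insert a b tendsto_const)
    then show ?case unfolding prod.insert[OF insert.hyps] .
  qed (simp_all add: coeff_conv_const)
  have "coeff_conv (\<lambda>n. cayley N (\<delta> n) S)
      (\<Sum>\<mu>\<in>Poly_Mapping.keys S. cC (Poly_Mapping.lookup S \<mu>) * (\<Prod>k\<in>UNIV. ?G \<mu> k))"
    unfolding cayley_def by (intro coeff_conv_sum coeff_conv_cC_mult prod)
  also have "(\<Sum>\<mu>\<in>Poly_Mapping.keys S. cC (Poly_Mapping.lookup S \<mu>) * (\<Prod>k\<in>UNIV. ?G \<mu> k)) = S"
  proof -
    have "(\<Prod>k\<in>UNIV. ?G \<mu> k) = Poly_Mapping.single \<mu> 1" for \<mu> :: "nat ^ 'a"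
      by (simp only: single_zero single_one mult_zero_left add_0 add_0_right mult_1 power_one mult_1_right prod_cX_power)
    then show ?thesis by (simp add: mult_single flip: poly_mapping_expand)
  qed
  finally show ?thesis .
qed

section \<open>The Cayley substitution turns stable polynomials into strictly stable ones\<close>

definition cayley_map :: "real \<Rightarrow> complex \<Rightarrow> complex" where
  "cayley_map \<delta> z = (z + \<i> * of_real \<delta>) / (1 - \<i> * of_real \<delta> * z)"

text \<open>The modulus is at least 1, by the real part, and at least
  \<open>\<delta> * cmod z\<close>; averaging gives a bound of the shape required by
  \<open>strictly_stable\<close>.\<close>

lemma cayley_denom_ge:
  assumes "0 < \<delta>" "\<delta> \<le> 1" "0 \<le> Im z"
  shows "\<delta> / 2 * (1 + cmod z) \<le> cmod (1 - \<i> * of_real \<delta> * z)"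
proof -
  let ?u = "1 - \<i> * of_real \<delta> * z"
  have "1 \<le> Re ?u" using assms by simp
  then have 1: "1 \<le> cmod ?u" using complex_Re_le_cmod[of ?u] by linarith
  have "(\<delta> * cmod z)\<^sup>2 \<le> (cmod ?u)\<^sup>2"
    unfolding power_mult_distrib cmod_power2 using assms
    by (simp add: power2_eq_square algebra_simps add_nonneg_nonneg)
  then have 2: "\<delta> * cmod z \<le> cmod ?u" by (rule power2_le_imp_le) simp
  have "\<delta> * (1 + cmod z) \<le> 1 + \<delta> * cmod z" using assms by (simp add: algebra_simps)
  with 1 2 show ?thesis by simp
qed

lemma cayley_map_bounds:
  assumes \<delta>: "0 < \<delta>" "\<delta> \<le> 1" and z: "0 \<le> Im z"
  shows "\<delta> / 2 \<le> Im (cayley_map \<delta> z)" "cmod (cayley_map \<delta> z) \<le> 2 / \<delta>"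
proof -
  let ?u = "1 - \<i> * of_real \<delta> * z"
  have u: "\<delta> / 2 * (1 + cmod z) \<le> cmod ?u" by (rule cayley_denom_ge[OF assms])
  have "0 < \<delta> / 2 * (1 + cmod z)" using \<delta> by (simp add: add_pos_nonneg)
  with u have u0: "0 < cmod ?u" by linarith
  have "cmod ?u \<le> 1 + cmod (\<i> * of_real \<delta> * z)" using norm_triangle_ineq4[of 1 "\<i> * of_real \<delta> * z"] by simp
  also have "\<dots> \<le> 1 + cmod z" using \<delta> by (simp add: norm_mult mult_left_le_one_le)
  finally have "(cmod ?u)\<^sup>2 \<le> (1 + cmod z)\<^sup>2" by (intro power_mono) auto
  also have "\<dots> \<le> 2 * (1 + (cmod z)\<^sup>2)"
    using zero_le_power2[of "1 - cmod z"] by (simp add: power2_eq_square algebra_simps)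
  finally have usq: "(cmod ?u)\<^sup>2 \<le> 2 * (1 + (cmod z)\<^sup>2)" .
  have "Im (cayley_map \<delta> z) = Im ((z + \<i> * of_real \<delta>) * cnj ?u) / (cmod ?u)\<^sup>2"
    unfolding cayley_map_def by (simp only: complex_div_cnj[of _ ?u] Im_divide_of_real of_real_power[symmetric])
  also have "Im ((z + \<i> * of_real \<delta>) * cnj ?u) = Im z + \<delta> * (1 + (cmod z)\<^sup>2) + \<delta>\<^sup>2 * Im z"
    unfolding cmod_power2 by (simp add: power2_eq_square algebra_simps)
  finally have Im: "Im (cayley_map \<delta> z) = (Im z + \<delta> * (1 + (cmod z)\<^sup>2) + \<delta>\<^sup>2 * Im z) / (cmod ?u)\<^sup>2" .
  have "\<delta> / 2 * (cmod ?u)\<^sup>2 \<le> \<delta> / 2 * (2 * (1 + (cmod z)\<^sup>2))"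
    using usq \<delta> by (intro mult_left_mono) auto
  also have "\<dots> \<le> Im z + \<delta> * (1 + (cmod z)\<^sup>2) + \<delta>\<^sup>2 * Im z"
    using z mult_nonneg_nonneg[OF zero_le_power2[of \<delta>] z] by (simp add: algebra_simps)
  finally show "\<delta> / 2 \<le> Im (cayley_map \<delta> z)"
    unfolding Im using u0 by (simp add: pos_le_divide_eq)
  have "cmod (z + \<i> * of_real \<delta>) \<le> cmod z + 1"
    using norm_triangle_ineq[of z "\<i> * of_real \<delta>"] \<delta> by (simp add: norm_mult)
  also have "\<dots> \<le> 2 / \<delta> * cmod ?u" using u \<delta> by (simp add: field_simps)
  finally show "cmod (cayley_map \<delta> z) \<le> 2 / \<delta>"
    unfolding cayley_map_def norm_divide using u0 by (simp add: pos_divide_le_eq)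
qed

lemma ceval_cayley:
  fixes S :: "'n::finite cpoly"
  assumes S: "Poly_Mapping.keys S \<subseteq> degree_box N" and \<delta>: "0 < \<delta>" "\<delta> \<le> 1" and z: "\<forall>k. 0 \<le> Im (z $ k)"
  shows "ceval (cayley N \<delta> S) z
    = (\<Prod>k\<in>UNIV. (1 - \<i> * of_real \<delta> * z $ k) ^ N) * ceval S (\<chi> k. cayley_map \<delta> (z $ k))"
proof -
  have u0: "1 - \<i> * of_real \<delta> * z $ k \<noteq> 0" for k
  proof -
    have "0 < \<delta> / 2 * (1 + cmod (z $ k))" using \<delta> by (simp add: add_pos_nonneg)
    also have "\<dots> \<le> cmod (1 - \<i> * of_real \<delta> * z $ k)" using z by (intro cayley_denom_ge \<delta>) auto
    finally show ?thesis by (simp only: zero_less_norm_iff not_False_eq_True)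
  qed
  have lin: "ceval (cC 1 + cC (- \<i> * of_real \<delta>) * cX k) z = 1 - \<i> * of_real \<delta> * z $ k"
    "ceval (cC (\<i> * of_real \<delta>) + cC 1 * cX k) z = z $ k + \<i> * of_real \<delta>" for k
    unfolding ceval_lin by simp_all
  have "ceval (cayley N \<delta> S) z = (\<Sum>\<mu>\<in>Poly_Mapping.keys S. Poly_Mapping.lookup S \<mu> *
     (\<Prod>k\<in>UNIV. (z $ k + \<i> * of_real \<delta>) ^ (\<mu> $ k) * (1 - \<i> * of_real \<delta> * z $ k) ^ (N - \<mu> $ k)))"
    unfolding cayley_def mfun_sum ceval_mult ceval_prod ceval_power lin by simp
  also have "\<dots> = (\<Sum>\<mu>\<in>Poly_Mapping.keys S. (\<Prod>k\<in>UNIV. (1 - \<i> * of_real \<delta> * z $ k) ^ N) *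
     (Poly_Mapping.lookup S \<mu> * mono_eval \<mu> (\<chi> k. cayley_map \<delta> (z $ k))))"
  proof (intro sum.cong refl)
    fix \<mu> assume "\<mu> \<in> Poly_Mapping.keys S"
    with S have \<mu>: "\<mu> $ k \<le> N" for k by (auto simp: degree_box_def)
    have "(z $ k + \<i> * of_real \<delta>) ^ (\<mu> $ k) * (1 - \<i> * of_real \<delta> * z $ k) ^ (N - \<mu> $ k)
        = (1 - \<i> * of_real \<delta> * z $ k) ^ N * cayley_map \<delta> (z $ k) ^ (\<mu> $ k)" for k
      using u0[of k] \<mu>[of k] by (simp add: cayley_map_def power_divide power_diff)
    then show "Poly_Mapping.lookup S \<mu> *
       (\<Prod>k\<in>UNIV. (z $ k + \<i> * of_real \<delta>) ^ (\<mu> $ k) * (1 - \<i> * of_real \<delta> * z $ k) ^ (N - \<mu> $ k))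
      = (\<Prod>k\<in>UNIV. (1 - \<i> * of_real \<delta> * z $ k) ^ N) *
       (Poly_Mapping.lookup S \<mu> * mono_eval \<mu> (\<chi> k. cayley_map \<delta> (z $ k)))"
      by (simp add: mono_eval_def prod.distrib)
  qed
  finally show ?thesis by (simp add: mfun_def sum_distrib_left)
qed

lemma compact_half_plane_polybox:
  "compact {u :: complex ^ 'n::finite. \<forall>k. a \<le> Im (u $ k) \<and> cmod (u $ k) \<le> R}"
proof -
  have "closed {u :: complex ^ 'n. \<forall>k. a \<le> Im (u $ k) \<and> cmod (u $ k) \<le> R}"
    by (intro closed_Collect_all closed_Collect_conj closed_Collect_le continuous_intros)
  moreover have "bounded {u :: complex ^ 'n. \<forall>k. a \<le> Im (u $ k) \<and> cmod (u $ k) \<le> R}"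
  proof (rule boundedI)
    fix u :: "complex ^ 'n" assume u: "u \<in> {u. \<forall>k. a \<le> Im (u $ k) \<and> cmod (u $ k) \<le> R}"
    have "norm u \<le> (\<Sum>k\<in>UNIV. cmod (u $ k))"
      unfolding norm_vec_def by (rule L2_set_le_sum) simp
    also have "\<dots> \<le> (\<Sum>k\<in>(UNIV :: 'n set). R)" using u by (intro sum_mono) auto
    finally show "norm u \<le> (\<Sum>k\<in>(UNIV :: 'n set). R)" .
  qed
  ultimately show ?thesis by (simp add: compact_eq_bounded_closed)
qed

lemma continuous_on_ceval [continuous_intros]: "continuous_on A (\<lambda>z. ceval S z)"
  unfolding mfun_def mono_eval_def by (intro continuous_intros)

text \<open>Up to the denominators this is (1 - w x_j) S at a point of a compact part of the open
  half-space, where it has a positive minimum; the denominators supply the growth. The two terms are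
  kept apart so that functionals of the result are affine in w.\<close>

lemma strictly_stable_cayley:
  fixes S :: "'n::finite cpoly"
  assumes S: "complex_stable S" and w: "0 < Im w" and \<delta>: "0 < \<delta>" "\<delta> \<le> 1"
    and N: "Poly_Mapping.keys S \<subseteq> degree_box N" "Poly_Mapping.keys (cX j * S) \<subseteq> degree_box N"
  shows "strictly_stable N (cayley N \<delta> S + cC (- w) * cayley N \<delta> (cX j * S))"
proof -
  let ?K = "{u :: complex ^ 'n. \<forall>k. \<delta> / 2 \<le> Im (u $ k) \<and> cmod (u $ k) \<le> 2 / \<delta>}"
  let ?h = "\<lambda>u. cmod ((1 - w * u $ j) * ceval S u)"
  have cont: "continuous_on ?K ?h" by (intro continuous_intros)
  have ne: "?K \<noteq> {}"
  proof -
    have ne_emptyI: "A \<noteq> {}" if "x \<in> A" for x and A :: "(complex ^ 'n) set" using that by auto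
    have "\<delta> / 2 \<le> 1" "1 \<le> 2 / \<delta>" using \<delta> by (simp_all add: field_simps)
    then have "\<delta> / 2 \<le> 2 / \<delta>" by linarith
    moreover have "cmod (\<i> * of_real (\<delta> / 2)) = \<bar>\<delta> / 2\<bar>" by (simp only: norm_mult norm_ii norm_of_real mult_1)
    ultimately have "(\<chi> k. \<i> * of_real (\<delta> / 2)) \<in> ?K" using \<delta>
      by (simp only: mem_Collect_eq vec_lambda_beta Im_i_times Re_complex_of_real abs_of_pos half_gt_zero simp_thms order.refl)
    then show ?thesis by (rule ne_emptyI)
  qed
  obtain u0 where u0: "u0 \<in> ?K" and "\<forall>u\<in>?K. ?h u0 \<le> ?h u"
    using continuous_attains_inf[OF compact_half_plane_polybox ne cont] by (elim bexE)
  then have u0_min: "?h u0 \<le> ?h u" if "u \<in> ?K" for u using that by (rule_tac bspec)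
  have "u0 \<in> upper"
    unfolding upper_def
  proof (intro CollectI allI)
    fix k
    have "0 < \<delta> / 2" using \<delta> by simp
    also have "\<dots> \<le> Im (u0 $ k)" using u0 by blast
    finally show "0 < Im (u0 $ k)" .
  qed
  then have Imj: "0 < Im (u0 $ j)" and "ceval S u0 \<noteq> 0" using S by (auto simp: upper_def complex_stable_def)
  moreover have "1 - w * u0 $ j \<noteq> 0"
  proof
    assume "1 - w * u0 $ j = 0"
    then have eq: "w * u0 $ j = 1" by simp
    then have "w \<noteq> 0" by auto
    with eq have "u0 $ j = 1 / w" by (simp add: field_simps)
    moreover have "0 < (Re w)\<^sup>2 + (Im w)\<^sup>2" using w by (simp add: add_nonneg_pos)
    ultimately have "Im (u0 $ j) < 0" using w by (simp add: Im_divide)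
    with Imj show False by simp
  qed
  ultimately have h0: "0 < ?h u0" by simp
  \<comment> \<open>The minimum on the compact set times one factor
    \<open>(\<delta> / 2) ^ N\<close> from the denominators of each variable.\<close>
  define c where "c = (\<delta> / 2) ^ (N * CARD('n)) * ?h u0"
  have c: "0 < c" using h0 \<delta> by (simp only: c_def mult_pos_pos zero_less_power zero_less_divide_iff zero_less_numeral simp_thms)
  have "c * (\<Prod>k\<in>UNIV. (1 + cmod (z $ k)) ^ N)
      \<le> cmod (ceval (cayley N \<delta> S + cC (- w) * cayley N \<delta> (cX j * S)) z)"
    if z: "\<forall>k. 0 \<le> Im (z $ k)" for z
  proof -
    let ?u = "\<chi> k. cayley_map \<delta> (z $ k)"
    let ?P = "\<Prod>k\<in>UNIV. (1 - \<i> * of_real \<delta> * z $ k) ^ N"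
    have uK: "?u \<in> ?K" using cayley_map_bounds[OF \<delta>] z by simp
    have "ceval (cayley N \<delta> S + cC (- w) * cayley N \<delta> (cX j * S)) z
        = ?P * ceval S ?u - w * (?P * ceval (cX j * S) ?u)"
      by (simp only: mfun_add ceval_mult mfun_single mono_eval_zero ceval_cayley[OF N(1) \<delta> z] ceval_cayley[OF N(2) \<delta> z])
         simp
    also have "ceval (cX j * S) ?u = ?u $ j * ceval S ?u"
      unfolding ceval_mult mfun_single mono_eval_axis by simp
    also have "?P * ceval S ?u - w * (?P * (?u $ j * ceval S ?u)) = ?P * ((1 - w * ?u $ j) * ceval S ?u)"
      by (simp only: left_diff_distrib right_diff_distrib mult_1 mult_ac)
    finally have eq: "cmod (ceval (cayley N \<delta> S + cC (- w) * cayley N \<delta> (cX j * S)) z) = cmod ?P * ?h ?u"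
      by (simp only: norm_mult)
    have "(\<delta> / 2) ^ (N * CARD('n)) * (\<Prod>k\<in>UNIV. (1 + cmod (z $ k)) ^ N)
        = (\<Prod>k\<in>(UNIV :: 'n set). (\<delta> / 2 * (1 + cmod (z $ k))) ^ N)"
      by (simp only: power_mult_distrib prod.distrib power_mult prod_constant)
    also have "\<dots> \<le> (\<Prod>k\<in>UNIV. cmod (1 - \<i> * of_real \<delta> * z $ k) ^ N)"
      using z \<delta> by (intro prod_mono conjI power_mono cayley_denom_ge) (auto intro!: zero_le_power mult_nonneg_nonneg)
    also have "\<dots> = cmod ?P" by (simp add: norm_power prod_norm[symmetric])
    finally have "(\<delta> / 2) ^ (N * CARD('n)) * (\<Prod>k\<in>UNIV. (1 + cmod (z $ k)) ^ N) * ?h u0 \<le> cmod ?P * ?h ?u"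
      using u0_min[OF uK] by (intro mult_mono) auto
    then show ?thesis unfolding eq c_def by (simp only: mult_ac)
  qed
  with c show ?thesis unfolding strictly_stable_def by blast
qed

text \<open>If c is non-zero, the only zero in w is a / c, whose imaginary part has the sign of Im
  (a cnj c).\<close>

lemma Im_mult_cnj_nonpos:
  assumes "\<And>w. 0 < Im w \<Longrightarrow> a - w * c \<noteq> 0"
  shows "Im (a * cnj c) \<le> 0"
proof (rule ccontr)
  assume *: "\<not> ?thesis"
  then have c: "c \<noteq> 0" by auto
  have "Im (a / c) = Im (a * cnj c) / (cmod c)\<^sup>2"
    by (simp only: complex_div_cnj[of a c] Im_divide_of_real of_real_power[symmetric])
  then have "0 < Im (a / c)" using * c by simp
  from assms[OF this] c show False by simp
qed

text \<open>For fixed \<open>\<delta>\<close> and \<open>\<zeta>\<close> the difference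
  \<open>g\<close> of the two moduli is continuous and has no zero on the half-plane of w, so it
  keeps its sign there. The larger modulus never vanishes, which gives the inequality at
  \<open>\<zeta>\<close> or at its conjugate. Letting \<open>\<delta>\<close> tend to 0 and
  \<open>\<zeta>\<close> to x gives it for \<open>S\<close> itself.\<close>

lemma good_moments_operator:
  fixes T :: "'n::finite rpoly \<Rightarrow> 'm::finite rpoly" and x :: "real ^ 'm"
  assumes T: "linear T" "preserves_real_stability T" and rank: "2 < op_rank T"
  shows "good_moments (\<lambda>\<mu>. poly_eval (T (monomial \<mu>)) x)"
  unfolding good_moments_def
proof (intro allI impI)
  fix S :: "'n cpoly" and j assume S: "complex_stable S"
  obtain G where G: "\<not> real_stable (T G)"
    using op_rank_le_2[OF T(1)] rank by (meson not_le)
  define A where "A = Poly_Mapping.keys G \<union> Poly_Mapping.keys S \<union> Poly_Mapping.keys (cX j * S)"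
  have "finite A" by (simp add: A_def)
  then obtain M where "A \<subseteq> degree_box M" by (rule finite_subset_degree_box)
  \<comment> \<open>The successor guarantees a positive degree bound, which the strict inequality
    between conjugate points requires.\<close>
  define N where "N = Suc M"
  have "A \<subseteq> degree_box N"
    using \<open>A \<subseteq> degree_box M\<close> by (auto simp: degree_box_def N_def le_SucI)
  then have N: "Poly_Mapping.keys G \<subseteq> degree_box N" "Poly_Mapping.keys S \<subseteq> degree_box N" "Poly_Mapping.keys (cX j * S) \<subseteq> degree_box N"
    by (auto simp: A_def)
  define a where "a \<delta> \<zeta> = mfun (symbol_moments T \<zeta>) (cayley N \<delta> S)" for \<delta> \<zeta>
  define c where "c \<delta> \<zeta> = mfun (symbol_moments T \<zeta>) (cayley N \<delta> (cX j * S))" for \<delta> \<zeta>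
  have dich: "Im (a \<delta> \<zeta> * cnj (c \<delta> \<zeta>)) \<le> 0 \<or> Im (a \<delta> (vcnj \<zeta>) * cnj (c \<delta> (vcnj \<zeta>))) \<le> 0"
    if \<delta>: "0 < \<delta>" "\<delta> \<le> 1" and \<zeta>: "\<zeta> \<in> upper" for \<delta> \<zeta>
  proof -
    define g where "g w = cmod (a \<delta> \<zeta> - w * c \<delta> \<zeta>) - cmod (a \<delta> (vcnj \<zeta>) - w * c \<delta> (vcnj \<zeta>))" for w
    have g0: "g w \<noteq> 0" if "0 < Im w" for w
    proof -
      have "mfun (symbol_moments T \<zeta>) (cayley N \<delta> S + cC (- w) * cayley N \<delta> (cX j * S)) = a \<delta> \<zeta> - w * c \<delta> \<zeta>" for \<zeta>
        unfolding mfun_add mfun_single_mult a_def c_def by simp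
      then show ?thesis
        using symbol_moments_norm_neq[OF T strictly_stable_cayley[OF S that \<delta> N(2,3)] _ N(1) G \<zeta>]
        by (simp add: g_def N_def)
    qed
    have conn: "connected (g ` {w. 0 < Im w})"
      unfolding g_def
      by (intro connected_continuous_image continuous_intros convex_connected convex_halfspace_Im_gt)
    have "(\<forall>w. 0 < Im w \<longrightarrow> 0 < g w) \<or> (\<forall>w. 0 < Im w \<longrightarrow> g w < 0)"
    proof (rule ccontr)
      assume "\<not> ?thesis"
      then obtain w w' where w: "0 < Im w" "g w \<le> 0" "0 < Im w'" "0 \<le> g w'" by (auto simp: not_less)
      then have "0 \<in> g ` {w. 0 < Im w}"
        using connectedD_interval[OF conn, of "g w" "g w'" 0] by blast
      then show False using g0 by auto
    qed
    then show ?thesis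
    proof
      assume *: "\<forall>w. 0 < Im w \<longrightarrow> 0 < g w"
      have "Im (a \<delta> \<zeta> * cnj (c \<delta> \<zeta>)) \<le> 0"
      proof (rule Im_mult_cnj_nonpos)
        fix w assume "0 < Im w"
        then have "0 < g w" using * by blast
        then have "0 < cmod (a \<delta> \<zeta> - w * c \<delta> \<zeta>)" unfolding g_def by (smt (verit) norm_ge_zero)
        then show "a \<delta> \<zeta> - w * c \<delta> \<zeta> \<noteq> 0" by simp
      qed
      then show ?thesis ..
    next
      assume *: "\<forall>w. 0 < Im w \<longrightarrow> g w < 0"
      have "Im (a \<delta> (vcnj \<zeta>) * cnj (c \<delta> (vcnj \<zeta>))) \<le> 0"
      proof (rule Im_mult_cnj_nonpos)
        fix w assume "0 < Im w"
        then have "g w < 0" using * by blast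
        then have "0 < cmod (a \<delta> (vcnj \<zeta>) - w * c \<delta> (vcnj \<zeta>))" unfolding g_def by (smt (verit) norm_ge_zero)
        then show "a \<delta> (vcnj \<zeta>) - w * c \<delta> (vcnj \<zeta>) \<noteq> 0" by simp
      qed
      then show ?thesis ..
    qed
  qed
  define \<delta>n where "\<delta>n n = 1 / real (Suc n)" for n
  have \<delta>n: "\<delta>n \<longlonglongrightarrow> 0"
    unfolding \<delta>n_def using LIMSEQ_inverse_real_of_nat by (simp only: inverse_eq_divide)
  have \<delta>n01: "0 < \<delta>n n" "\<delta>n n \<le> 1" for n by (simp_all add: \<delta>n_def)
  define up where "up n = (\<chi> k. of_real (x $ k) + \<i> * of_real (\<delta>n n))" for n
  have "up n \<in> upper" for n using \<delta>n01[of n] by (simp add: up_def upper_def)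
  \<comment> \<open>Which of the two points works may depend on n; since both converge to x, the
    choice disappears in the limit.\<close>
  then have "\<exists>\<zeta>. (\<zeta> = up n \<or> \<zeta> = vcnj (up n)) \<and> Im (a (\<delta>n n) \<zeta> * cnj (c (\<delta>n n) \<zeta>)) \<le> 0" for n
    using dich[OF \<delta>n01] by blast
  then obtain \<zeta> where \<zeta>: "\<And>n. \<zeta> n = up n \<or> \<zeta> n = vcnj (up n)"
    and le: "\<And>n. Im (a (\<delta>n n) (\<zeta> n) * cnj (c (\<delta>n n) (\<zeta> n))) \<le> 0"
    by metis
  have "(\<lambda>n. \<zeta> n $ k) \<longlonglongrightarrow> of_real (x $ k)" for k
  proof (rule Lim_null[THEN iffD2], rule tendsto_norm_zero_cancel, rule Lim_transform_eventually[OF \<delta>n])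
    show "\<forall>\<^sub>F n in sequentially. \<delta>n n = cmod (\<zeta> n $ k - of_real (x $ k))"
    proof (rule always_eventually, rule allI)
      fix n show "\<delta>n n = cmod (\<zeta> n $ k - of_real (x $ k))"
        using \<zeta>[of n] \<delta>n01[of n] by (auto simp: up_def vcnj_def norm_mult)
    qed
  qed
  then have lim\<zeta>: "\<zeta> \<longlonglongrightarrow> (\<chi> k. of_real (x $ k))" by (intro vec_tendstoI) simp
  have real_eval: "poly_eval p (\<chi> k. of_real (x $ k)) = complex_of_real (poly_eval p x)" for p
    by (simp add: poly_eval_def mono_eval_def)
  have lim: "(\<lambda>n. symbol_moments T (\<zeta> n) \<mu>) \<longlonglongrightarrow> of_real (poly_eval (T (monomial \<mu>)) x)" for \<mu>
    unfolding symbol_moments_def real_eval[symmetric]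
    unfolding poly_eval_def mono_eval_def
    by (intro tendsto_intros tendsto_vec_nth lim\<zeta>)
  have lim_a: "(\<lambda>n. a (\<delta>n n) (\<zeta> n)) \<longlonglongrightarrow> mfun (\<lambda>\<mu>. of_real (poly_eval (T (monomial \<mu>)) x)) S"
    unfolding a_def by (rule coeff_convD[OF coeff_conv_cayley[OF \<delta>n] lim])
  have lim_c: "(\<lambda>n. c (\<delta>n n) (\<zeta> n)) \<longlonglongrightarrow> mfun (\<lambda>\<mu>. of_real (poly_eval (T (monomial \<mu>)) x)) (cX j * S)"
    unfolding c_def by (rule coeff_convD[OF coeff_conv_cayley[OF \<delta>n] lim])
  have "(\<lambda>n. Im (a (\<delta>n n) (\<zeta> n) * cnj (c (\<delta>n n) (\<zeta> n)))) \<longlonglongrightarrow>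
      Im (mfun (\<lambda>\<mu>. of_real (poly_eval (T (monomial \<mu>)) x)) S *
        cnj (mfun (\<lambda>\<mu>. of_real (poly_eval (T (monomial \<mu>)) x)) (cX j * S)))"
    by (intro tendsto_intros lim_a lim_c)
  then have "Im (mfun (\<lambda>\<mu>. of_real (poly_eval (T (monomial \<mu>)) x)) S *
        cnj (mfun (\<lambda>\<mu>. of_real (poly_eval (T (monomial \<mu>)) x)) (cX j * S))) \<le> 0"
    by (rule tendsto_upperbound) (use le in auto)
  then show "Im (mfun (\<lambda>\<mu>. of_real (poly_eval (T (monomial \<mu>)) x)) S *
        cnj (mfun (\<lambda>\<mu>. of_real (poly_eval (T (monomial (axis j 1 + \<mu>))) x)) S)) \<le> 0"
    by (simp only: mfun_single_mult mult_1)
qed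

section \<open>A comparison principle for a Hamilton--Jacobi inequality\<close>

text \<open>\<open>hj_sol\<close> solves \<open>\<partial>\<^sub>s w = \<partial>\<^sub>y w * \<partial>\<^sub>z w\<close> with \<open>w = \<alpha> ln (y z)\<close> at \<open>s = 0\<close>, and its value at
  \<open>s = 1\<close>, \<open>y = z = 0\<close> is \<open>\<alpha> ln \<alpha> - \<alpha>\<close>.  The method of characteristics gives it in terms of the positive root
  \<open>h\<close> of \<open>h\<^sup>2 - sqrt (y z) h = \<alpha> s\<close>.\<close>

definition hj_root :: "real \<Rightarrow> real \<Rightarrow> real \<Rightarrow> real \<Rightarrow> real" where
  "hj_root \<alpha> s y z = (sqrt (y * z) + sqrt (y * z + 4 * \<alpha> * s)) / 2"

definition hj_sol :: "real \<Rightarrow> real \<Rightarrow> real \<Rightarrow> real \<Rightarrow> real" where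
  "hj_sol \<alpha> s y z = 2 * \<alpha> * ln (hj_root \<alpha> s y z) - \<alpha>\<^sup>2 * s / (hj_root \<alpha> s y z)\<^sup>2"

context
  fixes \<alpha> s y z :: real
  assumes \<alpha>: "0 < \<alpha>" and s: "0 \<le> s" and y: "0 < y" and z: "0 < z"
begin

lemma hj_root_pos: "0 < hj_root \<alpha> s y z"
  using \<alpha> s y z unfolding hj_root_def by (auto intro!: add_pos_nonneg)

lemma hj_root_ge: "sqrt (y * z) \<le> hj_root \<alpha> s y z"
proof -
  have "sqrt (y * z) \<le> sqrt (y * z + 4 * \<alpha> * s)" using \<alpha> s by simp
  then show ?thesis unfolding hj_root_def by simp
qed

lemma hj_radicand: "sqrt (y * z + 4 * \<alpha> * s) > 0"
  using \<alpha> s y z by (simp add: add_pos_nonneg)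

text \<open>With v = sqrt(y z) and r the other square root, h solves h^2 - v h =
  \<open>\<alpha> * s\<close> and 2 h - v = r. Adding h^2 to the first equation and using the second
  gives the claim, which simplifies all derivatives below.\<close>

lemma hj_root_quadratic: "(hj_root \<alpha> s y z)\<^sup>2 + \<alpha> * s = hj_root \<alpha> s y z * sqrt (y * z + 4 * \<alpha> * s)"
proof -
  define v where "v = sqrt (y * z)"
  define r where "r = sqrt (y * z + 4 * \<alpha> * s)"
  have "v\<^sup>2 = y * z" "r\<^sup>2 = y * z + 4 * \<alpha> * s"
    using \<alpha> s y z by (simp_all add: v_def r_def)
  then have "r\<^sup>2 = v\<^sup>2 + 4 * \<alpha> * s" by simp
  then show ?thesis
    unfolding hj_root_def v_def[symmetric] r_def[symmetric]
    by (simp add: power2_eq_square field_simps)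
qed

text \<open>The explicit \<open>s\<close> is frozen and only the root moves, so that one computation
  serves for the derivatives in y and in s.\<close>

lemma hj_sol_deriv_aux:
  assumes "((\<lambda>t. h t) has_real_derivative h') (at x)" "h x = hj_root \<alpha> s y z"
  shows "((\<lambda>t. 2 * \<alpha> * ln (h t) - \<alpha>\<^sup>2 * s / (h t)\<^sup>2) has_real_derivative
      2 * \<alpha> * h' * sqrt (y * z + 4 * \<alpha> * s) / (hj_root \<alpha> s y z)\<^sup>2) (at x)"
proof -
  let ?h = "hj_root \<alpha> s y z"
  let ?r = "sqrt (y * z + 4 * \<alpha> * s)"
  have "((\<lambda>t. 2 * \<alpha> * ln (h t) - \<alpha>\<^sup>2 * s / (h t)\<^sup>2) has_real_derivative
      2 * \<alpha> * (h' / ?h) + \<alpha>\<^sup>2 * s * (2 * ?h * h') / (?h\<^sup>2)\<^sup>2) (at x)"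
    using assms hj_root_pos
    by (auto intro!: derivative_eq_intros simp: power2_eq_square field_simps)
  also have "2 * \<alpha> * (h' / ?h) + \<alpha>\<^sup>2 * s * (2 * ?h * h') / (?h\<^sup>2)\<^sup>2 = 2 * \<alpha> * h' * (?h\<^sup>2 + \<alpha> * s) / ?h ^ 3"
    using hj_root_pos by (simp add: field_simps power2_eq_square power3_eq_cube)
  also have "\<dots> = 2 * \<alpha> * h' * ?r / ?h\<^sup>2"
    unfolding hj_root_quadratic using hj_root_pos by (simp add: field_simps power2_eq_square power3_eq_cube)
  finally show ?thesis .
qed

lemma hj_sol_deriv_y:
  "((\<lambda>y. hj_sol \<alpha> s y z) has_real_derivative \<alpha> * z / (sqrt (y * z) * hj_root \<alpha> s y z)) (at y)"
proof -
  let ?v = "sqrt (y * z)" and ?r = "sqrt (y * z + 4 * \<alpha> * s)"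
  have "((\<lambda>y. hj_root \<alpha> s y z) has_real_derivative (z / (2 * ?v) + z / (2 * ?r)) / 2) (at y)"
    unfolding hj_root_def using \<alpha> s y z hj_radicand
    by (auto intro!: derivative_eq_intros simp: inverse_eq_divide mult.commute mult_less_0_iff)
  from hj_sol_deriv_aux[OF this refl]
  have "((\<lambda>y. hj_sol \<alpha> s y z) has_real_derivative
      2 * \<alpha> * ((z / (2 * ?v) + z / (2 * ?r)) / 2) * ?r / (hj_root \<alpha> s y z)\<^sup>2) (at y)"
    by (simp add: hj_sol_def)
  also have "(z / (2 * ?v) + z / (2 * ?r)) / 2 = z * hj_root \<alpha> s y z / (2 * ?v * ?r)"
    using hj_radicand y z unfolding hj_root_def by (simp add: field_simps)
  also have "2 * \<alpha> * (z * hj_root \<alpha> s y z / (2 * ?v * ?r)) * ?r / (hj_root \<alpha> s y z)\<^sup>2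
      = \<alpha> * z / (?v * hj_root \<alpha> s y z)"
    using hj_radicand y z hj_root_pos by (simp add: field_simps power2_eq_square)
  finally show ?thesis .
qed

lemma hj_sol_deriv_s:
  "((\<lambda>s. hj_sol \<alpha> s y z) has_real_derivative \<alpha>\<^sup>2 / (hj_root \<alpha> s y z)\<^sup>2) (at s)"
proof -
  let ?r = "sqrt (y * z + 4 * \<alpha> * s)" and ?h = "hj_root \<alpha> s y z"
  have h: "((\<lambda>s. hj_root \<alpha> s y z) has_real_derivative \<alpha> / ?r) (at s)"
    unfolding hj_root_def using \<alpha> s y z hj_radicand
    by (auto intro!: derivative_eq_intros simp: inverse_eq_divide)
  have "((\<lambda>s'. (2 * \<alpha> * ln (hj_root \<alpha> s' y z) - \<alpha>\<^sup>2 * s / (hj_root \<alpha> s' y z)\<^sup>2) - \<alpha>\<^sup>2 * (s' - s) / (hj_root \<alpha> s' y z)\<^sup>2)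
      has_real_derivative 2 * \<alpha> * (\<alpha> / ?r) * ?r / ?h\<^sup>2 - \<alpha>\<^sup>2 / ?h\<^sup>2) (at s)"
    apply (rule DERIV_diff[OF hj_sol_deriv_aux[OF h refl]])
    using hj_root_pos
    by (auto intro!: derivative_eq_intros h simp: power2_eq_square field_simps)
  moreover have "2 * \<alpha> * (\<alpha> / ?r) * ?r / ?h\<^sup>2 - \<alpha>\<^sup>2 / ?h\<^sup>2 = \<alpha>\<^sup>2 / ?h\<^sup>2"
    using hj_radicand hj_root_pos by (simp add: field_simps power2_eq_square)
  moreover have "(\<lambda>s'. (2 * \<alpha> * ln (hj_root \<alpha> s' y z) - \<alpha>\<^sup>2 * s / (hj_root \<alpha> s' y z)\<^sup>2) - \<alpha>\<^sup>2 * (s' - s) / (hj_root \<alpha> s' y z)\<^sup>2)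
      = (\<lambda>s. hj_sol \<alpha> s y z)"
    by (simp add: hj_sol_def fun_eq_iff right_diff_distrib diff_divide_distrib)
  ultimately show ?thesis by (simp only:)
qed

lemma hj_sol_initial: "hj_sol \<alpha> 0 y z = \<alpha> * ln (y * z)"
  using y z by (simp add: hj_sol_def hj_root_def ln_sqrt)

text \<open>Growth is only logarithmic, so a linear penalty dominates far out.\<close>

lemma hj_sol_le: 
  assumes "y \<le> Y" "z \<le> Y" "s \<le> 1"
  shows "hj_sol \<alpha> s y z \<le> 2 * \<alpha> * ln (Y + sqrt \<alpha>)"
proof -
  have "sqrt (y * z) \<le> sqrt (Y * Y)" using assms y z by (intro real_sqrt_le_mono mult_mono) auto
  then have 1: "sqrt (y * z) \<le> Y" using assms y by simp
  have "sqrt (y * z + 4 * \<alpha> * s) \<le> sqrt (y * z) + sqrt (4 * \<alpha> * s)"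
    using \<alpha> s y z by (intro sqrt_add_le_add_sqrt) auto
  also have "sqrt (4 * \<alpha> * s) = 2 * sqrt (\<alpha> * s)" by (simp add: real_sqrt_mult)
  also have "sqrt (\<alpha> * s) \<le> sqrt \<alpha>" using \<alpha> s assms by simp
  finally have "hj_root \<alpha> s y z \<le> Y + sqrt \<alpha>" unfolding hj_root_def using 1 by simp
  then have "2 * \<alpha> * ln (hj_root \<alpha> s y z) \<le> 2 * \<alpha> * ln (Y + sqrt \<alpha>)"
    using hj_root_pos \<alpha> by (intro mult_left_mono ln_mono) auto
  moreover have "0 \<le> \<alpha>\<^sup>2 * s / (hj_root \<alpha> s y z)\<^sup>2" using s by simp
  ultimately show ?thesis unfolding hj_sol_def by linarith
qed

end

lemma hj_root_commute: "hj_root \<alpha> s y z = hj_root \<alpha> s z y"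
  by (simp add: hj_root_def mult.commute)

lemma hj_sol_commute: "hj_sol \<alpha> s y z = hj_sol \<alpha> s z y"
  by (simp add: hj_sol_def hj_root_commute)

lemma hj_sol_deriv_z:
  assumes "0 < \<alpha>" "0 \<le> s" "0 < y" "0 < z"
  shows "((\<lambda>z. hj_sol \<alpha> s y z) has_real_derivative \<alpha> * y / (sqrt (y * z) * hj_root \<alpha> s y z)) (at z)"
  using hj_sol_deriv_y[of \<alpha> s z y] assms by (simp add: hj_sol_commute mult.commute hj_root_commute)

text \<open>Penalized by \<open>\<epsilon> (y + z + k s)\<close>, the difference \<open>ln f - hj_sol \<alpha>\<close> attains its minimum over
  \<open>y, z \<ge> \<delta>\<close>.  At a minimum with \<open>s > 0\<close> the first-order conditions contradict the differential
  inequality; a minimum on \<open>y = \<delta>\<close> or \<open>z = \<delta>\<close> does no harm because \<open>fy\<close> and \<open>fz\<close> are nonnegative.\<close>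

lemma hj_comparison_penalized:
  fixes f fs fy fz :: "real \<Rightarrow> real \<Rightarrow> real \<Rightarrow> real"
  assumes \<alpha>: "0 < \<alpha>" and C: "0 < C"
    and cont: "continuous_on ({0..1} \<times> {0..} \<times> {0..}) (\<lambda>(s, y, z). f s y z)"
    and ds: "\<And>s y z. 0 \<le> s \<Longrightarrow> 0 < y \<Longrightarrow> 0 < z \<Longrightarrow> ((\<lambda>s. f s y z) has_real_derivative fs s y z) (at s)"
    and dy: "\<And>s y z. 0 \<le> s \<Longrightarrow> 0 < y \<Longrightarrow> 0 < z \<Longrightarrow> ((\<lambda>y. f s y z) has_real_derivative fy s y z) (at y)"
    and dz: "\<And>s y z. 0 \<le> s \<Longrightarrow> 0 < y \<Longrightarrow> 0 < z \<Longrightarrow> ((\<lambda>z. f s y z) has_real_derivative fz s y z) (at z)"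
    and fs: "\<And>s y z. 0 \<le> s \<Longrightarrow> 0 < y \<Longrightarrow> 0 < z \<Longrightarrow> 0 \<le> fs s y z"
    and fy: "\<And>s y z. 0 \<le> s \<Longrightarrow> 0 < y \<Longrightarrow> 0 < z \<Longrightarrow> 0 \<le> fy s y z"
    and fz: "\<And>s y z. 0 \<le> s \<Longrightarrow> 0 < y \<Longrightarrow> 0 < z \<Longrightarrow> 0 \<le> fz s y z"
    and ineq: "\<And>s y z. 0 < s \<Longrightarrow> 0 < y \<Longrightarrow> 0 < z \<Longrightarrow> fy s y z * fz s y z \<le> f s y z * fs s y z"
    and init: "\<And>y z. 0 < y \<Longrightarrow> 0 < z \<Longrightarrow> C * (y * z) powr \<alpha> \<le> f 0 y z"
    and \<delta>: "0 < \<delta>" and \<epsilon>: "0 < \<epsilon>"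
  shows "0 < f 1 \<delta> \<delta>"
    and "ln C \<le> ln (f 1 \<delta> \<delta>) - hj_sol \<alpha> 1 \<delta> \<delta> + \<epsilon> * (2 * \<delta> + (2 * \<alpha> / \<delta> + 1))"
proof -
  have f_ge: "C * (y * z) powr \<alpha> \<le> f s y z" if "0 \<le> s" "0 < y" "0 < z" for s y z
  proof -
    have "f 0 y z \<le> f s y z"
    proof (rule DERIV_nonneg_imp_nondecreasing[of 0 s "\<lambda>s. f s y z"])
      fix t :: real assume "0 \<le> t"
      then show "\<exists>d. ((\<lambda>s. f s y z) has_real_derivative d) (at t) \<and> 0 \<le> d"
        using ds[of t y z] fs[of t y z] that(2,3) by blast
    qed (use that in simp)
    with init[OF that(2,3)] show ?thesis by simp
  qed
  have f_pos: "0 < f s y z" if "0 \<le> s" "0 < y" "0 < z" for s y z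
    using f_ge[OF that] that C by (smt (verit) mult_pos_pos powr_gt_zero)
  show "0 < f 1 \<delta> \<delta>" using f_pos \<delta> by simp
  define m0 where "m0 = ln C + \<alpha> * ln (\<delta> * \<delta>)"
  have ln_f_ge: "m0 \<le> ln (f s y z)" if "0 \<le> s" "\<delta> \<le> y" "\<delta> \<le> z" for s y z
  proof -
    have "C * (\<delta> * \<delta>) powr \<alpha> \<le> C * (y * z) powr \<alpha>"
      using that \<delta> \<alpha> C by (intro mult_left_mono powr_mono2 mult_mono) auto
    also have "\<dots> \<le> f s y z" using that \<delta> by (intro f_ge) auto
    finally have "ln (C * (\<delta> * \<delta>) powr \<alpha>) \<le> ln (f s y z)"
      using C \<delta> that f_pos[of s y z] by (subst ln_le_cancel_iff) auto
    then show ?thesis using C \<delta> by (simp add: m0_def ln_mult ln_powr)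
  qed
  \<comment> \<open>On y, z >= \<open>\<delta>\<close> the derivatives of \<open>hj_sol\<close> in y
    and z are at most \<open>\<alpha> / \<delta>\<close> each; the extra 1 makes the final
    contradiction strict.\<close>
  define k where "k = 2 * \<alpha> / \<delta> + 1"
  \<comment> \<open>The side \<open>Y\<close> is taken so large that the penalty alone gives the
    claim on the outer faces y = Y and z = Y.\<close>
  have "filterlim (\<lambda>Y. m0 - 2 * \<alpha> * ln (Y + sqrt \<alpha>) + \<epsilon> * Y) at_top at_top"
    using \<alpha> \<epsilon> by real_asymp
  then have "eventually (\<lambda>Y. ln C \<le> m0 - 2 * \<alpha> * ln (Y + sqrt \<alpha>) + \<epsilon> * Y \<and> \<delta> < Y) at_top"
    using eventually_gt_at_top[of \<delta>] by (auto simp: filterlim_at_top eventually_conj_iff)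
  then obtain Y where Y: "ln C \<le> m0 - 2 * \<alpha> * ln (Y + sqrt \<alpha>) + \<epsilon> * Y" "\<delta> < Y"
    using eventually_happens by fastforce
  let ?K = "{0..1} \<times> {\<delta>..Y} \<times> {\<delta>..Y} :: (real \<times> real \<times> real) set"
  define D where "D s y z = ln (f s y z) - hj_sol \<alpha> s y z + \<epsilon> * (y + z + k * s)" for s y z
  have contD: "continuous_on ?K (\<lambda>(s, y, z). D s y z)"
  proof -
    have f: "continuous_on ?K (\<lambda>x. f (fst x) (fst (snd x)) (snd (snd x)))"
    proof -
      have "?K \<subseteq> {0..1} \<times> {0..} \<times> {0..}" using \<delta> by auto
      from continuous_on_subset[OF cont this] show ?thesis by (simp only: case_prod_unfold)
    qed
    have h: "continuous_on ?K (\<lambda>x. hj_root \<alpha> (fst x) (fst (snd x)) (snd (snd x)))"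
      unfolding hj_root_def by (intro continuous_intros) auto
    have pos: "0 \<le> fst x \<and> 0 < fst (snd x) \<and> 0 < snd (snd x)" if "x \<in> ?K" for x
      using that \<delta> by auto
    have h0: "\<forall>x\<in>?K. hj_root \<alpha> (fst x) (fst (snd x)) (snd (snd x)) \<noteq> 0"
      by (intro ballI less_imp_neq[THEN not_sym] hj_root_pos[OF \<alpha>]) (use pos in blast)+
    have h1: "\<forall>x\<in>?K. (hj_root \<alpha> (fst x) (fst (snd x)) (snd (snd x)))\<^sup>2 \<noteq> 0"
      using h0 by (simp only: power2_eq_square mult_eq_0_iff simp_thms)
    have f0: "\<forall>x\<in>?K. f (fst x) (fst (snd x)) (snd (snd x)) \<noteq> 0"
      by (intro ballI less_imp_neq[THEN not_sym] f_pos) (use pos in blast)+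
    show ?thesis
      unfolding D_def case_prod_unfold hj_sol_def
      by (intro continuous_intros f h h0 h1 f0)
  qed
  have compactK: "compact ?K" by (intro compact_Times compact_Icc)
  have neK: "?K \<noteq> {}" using Y by auto
  from continuous_attains_inf[OF compactK neK contD]
  obtain x where "x \<in> ?K" "\<forall>x'\<in>?K. (\<lambda>(s, y, z). D s y z) x \<le> (\<lambda>(s, y, z). D s y z) x'" ..
  then obtain s y z where s: "0 \<le> s" "s \<le> 1" and y: "\<delta> \<le> y" "y \<le> Y" and z: "\<delta> \<le> z" "z \<le> Y"
    and min: "\<And>s' y' z'. \<lbrakk>0 \<le> s'; s' \<le> 1; \<delta> \<le> y'; y' \<le> Y; \<delta> \<le> z'; z' \<le> Y\<rbrakk> \<Longrightarrow> D s y z \<le> D s' y' z'"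
    by (cases x) auto
  have yz: "0 < y" "0 < z" using y z \<delta> by auto
  have "0 \<le> k" using \<alpha> \<delta> by (simp add: k_def)
  have "ln C \<le> D s y z"
  proof (cases "y = Y \<or> z = Y")
    case True
    have "ln C \<le> m0 - 2 * \<alpha> * ln (Y + sqrt \<alpha>) + \<epsilon> * Y" by (rule Y)
    also have "\<dots> \<le> ln (f s y z) - hj_sol \<alpha> s y z + \<epsilon> * (y + z + k * s)"
    proof (intro add_mono diff_mono ln_f_ge s y z hj_sol_le \<alpha> yz mult_left_mono)
      show "Y \<le> y + z + k * s" using True yz \<open>0 \<le> k\<close> s by auto
    qed (use \<epsilon> in auto)
    finally show ?thesis by (simp add: D_def)
  next
    case upper: False
    show ?thesis
    proof (cases "s = 0")
      case True
      have "ln C + \<alpha> * ln (y * z) = ln (C * (y * z) powr \<alpha>)"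
        using C yz by (simp add: ln_mult ln_powr)
      also have "\<dots> \<le> ln (f 0 y z)"
        using f_ge[of 0 y z] f_pos[of 0 y z] yz C by (subst ln_le_cancel_iff) auto
      finally have "ln C + hj_sol \<alpha> 0 y z \<le> ln (f 0 y z)"
        using hj_sol_initial[OF \<alpha> order.refl yz] by simp
      then show ?thesis using True yz \<epsilon> by (simp add: D_def add_increasing2)
    next
      case False
      with s have s0: "0 < s" by simp
      let ?F = "f s y z" and ?h = "hj_root \<alpha> s y z" and ?v = "sqrt (y * z)"
      note F = f_pos[OF s(1) yz]
      note h = hj_root_pos[OF \<alpha> s(1) yz]
      define wy wz where "wy = \<alpha> * z / (?v * ?h)" and "wz = \<alpha> * y / (?v * ?h)"
      have Ds: "((\<lambda>s. D s y z) has_real_derivative fs s y z / ?F - \<alpha>\<^sup>2 / ?h\<^sup>2 + \<epsilon> * k) (at s)"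
        unfolding D_def using F hj_sol_deriv_s[OF \<alpha> s(1) yz] ds[OF s(1) yz]
        by (auto intro!: derivative_eq_intros)
      have Dy: "((\<lambda>y. D s y z) has_real_derivative fy s y z / ?F - wy + \<epsilon>) (at y)"
        unfolding D_def wy_def using F hj_sol_deriv_y[OF \<alpha> s(1) yz] dy[OF s(1) yz]
        by (auto intro!: derivative_eq_intros)
      have Dz: "((\<lambda>z. D s y z) has_real_derivative fz s y z / ?F - wz + \<epsilon>) (at z)"
        unfolding D_def wz_def using F hj_sol_deriv_z[OF \<alpha> s(1) yz] dz[OF s(1) yz]
        by (auto intro!: derivative_eq_intros)
      \<comment> \<open>Only one-sided conditions are available: s may equal 1 and can only be
        lowered, y and z may equal \<open>\<delta>\<close> and can only be raised.\<close>
      have ms: "fs s y z / ?F - \<alpha>\<^sup>2 / ?h\<^sup>2 + \<epsilon> * k \<le> 0"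
      proof (rule ccontr)
        assume "\<not> ?thesis"
        then obtain d where d: "d > 0" "\<forall>t>0. t < d \<longrightarrow> D (s - t) y z < D s y z"
          using DERIV_pos_inc_left[OF Ds] by auto
        define t where "t = min (d/2) (s/2)"
        have "0 < t" "t < d" "t \<le> s" using d s0 by (auto simp: t_def min_def)
        with d(2) min[of "s - t" y z] s y z show False by force
      qed
      have my: "0 \<le> fy s y z / ?F - wy + \<epsilon>"
      proof (rule ccontr)
        assume "\<not> ?thesis"
        then obtain d where d: "d > 0" "\<forall>t>0. t < d \<longrightarrow> D s (y + t) z < D s y z"
          using DERIV_neg_dec_right[OF Dy] by auto
        define t where "t = min (d/2) (Y - y)"
        have "0 < t" "t < d" "y + t \<le> Y" using d upper y by (auto simp: t_def min_def)
        with d(2) min[of s "y + t" z] s y z show False by force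
      qed
      have mz: "0 \<le> fz s y z / ?F - wz + \<epsilon>"
      proof (rule ccontr)
        assume "\<not> ?thesis"
        then obtain d where d: "d > 0" "\<forall>t>0. t < d \<longrightarrow> D s y (z + t) < D s y z"
          using DERIV_neg_dec_right[OF Dz] by auto
        define t where "t = min (d/2) (Y - z)"
        have "0 < t" "t < d" "z + t \<le> Y" using d upper z by (auto simp: t_def min_def)
        with d(2) min[of s y "z + t"] s y z show False by force
      qed
      define a b where "a = fy s y z / ?F" and "b = fz s y z / ?F"
      have ab: "0 \<le> a" "0 \<le> b" using fy[OF s(1) yz] fz[OF s(1) yz] F by (auto simp: a_def b_def)
      have "a * b \<le> fs s y z / ?F"
        using ineq[OF s0 yz] F by (simp add: a_def b_def field_simps)
      then have 1: "a * b + \<epsilon> * k \<le> \<alpha>\<^sup>2 / ?h\<^sup>2" using ms by simp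
      have v2: "?v * ?v = y * z" and v0: "0 < ?v" using yz by simp_all
      have w: "wy * wz = \<alpha>\<^sup>2 / ?h\<^sup>2"
        using v2 v0 h yz unfolding wy_def wz_def by (simp add: field_simps power2_eq_square)
      have vh: "y * z \<le> ?v * ?h"
        using mult_left_mono[OF hj_root_ge[OF \<alpha> s(1) yz], of ?v] v2 v0 by simp
      have "wy \<le> \<alpha> * z / (y * z)"
        unfolding wy_def using vh yz \<alpha> by (intro divide_left_mono) (auto intro!: mult_pos_pos v0 h)
      also have "\<dots> \<le> \<alpha> / \<delta>" using yz y \<alpha> \<delta> by (simp add: frac_le)
      finally have wy: "wy \<le> \<alpha> / \<delta>" .
      have "wz \<le> \<alpha> * y / (y * z)"
        unfolding wz_def using vh yz \<alpha> by (intro divide_left_mono) (auto intro!: mult_pos_pos v0 h)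
      also have "\<dots> \<le> \<alpha> / \<delta>" using yz z \<alpha> \<delta> by (simp add: frac_le)
      finally have wz: "wz \<le> \<alpha> / \<delta>" .
      have w0: "0 \<le> wy" "0 \<le> wz" using \<alpha> yz v0 h by (auto simp: wy_def wz_def)
      \<comment> \<open>From \<open>a \<ge> wy - \<epsilon>\<close> and
        \<open>b \<ge> wz - \<epsilon>\<close>, if both lower bounds are non-negative. Otherwise one
        of \<open>wy\<close>, \<open>wz\<close> is below \<open>\<epsilon>\<close> and the left-hand
        side is already at most 0.\<close>
      have "wy * wz - \<epsilon> * (wy + wz) \<le> a * b"
      proof (cases "\<epsilon> \<le> wy \<and> \<epsilon> \<le> wz")
        case True
        have "(wy - \<epsilon>) * (wz - \<epsilon>) \<le> a * b"
          using my mz True ab unfolding a_def[symmetric] b_def[symmetric] by (intro mult_mono) auto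
        moreover have "wy * wz - \<epsilon> * (wy + wz) \<le> (wy - \<epsilon>) * (wz - \<epsilon>)"
          by (simp add: algebra_simps)
        ultimately show ?thesis by linarith
      next
        case False
        then have "wy * wz \<le> \<epsilon> * (wy + wz)"
          using w0 \<epsilon> by (auto simp: distrib_left not_le intro: order_trans[OF mult_right_mono[of wy \<epsilon> wz]]
            order_trans[OF mult_left_mono[of wz \<epsilon> wy]])
        with ab show ?thesis by (smt (verit) mult_nonneg_nonneg)
      qed
      with 1 w have "\<epsilon> * k \<le> \<epsilon> * (wy + wz)" by simp
      then have "k \<le> wy + wz" using \<epsilon> by simp
      with wy wz have False by (simp add: k_def)
      then show ?thesis ..
    qed
  qed
  also have "D s y z \<le> D 1 \<delta> \<delta>" using Y by (intro min) auto
  finally show "ln C \<le> ln (f 1 \<delta> \<delta>) - hj_sol \<alpha> 1 \<delta> \<delta> + \<epsilon> * (2 * \<delta> + (2 * \<alpha> / \<delta> + 1))"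
    by (simp add: D_def k_def)
qed

text \<open>The order of the limits matters: the penalty contains
  \<open>\<epsilon> * (2 * \<alpha> / \<delta>)\<close>, so \<open>\<epsilon>\<close> tends to 0 for
  fixed \<open>\<delta>\<close>, and only then does \<open>\<delta>\<close>.\<close>

lemma hj_comparison:
  fixes f fs fy fz :: "real \<Rightarrow> real \<Rightarrow> real \<Rightarrow> real"
  assumes \<alpha>: "0 < \<alpha>" and C: "0 < C"
    and cont: "continuous_on ({0..1} \<times> {0..} \<times> {0..}) (\<lambda>(s, y, z). f s y z)"
    and hyps: "\<And>s y z. 0 \<le> s \<Longrightarrow> 0 < y \<Longrightarrow> 0 < z \<Longrightarrow> ((\<lambda>s. f s y z) has_real_derivative fs s y z) (at s)"
      "\<And>s y z. 0 \<le> s \<Longrightarrow> 0 < y \<Longrightarrow> 0 < z \<Longrightarrow> ((\<lambda>y. f s y z) has_real_derivative fy s y z) (at y)"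
      "\<And>s y z. 0 \<le> s \<Longrightarrow> 0 < y \<Longrightarrow> 0 < z \<Longrightarrow> ((\<lambda>z. f s y z) has_real_derivative fz s y z) (at z)"
      "\<And>s y z. 0 \<le> s \<Longrightarrow> 0 < y \<Longrightarrow> 0 < z \<Longrightarrow> 0 \<le> fs s y z"
      "\<And>s y z. 0 \<le> s \<Longrightarrow> 0 < y \<Longrightarrow> 0 < z \<Longrightarrow> 0 \<le> fy s y z"
      "\<And>s y z. 0 \<le> s \<Longrightarrow> 0 < y \<Longrightarrow> 0 < z \<Longrightarrow> 0 \<le> fz s y z"
      "\<And>s y z. 0 < s \<Longrightarrow> 0 < y \<Longrightarrow> 0 < z \<Longrightarrow> fy s y z * fz s y z \<le> f s y z * fs s y z"
      "\<And>y z. 0 < y \<Longrightarrow> 0 < z \<Longrightarrow> C * (y * z) powr \<alpha> \<le> f 0 y z"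
  shows "C * (\<alpha> powr \<alpha> * exp (- \<alpha>)) \<le> f 1 0 0"
proof -
  have pen: "0 < f 1 \<delta> \<delta> \<and>
      ln C \<le> ln (f 1 \<delta> \<delta>) - hj_sol \<alpha> 1 \<delta> \<delta> + \<epsilon> * (2 * \<delta> + (2 * \<alpha> / \<delta> + 1))"
    if "0 < \<delta>" "0 < \<epsilon>" for \<delta> \<epsilon>
    by (intro conjI hj_comparison_penalized[where fs = fs and fy = fy and fz = fz and \<delta> = \<delta> and \<epsilon> = \<epsilon>, OF \<alpha> C cont] hyps that)
  have *: "C * exp (hj_sol \<alpha> 1 \<delta> \<delta>) \<le> f 1 \<delta> \<delta>" if \<delta>: "0 < \<delta>" for \<delta>
  proof -
    have "ln C + hj_sol \<alpha> 1 \<delta> \<delta> \<le> ln (f 1 \<delta> \<delta>)"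
    proof (rule field_le_epsilon)
      fix e :: real assume e: "0 < e"
      define K where "K = 2 * \<delta> + (2 * \<alpha> / \<delta> + 1)"
      have K: "0 < K" using \<delta> \<alpha> by (simp add: K_def add_pos_pos)
      have "ln C \<le> ln (f 1 \<delta> \<delta>) - hj_sol \<alpha> 1 \<delta> \<delta> + e / K * K"
        using pen[OF \<delta>, of "e / K"] e K unfolding K_def by simp
      then show "ln C + hj_sol \<alpha> 1 \<delta> \<delta> \<le> ln (f 1 \<delta> \<delta>) + e" using K by simp
    qed
    then have "exp (ln C + hj_sol \<alpha> 1 \<delta> \<delta>) \<le> exp (ln (f 1 \<delta> \<delta>))" by simp
    moreover have "0 < f 1 \<delta> \<delta>"
      using pen[OF \<delta> zero_less_one] by blast
    ultimately show ?thesis using C by (simp add: exp_add)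
  qed
  have lim1: "((\<lambda>\<delta>. f 1 \<delta> \<delta>) \<longlongrightarrow> f 1 0 0) (at_right 0)"
  proof -
    have "continuous_on {0..} (\<lambda>\<delta>. f 1 \<delta> \<delta>)"
      using continuous_on_compose2[OF cont, of "{0..}" "\<lambda>\<delta>. (1, \<delta>, \<delta>)"]
      by (simp add: continuous_intros image_subset_iff)
    then have "((\<lambda>\<delta>. f 1 \<delta> \<delta>) \<longlongrightarrow> f 1 0 0) (at 0 within {0..})"
      by (auto simp: continuous_on_def)
    then show ?thesis by (rule tendsto_mono[rotated]) (auto intro: at_le)
  qed
  \<comment> \<open>The bound at (1, \<open>\<delta>\<close>, \<open>\<delta>\<close>) in a form
    continuous at 0. There the root is sqrt \<open>\<alpha>\<close>, so the exponent is
    \<open>\<alpha> * ln \<alpha> - \<alpha>\<close>.\<close>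
  define g where "g \<delta> = C * exp (2 * \<alpha> * ln ((\<delta> + sqrt (\<delta> * \<delta> + 4 * \<alpha>)) / 2) - \<alpha>\<^sup>2 / ((\<delta> + sqrt (\<delta> * \<delta> + 4 * \<alpha>)) / 2)\<^sup>2)" for \<delta>
  have "sqrt (4 * \<alpha>) / 2 = sqrt \<alpha>" by (simp add: real_sqrt_mult)
  then have g0: "g 0 = C * (\<alpha> powr \<alpha> * exp (- \<alpha>))"
    using \<alpha> by (simp add: g_def ln_sqrt exp_diff powr_def exp_minus power2_eq_square field_simps)
  have lim2: "(g \<longlongrightarrow> g 0) (at_right 0)"
    unfolding g_def using \<alpha> by (intro tendsto_intros) auto
  have "g 0 \<le> f 1 0 0"
  proof (rule tendsto_le[OF _ lim1 lim2])
    show "eventually (\<lambda>\<delta>. g \<delta> \<le> f 1 \<delta> \<delta>) (at_right 0)"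
      using eventually_at_right_less[of "0::real"]
    proof eventually_elim
      case (elim \<delta>)
      then have "g \<delta> = C * exp (hj_sol \<alpha> 1 \<delta> \<delta>)"
        by (simp add: g_def hj_sol_def hj_root_def)
      with *[OF elim] show ?case by simp
    qed
  qed simp
  then show ?thesis by (simp add: g0)
qed

section \<open>One variable at a time\<close>

definition one_plus_vars :: "'n::finite cpoly" where
  "one_plus_vars = cC 1 + (\<Sum>j\<in>UNIV. cX j)"

text \<open>This is M((1 + x_1 + ... + x_n)^k). For non-negative moments it dominates every moment
  of total degree k, and the summand 1 makes it non-decreasing in k.\<close>

fun power_moment :: "nat \<Rightarrow> (nat ^ 'n::finite \<Rightarrow> real) \<Rightarrow> real" where
  "power_moment 0 m = m 0"
| "power_moment (Suc k) m = power_moment k m + (\<Sum>j\<in>UNIV. power_moment k (\<lambda>\<mu>. m (axis j 1 + \<mu>)))"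

lemma mfun_one_plus_vars_mult:
  "mfun m (one_plus_vars * S) = mfun m S + (\<Sum>j\<in>UNIV. mfun (\<lambda>\<mu>. m (axis j 1 + \<mu>)) S)"
  unfolding one_plus_vars_def distrib_right sum_distrib_right mfun_add mfun_sum mfun_single_mult by simp

lemma mfun_power_moment:
  "mfun (\<lambda>\<mu>. of_real (m \<mu>)) (one_plus_vars ^ k) = of_real (power_moment k m)"
proof (induction k arbitrary: m)
  case 0
  then show ?case by (simp flip: single_one)
next
  case (Suc k)
  show ?case unfolding power_Suc mfun_one_plus_vars_mult Suc.IH by simp
qed

lemma power_moment_nonneg: "(\<And>\<mu>. 0 \<le> m \<mu>) \<Longrightarrow> 0 \<le> power_moment k m"
  by (induction k arbitrary: m) (simp_all add: sum_nonneg)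

lemma power_moment_ge:
  fixes \<mu> :: "nat ^ 'n::finite"
  assumes "\<And>\<mu>. 0 \<le> m \<mu>" "(\<Sum>k\<in>UNIV. \<mu> $ k) = d"
  shows "m \<mu> \<le> power_moment d m"
  using assms
proof (induction d arbitrary: m \<mu>)
  case 0
  then have "\<mu> = 0" by (simp add: vec_eq_iff)
  then show ?case by simp
next
  case (Suc d)
  then have "(\<Sum>k\<in>UNIV. \<mu> $ k) \<noteq> 0" by simp
  then obtain j where j: "\<mu> $ j \<noteq> 0" by (metis sum.neutral)
  define \<nu> where "\<nu> = upd \<mu> j (\<mu> $ j - 1)"
  have \<mu>: "axis j 1 + \<nu> = \<mu>" using j by (simp add: \<nu>_def axis_add_upd)
  have "(\<Sum>k\<in>UNIV. \<nu> $ k) = d"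
    using sum_upd[of \<mu> j "\<mu> $ j - 1"] sum_upd[of \<mu> j "\<mu> $ j"] Suc.prems(2) j by (simp add: \<nu>_def)
  then have "m (axis j 1 + \<nu>) \<le> power_moment d (\<lambda>\<mu>. m (axis j 1 + \<mu>))"
    using Suc.IH[of "\<lambda>\<mu>. m (axis j 1 + \<mu>)" \<nu>] Suc.prems(1) by simp
  also have "\<dots> \<le> (\<Sum>j\<in>UNIV. power_moment d (\<lambda>\<mu>. m (axis j 1 + \<mu>)))"
    by (rule member_le_sum) (auto intro: power_moment_nonneg Suc.prems)
  also have "\<dots> \<le> power_moment (Suc d) m"
    using power_moment_nonneg[of m d] Suc.prems(1) by simp
  finally show ?case unfolding \<mu> .
qed

text \<open>With Q = 1 + x_1 + ... + x_n, the polynomial (Q + i) Q^k is stable because Q maps the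
  upper half-space into the upper half-plane. Summing the inequalities over all j replaces x_j by Q,
  as the summand 1 contributes a real number. The imaginary part is then exactly the difference of
  the two sides.\<close>

lemma power_moment_log_concave:
  fixes m :: "nat ^ 'n::finite \<Rightarrow> real"
  assumes "good_moments m"
  shows "power_moment k m * power_moment (Suc (Suc k)) m \<le> (power_moment (Suc k) m)\<^sup>2"
proof -
  define r where "r k = power_moment k m" for k
  let ?L = "mfun (\<lambda>\<mu>. complex_of_real (m \<mu>))"
  let ?Q = "one_plus_vars :: 'n cpoly"
  define S where "S = ?Q ^ Suc k + cC \<i> * ?Q ^ k"
  have S_eq: "S = (?Q + cC \<i>) * ?Q ^ k" by (simp add: S_def distrib_right)
  have "complex_stable S"
    unfolding complex_stable_def
  proof
    fix z :: "complex ^ 'n" assume "z \<in> upper"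
    then have pos: "0 < (\<Sum>j\<in>UNIV. Im (z $ j))" by (intro sum_pos) (auto simp: upper_def)
    have Q: "ceval ?Q z = 1 + (\<Sum>j\<in>UNIV. z $ j)"
      unfolding one_plus_vars_def mfun_add mfun_sum mfun_single mono_eval_axis by simp
    have "Im (ceval ?Q z) > 0" using pos by (simp add: Q)
    then have "ceval ?Q z \<noteq> 0" "ceval ?Q z + \<i> \<noteq> 0" by (auto simp: complex_eq_iff)
    then show "ceval S z \<noteq> 0" by (simp add: S_eq ceval_mult ceval_power mfun_add)
  qed
  then have le: "Im (?L S * cnj (mfun (\<lambda>\<mu>. of_real (m (axis j 1 + \<mu>))) S)) \<le> 0" for j
    using good_momentsD[OF assms] by blast
  have "Im (?L S * cnj (?L (?Q * S)))
      = Im (?L S * cnj (?L S)) + (\<Sum>j\<in>UNIV. Im (?L S * cnj (mfun (\<lambda>\<mu>. of_real (m (axis j 1 + \<mu>))) S)))"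
    unfolding mfun_one_plus_vars_mult complex_cnj_add cnj_sum distrib_left sum_distrib_left by simp
  also have "\<dots> \<le> 0" using le by (simp add: sum_nonpos)
  finally have "Im (?L S * cnj (?L (?Q * S))) \<le> 0" .
  moreover have "?L S = of_real (r (Suc k)) + \<i> * of_real (r k)"
    unfolding S_def mfun_add mfun_single_mult r_def add_0 mfun_power_moment ..
  moreover have "?L (?Q * S) = of_real (r (Suc (Suc k))) + \<i> * of_real (r (Suc k))"
  proof -
    have "?Q * S = ?Q ^ Suc (Suc k) + cC \<i> * ?Q ^ Suc k"
      by (simp add: S_def distrib_left mult.left_commute)
    then show ?thesis by (simp only: mfun_add mfun_single_mult r_def add_0 mfun_power_moment)
  qed
  ultimately have "r k * r (Suc (Suc k)) \<le> (r (Suc k))\<^sup>2"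
    by (simp add: power2_eq_square algebra_simps)
  then show ?thesis by (simp only: r_def)
qed

text \<open>Quotients of consecutive terms do not increase, so the first one bounds them all.
  Leading zeros are skipped by \<open>k0\<close>; monotonicity excludes later ones.\<close>

lemma log_concave_growth:
  fixes r :: "nat \<Rightarrow> real"
  assumes nonneg: "\<And>k. 0 \<le> r k" and mono: "\<And>k. r k \<le> r (Suc k)"
    and lc: "\<And>k. r k * r (Suc (Suc k)) \<le> (r (Suc k))\<^sup>2"
  obtains C \<rho> where "0 \<le> C" "0 \<le> \<rho>" "\<And>k. r k \<le> C * \<rho> ^ k"
proof (cases "\<forall>k. r k = 0")
  case True
  then show ?thesis using that[of 0 0] by simp
next
  case False
  define k0 where "k0 = (LEAST k. r k \<noteq> 0)"
  have k0: "r k0 \<noteq> 0" unfolding k0_def using False by (metis (mono_tags, lifting) LeastI)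
  have less: "r k = 0" if "k < k0" for k using that not_less_Least unfolding k0_def by blast
  have "incseq r" using mono by (simp add: incseq_Suc_iff)
  then have pos: "0 < r (k0 + k)" for k
    using k0 nonneg[of k0] incseqD[of r k0 "k0 + k"] by simp
  define \<rho> where "\<rho> = r (Suc k0) / r k0"
  have \<rho>: "1 \<le> \<rho>" using pos[of 0] mono[of k0] by (simp add: \<rho>_def)
  have ratio: "r (Suc (k0 + k)) \<le> \<rho> * r (k0 + k)" for k
  proof (induction k)
    case 0
    then show ?case using k0 by (simp add: \<rho>_def)
  next
    case (Suc k)
    have "r (k0 + k) * r (Suc (k0 + Suc k)) \<le> (r (Suc (k0 + k)))\<^sup>2"
      using lc[of "k0 + k"] by simp
    also have "\<dots> \<le> r (Suc (k0 + k)) * (\<rho> * r (k0 + k))"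
      unfolding power2_eq_square using Suc nonneg by (intro mult_left_mono) auto
    finally have "r (k0 + k) * r (Suc (k0 + Suc k)) \<le> r (k0 + k) * (\<rho> * r (k0 + Suc k))"
      by (simp add: mult_ac)
    then show ?case using pos[of k] by simp
  qed
  have bound: "r (k0 + k) \<le> r k0 * \<rho> ^ k" for k
  proof (induction k)
    case (Suc k)
    have "r (k0 + Suc k) \<le> \<rho> * r (k0 + k)" using ratio[of k] by simp
    also have "\<dots> \<le> \<rho> * (r k0 * \<rho> ^ k)" using Suc \<rho> by (intro mult_left_mono) auto
    finally show ?case by (simp add: mult_ac)
  qed simp
  show ?thesis
  proof (rule that[of "r k0" \<rho>])
    fix k
    show "r k \<le> r k0 * \<rho> ^ k"
    proof (cases "k < k0")
      case True
      then show ?thesis using less nonneg[of k0] \<rho> by simp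
    next
      case False
      then have "r k \<le> r k0 * \<rho> ^ (k - k0)" using bound[of "k - k0"] by simp
      also have "\<dots> \<le> r k0 * \<rho> ^ k" using \<rho> nonneg[of k0] by (intro mult_left_mono power_increasing) auto
      finally show ?thesis .
    qed
  qed (use nonneg \<rho> in auto)
qed

lemma good_imp_admissible:
  assumes good: "good_moments m" and nonneg: "\<And>\<mu>. 0 \<le> m \<mu>"
  shows "admissible m"
proof -
  have mono: "power_moment k m \<le> power_moment (Suc k) m" for k
    using nonneg by (simp add: sum_nonneg power_moment_nonneg)
  obtain C \<rho> where C: "0 \<le> C" "0 \<le> \<rho>" "\<And>k. power_moment k m \<le> C * \<rho> ^ k"
    using log_concave_growth[of "\<lambda>k. power_moment k m", OF power_moment_nonneg[OF nonneg] mono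
        power_moment_log_concave[OF good]] by blast
  have "m \<mu> \<le> C * \<rho> ^ (\<Sum>k\<in>UNIV. \<mu> $ k)" for \<mu>
    using power_moment_ge[where m = m and \<mu> = \<mu>, OF nonneg refl] C(3) order_trans by blast
  with good nonneg C(1,2) show ?thesis unfolding admissible_def by blast
qed

text \<open>The moments of \<open>q \<mapsto> M(exp (z x\<^sub>j) q(x\<^sub>j \<mapsto> y + s x\<^sub>j))\<close>.\<close>

definition slot_moments :: "'n \<Rightarrow> real \<Rightarrow> real \<Rightarrow> real \<Rightarrow> (nat ^ 'n::finite \<Rightarrow> real) \<Rightarrow> nat ^ 'n \<Rightarrow> real" where
  "slot_moments j s y z m = shift_moments j s y (exp_moments j z m)"

lemma admissible_slot_moments:
  "admissible m \<Longrightarrow> 0 \<le> s \<Longrightarrow> 0 \<le> y \<Longrightarrow> 0 \<le> z \<Longrightarrow> admissible (slot_moments j s y z m)"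
  by (simp add: slot_moments_def admissible_shift_moments admissible_exp_moments)

lemma exp_moments_upd:
  "exp_moments j z m (upd \<mu> j b) = suminf (\<lambda>l. z ^ l / fact l * m (upd \<mu> j (b + l)))"
  by (simp add: exp_moments_def)

lemma exp_moments_0: "exp_moments j 0 m \<mu> = m \<mu>"
proof -
  have "suminf (\<lambda>l. 0 ^ l / fact l * m (upd \<mu> j (\<mu> $ j + l))) = (\<Sum>l\<in>{0}. 0 ^ l / fact l * m (upd \<mu> j (\<mu> $ j + l)))"
    by (rule suminf_finite) auto
  then show ?thesis by (simp add: exp_moments_def)
qed

text \<open>Differentiating exp(z x_j) in z brings down a factor x_j, which raises the slot by one;
  the series is entire in z.\<close>

lemma exp_moments_deriv:
  assumes "admissible m"
  shows "((\<lambda>z. exp_moments j z m (upd \<mu> j b)) has_real_derivative exp_moments j z m (upd \<mu> j (Suc b))) (at z)"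
proof -
  obtain A \<rho> where A: "\<And>l. m (upd \<mu> j (b + l)) \<le> A * \<rho> ^ l"
    using admissible_slot_growth[OF assms, of \<mu> j b] by blast
  define c where "c l = m (upd \<mu> j (b + l)) / fact l" for l
  have "summable (\<lambda>l. c l * z ^ l)" for z
    using summable_exp_growth[OF admissible_nonneg[OF assms] A, of z] by (simp add: c_def mult_ac)
  then have "((\<lambda>z. suminf (\<lambda>l. c l * z ^ l)) has_real_derivative suminf (\<lambda>l. diffs c l * z ^ l)) (at z)"
    by (rule termdiffs_strong_converges_everywhere)
  moreover have "diffs c l * z ^ l = z ^ l / fact l * m (upd \<mu> j (Suc b + l))" for l
    by (simp add: diffs_def c_def del: of_nat_Suc)
  moreover have "c l * z ^ l = z ^ l / fact l * m (upd \<mu> j (b + l))" for l z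
    by (simp add: c_def)
  ultimately show ?thesis by (simp only: exp_moments_upd)
qed

text \<open>Read as (y + s X)^k, the derivative in s is k X (y + s X)^(k-1), and the factor X shifts
  the entries \<open>e\<close>.\<close>

lemma slot_shift_has_real_derivative_s:
  fixes e :: "nat \<Rightarrow> real"
  shows "((\<lambda>s. slot_shift s y e k) has_real_derivative real k * slot_shift s y (\<lambda>b. e (Suc b)) (k - 1)) (at s)"
proof (induction k arbitrary: e)
  case (Suc k)
  have "((\<lambda>s. slot_shift s y e (Suc k)) has_real_derivative
      y * (real k * slot_shift s y (\<lambda>b. e (Suc b)) (k - 1)) +
      (1 * slot_shift s y (\<lambda>b. e (Suc b)) k + (real k * slot_shift s y (\<lambda>b. e (Suc (Suc b))) (k - 1)) * s)) (at s)"
    unfolding slot_shift.simps by (intro DERIV_add DERIV_cmult DERIV_mult DERIV_ident Suc.IH)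
  moreover have "y * (real k * slot_shift s y (\<lambda>b. e (Suc b)) (k - 1)) +
      (1 * slot_shift s y (\<lambda>b. e (Suc b)) k + (real k * slot_shift s y (\<lambda>b. e (Suc (Suc b))) (k - 1)) * s)
     = real (Suc k) * slot_shift s y (\<lambda>b. e (Suc b)) (Suc k - 1)"
    by (cases k) (simp_all add: algebra_simps)
  ultimately show ?case by simp
qed simp

lemma slot_shift_has_real_derivative_entries:
  assumes "\<And>b. ((\<lambda>z. e z b) has_real_derivative e' b) (at z)"
  shows "((\<lambda>z. slot_shift s y (e z) k) has_real_derivative slot_shift s y e' k) (at z)"
  using assms
proof (induction k arbitrary: e e')
  case (Suc k)
  show ?case unfolding slot_shift.simps
    by (intro DERIV_add DERIV_cmult Suc.IH Suc.prems)
qed simp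

text \<open>The contribution of one variable: for a > 0 the exponential of \<open>hj_sol\<close> at
  s = 1, y = z = 0, and for a = 0 its limit under the convention 0^0 = 1.\<close>

definition self_power1 :: "real \<Rightarrow> real" where
  "self_power1 a = exp (- a) * (if a = 0 then 1 else a powr a)"

text \<open>The comparison principle carries the bound in \<open>init\<close>, at s = 0, to the
  point (1, 0, 0), where the interpolating function \<open>f\<close> equals M(p).\<close>

lemma capacity_slot_step:
  fixes p :: "'n::finite rpoly" and m :: "nat ^ 'n \<Rightarrow> real"
  assumes m: "admissible m" and p: "real_stable p" "p \<noteq> 0" "nonneg_coeffs p" and \<alpha>: "0 \<le> \<alpha>"
    and init: "\<And>y z. 0 < y \<Longrightarrow> 0 < z \<Longrightarrow> C * (y * z) powr \<alpha> \<le> mfun (slot_moments j 0 y z m) p"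
  shows "C * self_power1 \<alpha> \<le> mfun m p"
proof -
  let ?K = "Poly_Mapping.keys p" and ?c = "Poly_Mapping.lookup p"
  have c: "0 \<le> ?c \<mu>" for \<mu> using p(3) by (simp add: nonneg_coeffs_def)
  define E where "E \<mu> z = (\<lambda>b. exp_moments j z m (upd \<mu> j b))" for \<mu> z
  have E0: "0 \<le> E \<mu> z b" if "0 \<le> z" for \<mu> z b
    unfolding E_def using admissible_nonneg[OF admissible_exp_moments[OF m that]] .
  define f where "f s y z = (\<Sum>\<mu>\<in>?K. ?c \<mu> * slot_shift s y (E \<mu> z) (\<mu> $ j))" for s y z
  define fs where "fs s y z = (\<Sum>\<mu>\<in>?K. ?c \<mu> * (real (\<mu> $ j) * slot_shift s y (\<lambda>b. E \<mu> z (Suc b)) (\<mu> $ j - 1)))" for s y z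
  define fy where "fy s y z = (\<Sum>\<mu>\<in>?K. ?c \<mu> * (real (\<mu> $ j) * slot_shift s y (E \<mu> z) (\<mu> $ j - 1)))" for s y z
  define fz where "fz s y z = (\<Sum>\<mu>\<in>?K. ?c \<mu> * slot_shift s y (\<lambda>b. E \<mu> z (Suc b)) (\<mu> $ j))" for s y z
  have f_eq: "f s y z = mfun (slot_moments j s y z m) p" for s y z
    by (simp add: f_def mfun_def slot_moments_def shift_moments_def E_def)
  have ds: "((\<lambda>s. f s y z) has_real_derivative fs s y z) (at s)" for s y z
    unfolding f_def fs_def by (intro DERIV_sum DERIV_cmult slot_shift_has_real_derivative_s)
  have dy: "((\<lambda>y. f s y z) has_real_derivative fy s y z) (at y)" for s y z
    unfolding f_def fy_def by (intro DERIV_sum DERIV_cmult slot_shift_has_field_derivative_y)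
  have dz: "((\<lambda>z. f s y z) has_real_derivative fz s y z) (at z)" for s y z
    unfolding f_def fz_def E_def
    by (intro DERIV_sum DERIV_cmult slot_shift_has_real_derivative_entries exp_moments_deriv m)
  have fs0: "0 \<le> fs s y z" and fy0: "0 \<le> fy s y z" and fz0: "0 \<le> fz s y z"
    if "0 \<le> s" "0 < y" "0 < z" for s y z
    unfolding fs_def fy_def fz_def using that
    by (auto intro!: sum_nonneg mult_nonneg_nonneg c slot_shift_nonneg E0)
  have cont: "continuous_on A (\<lambda>(s, y, z). f s y z)" for A
  proof -
    have Ec: "continuous_on UNIV (\<lambda>z. E \<mu> z b)" for \<mu> b
      unfolding E_def by (intro continuous_at_imp_continuous_on ballI DERIV_isCont[OF exp_moments_deriv[OF m]])
    have "continuous_on A (\<lambda>x. E \<mu> (snd (snd x)) b)" for \<mu> b and A :: "(real \<times> real \<times> real) set"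
      by (rule continuous_on_compose2[OF Ec]) (auto intro!: continuous_intros)
    then show ?thesis
      unfolding f_def case_prod_unfold by (intro continuous_intros) auto
  qed
  have ineq: "fy s y z * fz s y z \<le> f s y z * fs s y z" if s: "0 < s" and y: "0 < y" and z: "0 < z" for s y z
  proof -
    let ?M = "slot_moments j s y z m"
    have "good_moments ?M"
      using admissible_slot_moments[OF m, of s y z j] s y z by (simp add: admissible_def)
    from rayleigh[OF this p(1,2), of j]
    have "mfun (\<lambda>\<mu>. ?M (axis j 1 + \<mu>)) p * mfun (\<lambda>\<mu>. real (\<mu> $ j) * ?M (upd \<mu> j (\<mu> $ j - 1))) p
       \<le> mfun ?M p * mfun (\<lambda>\<mu>. real (\<mu> $ j) * ?M \<mu>) p" .
    moreover have "mfun (\<lambda>\<mu>. ?M (axis j 1 + \<mu>)) p = y * f s y z + s * fz s y z"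
      unfolding slot_moments_def shift_moments_axis_same mfun_add_moments mfun_cmult_moments
      by (simp add: f_eq slot_moments_def)
         (simp add: fz_def mfun_def shift_moments_def E_def axis_add_upd)
    moreover have "mfun (\<lambda>\<mu>. real (\<mu> $ j) * ?M (upd \<mu> j (\<mu> $ j - 1))) p = fy s y z"
      by (simp add: fy_def mfun_def slot_moments_def shift_moments_def E_def)
    moreover have "mfun (\<lambda>\<mu>. real (\<mu> $ j) * ?M \<mu>) p = y * fy s y z + s * fs s y z"
    proof -
      have "real (\<mu> $ j) * ?M \<mu> = y * (real (\<mu> $ j) * slot_shift s y (E \<mu> z) (\<mu> $ j - 1)) +
          s * (real (\<mu> $ j) * slot_shift s y (\<lambda>b. E \<mu> z (Suc b)) (\<mu> $ j - 1))" for \<mu>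
        by (cases "\<mu> $ j") (simp_all add: slot_moments_def shift_moments_def E_def algebra_simps)
      then show ?thesis
        by (simp add: mfun_def fy_def fs_def sum_distrib_left distrib_left sum.distrib mult_ac)
    qed
    \<comment> \<open>For shifted moments, multiplication by x_j and x_j times the derivative both
      split into a y-part and an s-part. The products with y on the two sides agree and cancel;
      dividing by s > 0 leaves the claim.\<close>
    ultimately have "(y * f s y z + s * fz s y z) * fy s y z \<le> f s y z * (y * fy s y z + s * fs s y z)"
      by (simp add: f_eq)
    then have "s * (fy s y z * fz s y z) \<le> s * (f s y z * fs s y z)"
      by (simp add: algebra_simps)
    then show ?thesis using s by simp
  qed
  have f1: "f 1 0 0 = mfun m p"
    by (simp add: f_def E_def exp_moments_0 mfun_def)
  have init': "C * (y * z) powr \<alpha> \<le> f 0 y z" if "0 < y" "0 < z" for y z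
    using init[OF that] by (simp add: f_eq)
  have mp0: "0 \<le> mfun m p"
    unfolding mfun_def by (intro sum_nonneg mult_nonneg_nonneg c admissible_nonneg[OF m])
  \<comment> \<open>The comparison takes logarithms and divides by the root, hence needs positive
    \<open>C\<close> and \<open>\<alpha>\<close>. For \<open>\<alpha> = 0\<close> monotonicity in s
    is enough.\<close>
  consider "C \<le> 0" | "0 < C" "0 < \<alpha>" | "0 < C" "\<alpha> = 0" using \<alpha> by linarith
  then show ?thesis
  proof cases
    case 1
    have "0 \<le> self_power1 \<alpha>" by (simp add: self_power1_def)
    with 1 have "C * self_power1 \<alpha> \<le> 0" by (simp add: mult_nonpos_nonneg)
    with mp0 show ?thesis by simp
  next
    case 2
    have "C * (\<alpha> powr \<alpha> * exp (- \<alpha>)) \<le> f 1 0 0"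
      by (rule hj_comparison[where fs = fs and fy = fy and fz = fz, OF 2(2,1) cont ds dy dz fs0 fy0 fz0 ineq init'])
    then show ?thesis using 2 by (simp add: f1 self_power1_def mult.commute)
  next
    case 3
    have "((\<lambda>\<delta>. f 1 \<delta> \<delta>) \<longlongrightarrow> f 1 0 0) (at_right 0)"
    proof -
      have "continuous_on UNIV (\<lambda>\<delta>. f 1 \<delta> \<delta>)"
        using continuous_on_compose2[OF cont[of UNIV], of UNIV "\<lambda>\<delta>. (1, \<delta>, \<delta>)"]
        by (simp add: continuous_intros)
      then have "((\<lambda>\<delta>. f 1 \<delta> \<delta>) \<longlongrightarrow> f 1 0 0) (at 0)" by (simp add: continuous_on_def)
      then show ?thesis by (rule tendsto_mono[rotated]) (auto intro: at_le)
    qed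
    moreover have "eventually (\<lambda>\<delta>. C \<le> f 1 \<delta> \<delta>) (at_right 0)"
      using eventually_at_right_less[of "0::real"]
    proof eventually_elim
      case (elim \<delta>)
      have "f 0 \<delta> \<delta> \<le> f 1 \<delta> \<delta>"
      proof (rule DERIV_nonneg_imp_nondecreasing[of 0 1 "\<lambda>s. f s \<delta> \<delta>"])
        fix t :: real assume "0 \<le> t"
        then show "\<exists>d. ((\<lambda>s. f s \<delta> \<delta>) has_real_derivative d) (at t) \<and> 0 \<le> d"
          using ds fs0 elim by blast
      qed simp
      with init'[OF elim elim] 3 elim show ?case by simp
    qed
    ultimately have "C \<le> f 1 0 0" by (rule tendsto_lowerbound) simp
    then show ?thesis using 3 by (simp add: f1 self_power1_def)
  qed
qed

section \<open>All variables\<close>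

text \<open>Every listed variable is moved to the end s = 0: in the argument x_j becomes y_j, while
  M receives the weight exp(z_j x_j).\<close>

fun slots :: "'n list \<Rightarrow> real ^ 'n \<Rightarrow> real ^ 'n \<Rightarrow> (nat ^ 'n::finite \<Rightarrow> real) \<Rightarrow> nat ^ 'n \<Rightarrow> real" where
  "slots [] y z m = m"
| "slots (j # js) y z m = slots js y z (slot_moments j 0 (y $ j) (z $ j) m)"

lemma slots_cong:
  "(\<And>k. k \<in> set js \<Longrightarrow> y $ k = y' $ k \<and> z $ k = z' $ k) \<Longrightarrow> slots js y z m = slots js y' z' m"
  by (induction js arbitrary: m) simp_all

text \<open>When a variable is treated, its factor \<open>(a * b) powr (\<alpha> $ j)\<close>
  becomes part of the constant for the remaining ones; hence the induction runs over all
  \<open>C\<close> as well as all \<open>m\<close>.\<close>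

lemma capacity_slots:
  fixes p :: "'n::finite rpoly" and m :: "nat ^ 'n \<Rightarrow> real"
  assumes p: "real_stable p" "p \<noteq> 0" "nonneg_coeffs p" and \<alpha>: "\<And>k. 0 \<le> \<alpha> $ k"
    and m: "admissible m" and js: "distinct js"
    and init: "\<And>y z. y \<in> pos_vecs \<Longrightarrow> z \<in> pos_vecs \<Longrightarrow>
      C * (\<Prod>j\<leftarrow>js. (y $ j * z $ j) powr (\<alpha> $ j)) \<le> mfun (slots js y z m) p"
  shows "C * (\<Prod>j\<leftarrow>js. self_power1 (\<alpha> $ j)) \<le> mfun m p"
  using m js init
proof (induction js arbitrary: m C)
  case Nil
  have "(\<chi> k. 1) \<in> (pos_vecs :: (real ^ 'n) set)" by (simp add: pos_vecs_def)
  from Nil.prems(3)[OF this this] show ?case by simp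
next
  case (Cons j js)
  have "C * (\<Prod>j\<leftarrow>js. self_power1 (\<alpha> $ j)) * self_power1 (\<alpha> $ j) \<le> mfun m p"
  proof (rule capacity_slot_step[OF Cons.prems(1) p \<alpha>])
    fix a b :: real assume ab: "0 < a" "0 < b"
    have "C * (a * b) powr (\<alpha> $ j) * (\<Prod>j\<leftarrow>js. self_power1 (\<alpha> $ j)) \<le> mfun (slot_moments j 0 a b m) p"
    proof (rule Cons.IH)
      show "admissible (slot_moments j 0 a b m)"
        using ab by (intro admissible_slot_moments Cons.prems) auto
      show "distinct js" using Cons.prems by simp
      fix y z :: "real ^ 'n" assume yz: "y \<in> pos_vecs" "z \<in> pos_vecs"
      define y' where "y' = (\<chi> k. if k = j then a else y $ k)"
      define z' where "z' = (\<chi> k. if k = j then b else z $ k)"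
      have y'z': "y' \<in> pos_vecs" "z' \<in> pos_vecs" "y' $ j = a" "z' $ j = b"
        using yz ab by (auto simp: y'_def z'_def pos_vecs_def)
      have js: "y' $ k = y $ k" "z' $ k = z $ k" if "k \<in> set js" for k
        using that Cons.prems(2) by (auto simp: y'_def z'_def)
      have "(\<Prod>j\<leftarrow>js. (y' $ j * z' $ j) powr (\<alpha> $ j)) = (\<Prod>j\<leftarrow>js. (y $ j * z $ j) powr (\<alpha> $ j))"
        by (intro arg_cong[where f = prod_list] map_cong) (simp_all add: js)
      moreover have "slots js y' z' = slots js y z" by (intro ext slots_cong[THEN fun_cong]) (simp add: js)
      ultimately show "C * (a * b) powr (\<alpha> $ j) * (\<Prod>j\<leftarrow>js. (y $ j * z $ j) powr (\<alpha> $ j))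
          \<le> mfun (slots js y z (slot_moments j 0 a b m)) p"
        using Cons.prems(3)[OF y'z'(1,2)] by (simp add: y'z' mult.assoc)
    qed
    then show "C * (\<Prod>j\<leftarrow>js. self_power1 (\<alpha> $ j)) * (a * b) powr (\<alpha> $ j) \<le> mfun (slot_moments j 0 a b m) p"
      by (simp add: mult_ac)
  qed
  then show ?case by (simp add: mult_ac)
qed

definition partial_box :: "'n set \<Rightarrow> nat \<Rightarrow> (nat ^ 'n::finite) set" where
  "partial_box B N = {\<nu>. (\<forall>k\<in>B. \<nu> $ k \<le> N) \<and> (\<forall>k. k \<notin> B \<longrightarrow> \<nu> $ k = 0)}"

definition merge_vec :: "'n set \<Rightarrow> nat ^ 'n \<Rightarrow> nat ^ 'n \<Rightarrow> nat ^ 'n::finite" where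
  "merge_vec B \<mu> \<nu> = (\<chi> k. if k \<in> B then \<nu> $ k else \<mu> $ k)"

lemma sum_partial_box_insert:
  assumes "j \<notin> B"
  shows "(\<Sum>\<nu>\<in>partial_box (insert j B) N. F \<nu>) = (\<Sum>\<nu>\<in>partial_box B N. \<Sum>l\<le>N. F (upd \<nu> j l))"
proof -
  have "bij_betw (\<lambda>(\<nu>, l). upd \<nu> j l) (partial_box B N \<times> {..N}) (partial_box (insert j B) N)"
    by (rule bij_betw_byWitness[where f' = "\<lambda>\<nu>. (upd \<nu> j 0, \<nu> $ j)"])
       (use assms in \<open>auto simp: partial_box_def vec_eq_iff\<close>)
  from sum.reindex_bij_betw[OF this, of F] show ?thesis
    by (simp add: sum.cartesian_product case_prod_unfold)
qed

lemma slot_shift_0: "slot_shift 0 y e k = y ^ k * e 0"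
  by (induction k) (simp_all add: mult_ac)

text \<open>Iterated series are bounded below by finite box sums, one variable at a time. This
  direction suffices and avoids exchanging iterated sums with the unordered sum of the
  symbol.\<close>

lemma slots_ge_partial_sum:
  fixes m :: "nat ^ 'n::finite \<Rightarrow> real"
  assumes m: "admissible m" and js: "distinct js"
    and y: "\<And>k. 0 \<le> y $ k" and z: "\<And>k. 0 \<le> z $ k"
  shows "(\<Prod>k\<in>set js. y $ k ^ \<mu> $ k) *
      (\<Sum>\<nu>\<in>partial_box (set js) N. (\<Prod>k\<in>set js. z $ k ^ \<nu> $ k / fact (\<nu> $ k)) * m (merge_vec (set js) \<mu> \<nu>))
    \<le> slots js y z m \<mu>"
  using m js
proof (induction js arbitrary: m)
  case Nil
  have "partial_box {} N = {0 :: nat ^ 'n}" by (auto simp: partial_box_def vec_eq_iff)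
  moreover have "merge_vec {} \<mu> 0 = \<mu>" by (simp add: merge_vec_def)
  ultimately show ?case by simp
next
  case (Cons j js)
  let ?B = "set js"
  define m' where "m' = slot_moments j 0 (y $ j) (z $ j) m"
  have m': "admissible m'" unfolding m'_def using y z by (intro admissible_slot_moments Cons.prems) auto
  have j: "j \<notin> ?B" using Cons.prems by simp
  let ?y = "\<Prod>k\<in>?B. y $ k ^ \<mu> $ k" and ?z = "\<lambda>\<nu>. \<Prod>k\<in>?B. z $ k ^ \<nu> $ k / fact (\<nu> $ k)"
  have z_upd: "?z (upd \<nu> j l) = ?z \<nu>" for \<nu> l
    using j by (intro prod.cong) auto
  have merge_upd: "upd (merge_vec ?B \<mu> \<nu>) j l = merge_vec (insert j ?B) \<mu> (upd \<nu> j l)" for \<nu> l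
    using j by (simp add: merge_vec_def vec_eq_iff)
  have upd_nth_same: "upd \<nu> j l $ j = l" for \<nu> l by simp
  have m'_ge: "y $ j ^ \<mu> $ j * (\<Sum>l\<le>N. z $ j ^ l / fact l * m (merge_vec (insert j ?B) \<mu> (upd \<nu> j l))) \<le> m' (merge_vec ?B \<mu> \<nu>)" for \<nu>
  proof -
    let ?\<kappa> = "merge_vec ?B \<mu> \<nu>"
    obtain A \<rho> where A: "\<And>l. m (upd ?\<kappa> j (0 + l)) \<le> A * \<rho> ^ l"
      using admissible_slot_growth[OF Cons.prems(1), of ?\<kappa> j 0] by blast
    have "m' ?\<kappa> = y $ j ^ (?\<kappa> $ j) * suminf (\<lambda>l. z $ j ^ l / fact l * m (upd ?\<kappa> j (0 + l)))"
      by (simp only: m'_def slot_moments_def shift_moments_def slot_shift_0 exp_moments_upd)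
    also have "?\<kappa> $ j = \<mu> $ j" using j by (simp add: merge_vec_def)
    finally have eq: "m' ?\<kappa> = y $ j ^ (\<mu> $ j) * suminf (\<lambda>l. z $ j ^ l / fact l * m (upd ?\<kappa> j (0 + l)))" .
    have "(\<Sum>l\<le>N. z $ j ^ l / fact l * m (upd ?\<kappa> j (0 + l))) \<le> suminf (\<lambda>l. z $ j ^ l / fact l * m (upd ?\<kappa> j (0 + l)))"
      using z admissible_nonneg[OF Cons.prems(1)]
      by (intro sum_le_suminf summable_exp_growth[OF _ A]) auto
    then show ?thesis unfolding eq using y by (intro mult_left_mono) (auto simp: merge_upd)
  qed
  have "(\<Prod>k\<in>set (j # js). y $ k ^ \<mu> $ k) *
      (\<Sum>\<nu>\<in>partial_box (set (j # js)) N. (\<Prod>k\<in>set (j # js). z $ k ^ \<nu> $ k / fact (\<nu> $ k)) * m (merge_vec (set (j # js)) \<mu> \<nu>))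
    = ?y * (\<Sum>\<nu>\<in>partial_box ?B N. ?z \<nu> * (y $ j ^ \<mu> $ j * (\<Sum>l\<le>N. z $ j ^ l / fact l * m (merge_vec (insert j ?B) \<mu> (upd \<nu> j l)))))"
    using j by (simp add: sum_partial_box_insert z_upd sum_distrib_left mult_ac upd_nth_same del: upd_nth)
  also have "\<dots> \<le> ?y * (\<Sum>\<nu>\<in>partial_box ?B N. ?z \<nu> * m' (merge_vec ?B \<mu> \<nu>))"
    using y z by (intro mult_left_mono sum_mono m'_ge prod_nonneg) auto
  also have "\<dots> \<le> slots js y z m' \<mu>"
    using Cons.prems by (intro Cons.IH m') simp
  finally show ?case by (simp add: m'_def)
qed

definition exp_symbol :: "(nat ^ 'n::finite \<Rightarrow> real) \<Rightarrow> real ^ 'n \<Rightarrow> nat ^ 'n \<Rightarrow> real" where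
  "exp_symbol m z \<nu> = 1 / vfact \<nu> * mono_eval \<nu> z * m \<nu>"

lemma exp_symbol_nonneg: "admissible m \<Longrightarrow> z \<in> pos_vecs \<Longrightarrow> 0 \<le> exp_symbol m z \<nu>"
  by (auto simp: exp_symbol_def vfact_def mono_eval_def pos_vecs_def less_imp_le admissible_nonneg
      intro!: mult_nonneg_nonneg prod_nonneg divide_nonneg_nonneg)

lemma all_slots_ge_box_sum:
  fixes m :: "nat ^ 'n::finite \<Rightarrow> real"
  assumes m: "admissible m" and js: "distinct js" "set js = UNIV" and yz: "y \<in> pos_vecs" "z \<in> pos_vecs"
  shows "mono_eval \<mu> y * (\<Sum>\<nu>\<in>degree_box N. exp_symbol m z \<nu>) \<le> slots js y z m \<mu>"
proof -
  have "merge_vec UNIV \<mu> \<nu> = \<nu>" for \<nu> :: "nat ^ 'n" by (simp add: merge_vec_def)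
  moreover have "partial_box UNIV N = (degree_box N :: (nat ^ 'n) set)" by (simp add: partial_box_def degree_box_def)
  moreover have "(\<Prod>k\<in>UNIV. z $ k ^ \<nu> $ k / fact (\<nu> $ k)) = 1 / vfact \<nu> * mono_eval \<nu> z" for \<nu>
    by (simp add: vfact_def mono_eval_def prod_dividef)
  ultimately show ?thesis
    using slots_ge_partial_sum[OF m js(1), of y z \<mu> N] yz
    by (simp add: js(2) mono_eval_def[of \<mu>] exp_symbol_def pos_vecs_def less_imp_le)
qed

text \<open>The terms are non-negative, and every finite sum lies in a box sum, bounded by the
  iterated value at y = (1, ..., 1) and exponent 0.\<close>

lemma exp_symbol_summable:
  fixes m :: "nat ^ 'n::finite \<Rightarrow> real"
  assumes m: "admissible m" and z: "z \<in> pos_vecs"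
  shows "exp_symbol m z summable_on UNIV"
proof (rule nonneg_bdd_above_summable_on)
  obtain js :: "'n list" where js: "set js = UNIV" "distinct js"
    using finite_distinct_list[of "UNIV :: 'n set"] by auto
  have one: "(\<chi> k. 1) \<in> (pos_vecs :: (real ^ 'n) set)" by (simp add: pos_vecs_def)
  show "bdd_above (sum (exp_symbol m z) ` {F. F \<subseteq> UNIV \<and> finite F})"
  proof (rule bdd_aboveI2)
    fix F :: "(nat ^ 'n) set" assume "F \<in> {F. F \<subseteq> UNIV \<and> finite F}"
    then obtain N where "F \<subseteq> degree_box N" using finite_subset_degree_box by blast
    then have "sum (exp_symbol m z) F \<le> sum (exp_symbol m z) (degree_box N)"
      using exp_symbol_nonneg[OF m z] by (intro sum_mono2) auto
    also have "\<dots> \<le> slots js (\<chi> k. 1) z m 0"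
      using all_slots_ge_box_sum[OF m js(2,1) one z, of 0 N] by simp
    finally show "sum (exp_symbol m z) F \<le> slots js (\<chi> k. 1) z m 0" .
  qed
qed (rule exp_symbol_nonneg[OF m z])

lemma all_slots_ge_symbol:
  fixes m :: "nat ^ 'n::finite \<Rightarrow> real"
  assumes m: "admissible m" and js: "distinct js" "set js = UNIV" and yz: "y \<in> pos_vecs" "z \<in> pos_vecs"
  shows "mono_eval \<mu> y * infsum (exp_symbol m z) UNIV \<le> slots js y z m \<mu>"
proof -
  have pos: "0 < mono_eval \<mu> y" using yz by (auto simp: mono_eval_def pos_vecs_def intro!: prod_pos)
  have "infsum (exp_symbol m z) UNIV \<le> slots js y z m \<mu> / mono_eval \<mu> y"
  proof (rule infsum_le_finite_sums[OF exp_symbol_summable[OF m yz(2)]])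
    fix F :: "(nat ^ 'n) set" assume "finite F"
    then obtain N where "F \<subseteq> degree_box N" using finite_subset_degree_box by blast
    then have "sum (exp_symbol m z) F \<le> sum (exp_symbol m z) (degree_box N)"
      using exp_symbol_nonneg[OF m yz(2)] by (intro sum_mono2) auto
    also have "\<dots> \<le> slots js y z m \<mu> / mono_eval \<mu> y"
      using all_slots_ge_box_sum[OF m js yz, of \<mu> N] pos by (simp add: pos_le_divide_eq mult.commute)
    finally show "sum (exp_symbol m z) F \<le> slots js y z m \<mu> / mono_eval \<mu> y" .
  qed
  then show ?thesis using pos by (simp add: pos_le_divide_eq mult.commute)
qed

lemma prod_self_power1: "(\<Prod>k\<in>UNIV. self_power1 (\<alpha> $ k)) = exp_neg \<alpha> * self_power \<alpha>"
  by (simp add: self_power1_def exp_neg_def self_power_def prod.distrib)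

text \<open>Once all variables are at s = 0, the functional at p is at least p(y) times the symbol
  at z. Only this product enters the hypothesis on \<open>C\<close>, so the capacities of p and of
  the symbol can be inserted separately.\<close>

lemma moment_capacity_bound:
  fixes p :: "'n::finite rpoly" and m :: "nat ^ 'n \<Rightarrow> real"
  assumes p: "real_stable p" "p \<noteq> 0" "nonneg_coeffs p" and \<alpha>: "\<And>k. 0 \<le> \<alpha> $ k"
    and m: "admissible m"
    and C: "\<And>y z. y \<in> pos_vecs \<Longrightarrow> z \<in> pos_vecs \<Longrightarrow>
      C * (vpowr y \<alpha> * vpowr z \<alpha>) \<le> poly_eval p y * infsum (exp_symbol m z) UNIV"
  shows "C * (exp_neg \<alpha> * self_power \<alpha>) \<le> mfun m p"
proof -
  obtain js :: "'n list" where js: "set js = UNIV" "distinct js"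
    using finite_distinct_list[of "UNIV :: 'n set"] by auto
  have prod: "(\<Prod>j\<leftarrow>js. F j) = (\<Prod>j\<in>UNIV. F j)" for F :: "'n \<Rightarrow> real"
    using prod.distinct_set_conv_list[OF js(2), of F] by (simp add: js(1))
  have "C * (\<Prod>j\<leftarrow>js. self_power1 (\<alpha> $ j)) \<le> mfun m p"
  proof (rule capacity_slots[OF p \<alpha> m js(2)])
    fix y z :: "real ^ 'n" assume yz: "y \<in> pos_vecs" "z \<in> pos_vecs"
    have "C * (\<Prod>j\<leftarrow>js. (y $ j * z $ j) powr (\<alpha> $ j)) = C * (vpowr y \<alpha> * vpowr z \<alpha>)"
      using yz by (simp add: prod vpowr_def powr_mult pos_vecs_def less_imp_le prod.distrib)
    also have "\<dots> \<le> poly_eval p y * infsum (exp_symbol m z) UNIV" by (rule C[OF yz])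
    also have "\<dots> = (\<Sum>\<mu>\<in>Poly_Mapping.keys p. Poly_Mapping.lookup p \<mu> * (mono_eval \<mu> y * infsum (exp_symbol m z) UNIV))"
      by (simp add: poly_eval_def sum_distrib_right mult.assoc)
    also have "\<dots> \<le> mfun (slots js y z m) p"
      unfolding mfun_def using p(3)
      by (intro sum_mono mult_left_mono all_slots_ge_symbol[OF m js(2,1) yz]) (simp add: nonneg_coeffs_def)
    finally show "C * (\<Prod>j\<leftarrow>js. (y $ j * z $ j) powr (\<alpha> $ j)) \<le> mfun (slots js y z m) p" .
  qed
  then show ?thesis by (simp only: prod prod_self_power1)
qed

section \<open>Capacity and the symbol\<close>

lemma poly_eval_nonneg:
  assumes "nonneg_coeffs p" "x \<in> pos_vecs"
  shows "0 \<le> poly_eval p x"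
  using assms by (auto simp: poly_eval_def nonneg_coeffs_def mono_eval_def pos_vecs_def less_imp_le
      intro!: sum_nonneg mult_nonneg_nonneg prod_nonneg)

lemma vpowr_pos: "x \<in> pos_vecs \<Longrightarrow> 0 < vpowr x \<alpha>"
  by (auto simp: vpowr_def pos_vecs_def intro!: prod_pos) (metis less_irrefl)

lemma pos_vecs_nonempty: "(pos_vecs :: (real ^ 'n::finite) set) \<noteq> {}"
proof -
  have "(\<chi> k. 1) \<in> (pos_vecs :: (real ^ 'n) set)" by (simp add: pos_vecs_def)
  then show ?thesis by blast
qed

lemma Cap_bdd_below:
  assumes "nonneg_coeffs p"
  shows "bdd_below ((\<lambda>x. poly_eval p x / vpowr x \<alpha>) ` pos_vecs)"
  using assms by (intro bdd_belowI2[of _ 0]) (simp add: poly_eval_nonneg vpowr_pos less_imp_le)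

lemma Cap_le:
  assumes "nonneg_coeffs p" "x \<in> pos_vecs"
  shows "Cap \<alpha> p * vpowr x \<alpha> \<le> poly_eval p x"
proof -
  have "Cap \<alpha> p \<le> poly_eval p x / vpowr x \<alpha>"
    unfolding Cap_def by (rule cINF_lower[OF Cap_bdd_below[OF assms(1)] assms(2)])
  then show ?thesis using vpowr_pos[OF assms(2)] by (simp add: pos_le_divide_eq)
qed

lemma Cap_nonneg:
  assumes "nonneg_coeffs p"
  shows "0 \<le> Cap \<alpha> p"
  unfolding Cap_def using assms
  by (intro cINF_greatest pos_vecs_nonempty) (simp add: poly_eval_nonneg vpowr_pos less_imp_le)

lemma ln_vpowr: "x \<in> pos_vecs \<Longrightarrow> ln (vpowr x \<alpha>) = (\<Sum>k\<in>UNIV. \<alpha> $ k * ln (x $ k))"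
  unfolding vpowr_def by (subst ln_prod) (auto simp: pos_vecs_def ln_powr, metis less_irrefl)

lemma vpowr_nat: "x \<in> pos_vecs \<Longrightarrow> vpowr x (\<chi> k. real (\<mu> $ k)) = mono_eval \<mu> x"
  by (auto simp: vpowr_def mono_eval_def pos_vecs_def powr_realpow intro!: prod.cong)

text \<open>The exponents \<open>\<alpha>\<close> with \<open>x\<^sup>\<alpha> \<le> M\<close> form a half-space, so a bound on the vertices of the Newton
  polytope extends to all of it.\<close>

lemma Newt_vpowr_le:
  assumes \<alpha>: "\<alpha> \<in> Newt p" and x: "x \<in> pos_vecs"
    and M: "\<And>\<mu>. \<mu> \<in> Poly_Mapping.keys p \<Longrightarrow> mono_eval \<mu> x \<le> M" and "0 < M"
  shows "vpowr x \<alpha> \<le> M"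
proof -
  let ?H = "{\<gamma>. inner (\<chi> k. ln (x $ k)) \<gamma> \<le> ln M}"
  have "vpowr x \<gamma> \<le> M \<longleftrightarrow> \<gamma> \<in> ?H" for \<gamma>
  proof -
    have "vpowr x \<gamma> \<le> M \<longleftrightarrow> ln (vpowr x \<gamma>) \<le> ln M"
      using vpowr_pos[OF x] \<open>0 < M\<close> by simp
    then show ?thesis by (simp add: ln_vpowr[OF x] inner_vec_def mult.commute)
  qed
  then have H: "\<gamma> \<in> ?H \<longleftrightarrow> vpowr x \<gamma> \<le> M" for \<gamma> by blast
  have "Newt p \<subseteq> ?H"
    unfolding Newt_def
  proof (rule hull_minimal)
    show "(\<lambda>\<mu>. \<chi> k. real (\<mu> $ k)) ` Poly_Mapping.keys p \<subseteq> ?H"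
    proof (rule image_subsetI)
      fix \<mu> assume "\<mu> \<in> Poly_Mapping.keys p"
      then show "(\<chi> k. real (\<mu> $ k)) \<in> ?H" unfolding H vpowr_nat[OF x] by (rule M)
    qed
  qed (rule convex_halfspace_le)
  with \<alpha> H show ?thesis by blast
qed

text \<open>Each monomial of p is at most p(x) / c, with c the least non-zero coefficient, and the
  Newton polytope extends this to the exponent \<open>\<alpha>\<close>. Thus c itself is a lower
  bound for the capacity.\<close>

lemma Cap_pos:
  fixes p :: "'n::finite rpoly"
  assumes p: "nonneg_coeffs p" and \<alpha>: "\<alpha> \<in> Newt p"
  shows "0 < Cap \<alpha> p"
proof -
  let ?K = "Poly_Mapping.keys p" and ?c = "Poly_Mapping.lookup p"
  have ne: "?K \<noteq> {}" using \<alpha> by (auto simp: Newt_def)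
  have pos: "0 < ?c \<mu>" if "\<mu> \<in> ?K" for \<mu>
    using p that by (simp add: nonneg_coeffs_def in_keys_iff less_le)
  define c where "c = Min (?c ` ?K)"
  have c: "0 < c" using ne pos by (simp add: c_def)
  have "c \<le> poly_eval p x / vpowr x \<alpha>" if x: "x \<in> pos_vecs" for x
  proof -
    have mono_pos: "0 < mono_eval \<mu> x" for \<mu>
      using x by (auto simp: mono_eval_def pos_vecs_def intro!: prod_pos)
    have "mono_eval \<mu> x \<le> poly_eval p x / c" if \<mu>: "\<mu> \<in> ?K" for \<mu>
    proof -
      have "c * mono_eval \<mu> x \<le> ?c \<mu> * mono_eval \<mu> x"
        using \<mu> mono_pos by (intro mult_right_mono) (auto simp: c_def less_imp_le)
      also have "\<dots> \<le> (\<Sum>\<mu>\<in>?K. ?c \<mu> * mono_eval \<mu> x)"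
        using \<mu> pos mono_pos by (intro member_le_sum[of \<mu> ?K "\<lambda>\<mu>. ?c \<mu> * mono_eval \<mu> x"]) (auto simp: less_imp_le)
      also have "\<dots> = poly_eval p x" by (simp add: poly_eval_def)
      finally show ?thesis using c by (simp add: pos_le_divide_eq mult.commute)
    qed
    note le = this
    obtain \<mu> where "\<mu> \<in> ?K" using ne by blast
    then have "0 < poly_eval p x / c" using le mono_pos order_less_le_trans by blast
    then have "vpowr x \<alpha> \<le> poly_eval p x / c" using Newt_vpowr_le[OF \<alpha> x le] by blast
    then show ?thesis using c vpowr_pos[OF x, of \<alpha>] by (simp add: field_simps)
  qed
  then have "c \<le> Cap \<alpha> p" unfolding Cap_def by (intro cINF_greatest pos_vecs_nonempty)
  with c show ?thesis by simp
qed

locale stable_operator =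
  fixes T :: "'n::finite rpoly \<Rightarrow> 'm::finite rpoly"
  assumes lin: "linear T" and rank: "op_rank T > 2"
    and nonneg: "preserves_nonneg_coeffs T" and stable: "preserves_real_stability T"
begin

definition moment :: "real ^ 'm \<Rightarrow> nat ^ 'n \<Rightarrow> real" where
  "moment x \<mu> = poly_eval (T (monomial \<mu>)) x"

lemma nonneg_coeffs_T: "nonneg_coeffs p \<Longrightarrow> nonneg_coeffs (T p)"
  using nonneg by (simp add: preserves_nonneg_coeffs_def)

lemma admissible_moment: "x \<in> pos_vecs \<Longrightarrow> admissible (moment x)"
  unfolding moment_def
  by (intro good_imp_admissible good_moments_operator lin stable rank poly_eval_nonneg nonneg_coeffs_T)
     (auto simp: nonneg_coeffs_def monomial_def lookup_single when_def)

lemma symb_inf_eq: "symb_inf T z x = infsum (exp_symbol (moment x) z) UNIV"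
  by (simp add: symb_inf_def exp_symbol_def[abs_def] moment_def)

lemma poly_eval_T: "poly_eval (T p) x = mfun (moment x) p"
proof -
  have real_eval: "poly_eval p (\<chi> k. of_real (x $ k)) = complex_of_real (poly_eval p x)" for p
    by (simp add: poly_eval_def mono_eval_def)
  have "symbol_moments T (\<chi> k. of_real (x $ k)) = (\<lambda>\<mu>. of_real (moment x \<mu>))"
    by (simp add: symbol_moments_def moment_def real_eval fun_eq_iff)
  then have "complex_of_real (poly_eval (T p) x) = of_real (mfun (moment x) p)"
    using mfun_symbol_moments[OF lin, of "\<chi> k. of_real (x $ k)" p] by (simp add: real_eval mfun_complexify_of_real)
  then show ?thesis by (simp only: of_real_eq_iff)
qed

lemma symb_inf_nonneg: "x \<in> pos_vecs \<Longrightarrow> z \<in> pos_vecs \<Longrightarrow> 0 \<le> symb_inf T z x"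
  unfolding symb_inf_eq by (intro infsum_nonneg exp_symbol_nonneg admissible_moment)

lemma Cap_symb_le:
  assumes "z \<in> pos_vecs" "x \<in> pos_vecs"
  shows "Cap_symb \<alpha> \<beta> T * (vpowr z \<alpha> * vpowr x \<beta>) \<le> symb_inf T z x"
proof -
  let ?F = "\<lambda>(z, x). symb_inf T z x / (vpowr z \<alpha> * vpowr x \<beta>)"
  have "bdd_below (?F ` (pos_vecs \<times> pos_vecs))"
    by (intro bdd_belowI2[of _ 0]) (auto simp: symb_inf_nonneg vpowr_pos less_imp_le)
  then have "Cap_symb \<alpha> \<beta> T \<le> ?F (z, x)"
    unfolding Cap_symb_def using assms by (intro cINF_lower) auto
  moreover have "0 < vpowr z \<alpha> * vpowr x \<beta>" using assms by (intro mult_pos_pos vpowr_pos)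
  ultimately show ?thesis by (simp add: pos_le_divide_eq)
qed

lemma Cap_symb_nonneg: "0 \<le> Cap_symb \<alpha> \<beta> T"
  unfolding Cap_symb_def
  by (intro cINF_greatest) (auto simp: symb_inf_nonneg vpowr_pos less_imp_le pos_vecs_nonempty)

lemma capacity_lower_bound:
  assumes \<alpha>: "\<And>k. 0 \<le> \<alpha> $ k"
    and p: "real_stable p" "nonneg_coeffs p" "\<alpha> \<in> Newt p"
  shows "exp_neg \<alpha> * self_power \<alpha> * Cap_symb \<alpha> \<beta> T \<le> Cap \<beta> (T p) / Cap \<alpha> p"
proof -
  have p0: "p \<noteq> 0" using p(3) by (auto simp: Newt_def)
  let ?c = "exp_neg \<alpha> * self_power \<alpha>"
  have "Cap \<alpha> p * Cap_symb \<alpha> \<beta> T * ?c \<le> poly_eval (T p) x / vpowr x \<beta>" if x: "x \<in> pos_vecs" for x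
  proof -
    \<comment> \<open>The point x is fixed while y and z vary, so its power belongs to the
      constant.\<close>
    define C where "C = Cap \<alpha> p * Cap_symb \<alpha> \<beta> T * vpowr x \<beta>"
    have "C * ?c \<le> mfun (moment x) p"
    proof (rule moment_capacity_bound[OF p(1) p0 p(2) \<alpha> admissible_moment[OF x]])
      fix y z :: "real ^ 'n" assume y: "y \<in> pos_vecs" and z: "z \<in> pos_vecs"
      have "(Cap \<alpha> p * vpowr y \<alpha>) * (Cap_symb \<alpha> \<beta> T * (vpowr z \<alpha> * vpowr x \<beta>)) \<le> poly_eval p y * symb_inf T z x"
        using Cap_nonneg[OF p(2)] Cap_symb_nonneg vpowr_pos[OF z] vpowr_pos[OF x]
        by (intro mult_mono Cap_le Cap_symb_le p y z x poly_eval_nonneg) (auto simp: less_imp_le)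
      then show "C * (vpowr y \<alpha> * vpowr z \<alpha>) \<le> poly_eval p y * infsum (exp_symbol (moment x) z) UNIV"
        by (simp add: C_def symb_inf_eq mult_ac)
    qed
    then show ?thesis using vpowr_pos[OF x, of \<beta>] by (simp add: C_def poly_eval_T pos_le_divide_eq mult_ac)
  qed
  then have "Cap \<alpha> p * Cap_symb \<alpha> \<beta> T * ?c \<le> Cap \<beta> (T p)"
    unfolding Cap_def[of \<beta>] by (intro cINF_greatest pos_vecs_nonempty)
  then show ?thesis using Cap_pos[OF p(2,3)] by (simp add: pos_le_divide_eq mult_ac)
qed

end

section \<open>The extremal family and the tightness of the bound\<close>

lemma sum_box_prod:
  fixes F :: "'n::finite \<Rightarrow> nat \<Rightarrow> 'b::comm_semiring_1"
  shows "(\<Sum>\<nu>\<in>degree_box N. \<Prod>k\<in>UNIV. F k (\<nu> $ k)) = (\<Prod>k\<in>UNIV. \<Sum>l\<le>N. F k l)"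
proof -
  have "bij_betw vec_lambda (UNIV \<rightarrow>\<^sub>E {..N}) (degree_box N :: (nat ^ 'n) set)"
    by (rule bij_betw_byWitness[where f' = vec_nth]) (auto simp: degree_box_def vec_lambda_inverse)
  from sum.reindex_bij_betw[OF this, of "\<lambda>\<nu>. \<Prod>k\<in>UNIV. F k (\<nu> $ k)"] show ?thesis
    by (simp add: prod_sum_PiE)
qed

definition exp_approx_coeff :: "nat \<Rightarrow> real ^ 'n \<Rightarrow> nat ^ 'n::finite \<Rightarrow> real" where
  "exp_approx_coeff N z \<nu> = (\<Prod>k\<in>UNIV. of_nat (N choose (\<nu> $ k)) * (z $ k / of_nat N) ^ (\<nu> $ k))"

text \<open>The polynomial of the product over k of (1 + z_k x_k / N)^N, given by its coefficients
  because its Newton polytope and its comparison with the symbol are read off from them.\<close>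

definition exp_approx :: "nat \<Rightarrow> real ^ 'n \<Rightarrow> 'n::finite rpoly" where
  "exp_approx N z = (\<Sum>\<nu>\<in>degree_box N. Poly_Mapping.single \<nu> (exp_approx_coeff N z \<nu>))"

lemma lookup_exp_approx:
  "Poly_Mapping.lookup (exp_approx N z) \<nu> = (if \<nu> \<in> degree_box N then exp_approx_coeff N z \<nu> else 0)"
  by (simp add: exp_approx_def lookup_sum lookup_single when_def)

context
  fixes N :: nat and z :: "real ^ 'n::finite"
  assumes N: "0 < N" and z: "z \<in> pos_vecs"
begin

lemma exp_approx_coeff_pos: "\<nu> \<in> degree_box N \<Longrightarrow> 0 < exp_approx_coeff N z \<nu>"
  using N z by (auto simp: exp_approx_coeff_def pos_vecs_def degree_box_def intro!: prod_pos mult_pos_pos)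

lemma keys_exp_approx: "Poly_Mapping.keys (exp_approx N z) = degree_box N"
  using exp_approx_coeff_pos by (fastforce simp: in_keys_iff lookup_exp_approx split: if_splits)

lemma nonneg_coeffs_exp_approx: "nonneg_coeffs (exp_approx N z)"
  using exp_approx_coeff_pos by (auto simp: nonneg_coeffs_def lookup_exp_approx less_imp_le)

lemma poly_eval_exp_approx:
  fixes t :: "'a::real_field ^ 'n"
  shows "poly_eval (exp_approx N z) t = (\<Prod>k\<in>UNIV. (1 + of_real (z $ k / of_nat N) * t $ k) ^ N)"
proof -
  have summand: "of_real (exp_approx_coeff N z \<nu>) * mono_eval \<nu> t
      = (\<Prod>k\<in>UNIV. of_nat (N choose (\<nu> $ k)) * (of_real (z $ k / of_nat N) * t $ k) ^ (\<nu> $ k))" for \<nu>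
    unfolding exp_approx_coeff_def mono_eval_def of_real_prod prod.distrib[symmetric]
    by (intro prod.cong) (simp_all add: power_mult_distrib power_divide)
  have "poly_eval (exp_approx N z) t
      = (\<Sum>\<nu>\<in>degree_box N. \<Prod>k\<in>UNIV. of_nat (N choose (\<nu> $ k)) * (of_real (z $ k / of_nat N) * t $ k) ^ (\<nu> $ k))"
    unfolding poly_eval_def keys_exp_approx by (intro sum.cong) (simp_all only: lookup_exp_approx if_True summand)
  also have "\<dots> = (\<Prod>k\<in>UNIV. \<Sum>l\<le>N. of_nat (N choose l) * (of_real (z $ k / of_nat N) * t $ k) ^ l)"
    by (rule sum_box_prod)
  also have "\<dots> = (\<Prod>k\<in>UNIV. (1 + of_real (z $ k / of_nat N) * t $ k) ^ N)"
    by (simp add: binomial_ring[of _ 1] add.commute[of 1])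
  finally show ?thesis .
qed

lemma real_stable_exp_approx: "real_stable (exp_approx N z)"
  unfolding real_stable_def
proof (intro disjI2 allI impI)
  fix w :: "complex ^ 'n" assume w: "\<forall>k. 0 < Im (w $ k)"
  have "1 + of_real (z $ k / of_nat N) * w $ k \<noteq> 0" for k
  proof
    assume *: "1 + of_real (z $ k / of_nat N) * w $ k = 0"
    have "Im (1 + of_real r * w $ k) = r * Im (w $ k)" for r by simp
    with * have "z $ k / of_nat N * Im (w $ k) = 0" by (metis zero_complex.sel(2))
    moreover have "0 < z $ k / of_nat N * Im (w $ k)"
      using w z N by (intro mult_pos_pos divide_pos_pos) (auto simp: pos_vecs_def)
    ultimately show False by (simp only: less_irrefl)
  qed
  then show "poly_eval (exp_approx N z) w \<noteq> 0" by (simp add: poly_eval_exp_approx)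
qed

text \<open>The vertices of the cube [0, N]^n are exponents of the polynomial, so the polytope
  contains the unit cube scaled by N.\<close>

lemma Newt_exp_approx:
  assumes "\<And>k. 0 \<le> \<alpha> $ k" "\<And>k. \<alpha> $ k \<le> real N"
  shows "\<alpha> \<in> Newt (exp_approx N z)"
proof -
  let ?V = "{x :: real ^ 'n. \<forall>i\<in>Basis. x \<bullet> i = 0 \<or> x \<bullet> i = 1}"
  have "(1 / real N) *\<^sub>R \<alpha> \<in> cbox 0 One"
    unfolding mem_box
  proof (intro ballI)
    fix i :: "real ^ 'n" assume i: "i \<in> Basis"
    then obtain k where "i = axis k 1" by (auto simp: Basis_vec_def)
    then have "\<alpha> \<bullet> i = \<alpha> $ k" by (simp add: inner_axis)
    then show "0 \<bullet> i \<le> (1 / real N) *\<^sub>R \<alpha> \<bullet> i \<and> (1 / real N) *\<^sub>R \<alpha> \<bullet> i \<le> One \<bullet> i"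
      using assms[of k] N i by (simp add: inner_sum_left_Basis)
  qed
  then have "(1 / real N) *\<^sub>R \<alpha> \<in> convex hull ?V" by (simp only: unit_interval_convex_hull)
  then have "real N *\<^sub>R (1 / real N) *\<^sub>R \<alpha> \<in> convex hull ((\<lambda>x. real N *\<^sub>R x) ` ?V)"
    unfolding convex_hull_scaling by blast
  then have "\<alpha> \<in> convex hull ((\<lambda>x. real N *\<^sub>R x) ` ?V)" using N by simp
  also have "\<dots> \<subseteq> convex hull ((\<lambda>\<mu>. \<chi> k. real (\<mu> $ k)) ` degree_box N)"
  proof (rule hull_mono, rule image_subsetI)
    fix x :: "real ^ 'n" assume "x \<in> ?V"
    then have x: "x $ k = 0 \<or> x $ k = 1" for k by (auto simp: Basis_vec_def inner_axis)
    have "real N *\<^sub>R x = (\<chi> k. real ((\<chi> k. if x $ k = 1 then N else 0) $ k))"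
      using x by (auto simp: vec_eq_iff)
    moreover have "(\<chi> k. if x $ k = 1 then N else 0) \<in> degree_box N" by (simp add: degree_box_def)
    ultimately show "real N *\<^sub>R x \<in> (\<lambda>\<mu>. \<chi> k. real (\<mu> $ k)) ` degree_box N" by blast
  qed
  finally show ?thesis by (simp add: Newt_def keys_exp_approx)
qed

end

text \<open>For 0 < a < N this is the maximum over u > 0 of u^a / (1 + u / N)^N, attained at u = a N
  / (N - a); its limit in N is \<open>self_power1 a\<close>.\<close>

definition approx_const :: "nat \<Rightarrow> real \<Rightarrow> real" where
  "approx_const N a = (if a = 0 then 1 else a powr a * (1 - a / real N) powr (real N - a))"

lemma approx_const_tendsto: "0 \<le> a \<Longrightarrow> (\<lambda>N. approx_const N a) \<longlonglongrightarrow> self_power1 a"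
proof (cases "a = 0")
  case False
  have "(\<lambda>N. (1 - a / real N) powr (real N - a)) \<longlonglongrightarrow> exp (- a)" by real_asymp
  from tendsto_mult_left[OF this, of "a powr a"] False show ?thesis
    by (simp add: approx_const_def self_power1_def mult.commute)
qed (simp add: approx_const_def self_power1_def)

lemma approx_const_pos: "a < real N \<Longrightarrow> 0 \<le> a \<Longrightarrow> 0 < approx_const N a"
  by (simp add: approx_const_def)

text \<open>Weighted AM-GM for the two summands, with weights \<open>1 - a / N\<close> and \<open>a / N\<close>.\<close>

lemma powr_le_approx_const:
  fixes a u :: real
  assumes a: "0 \<le> a" "a < real N" and u: "0 < u"
  shows "u powr a \<le> approx_const N a * (1 + u / real N) ^ N"
proof (cases "a = 0")
  case True
  then show ?thesis using u by (simp add: approx_const_def one_le_power)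
next
  case False
  with a have a0: "0 < a" and N: "0 < real N" by auto
  define \<theta> where "\<theta> = a / real N"
  have \<theta>: "0 < \<theta>" "\<theta> < 1" using a a0 N by (auto simp: \<theta>_def)
  define b where "b = 1 + u / real N"
  have b: "0 < b" using u N by (simp add: b_def add_pos_pos)
  have ln_diff_le: "ln v - ln b \<le> v / b - 1" if "0 < v" for v
  proof -
    have "ln (v / b) = ln v - ln b" using that b by (simp add: ln_div)
    then show ?thesis using ln_le_minus_one[of "v / b"] that b by simp
  qed
  have 1: "ln (1 / (1 - \<theta>)) - ln b \<le> 1 / (1 - \<theta>) / b - 1"
    using \<theta> by (intro ln_diff_le) simp
  have 2: "ln (u / a) - ln b \<le> u / a / b - 1"
    using u a0 by (intro ln_diff_le) simp
  have "(1 - \<theta>) * (ln (1 / (1 - \<theta>)) - ln b) + \<theta> * (ln (u / a) - ln b)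
     \<le> (1 - \<theta>) * (1 / (1 - \<theta>) / b - 1) + \<theta> * (u / a / b - 1)"
    using \<theta> by (intro add_mono mult_left_mono 1 2) auto
  also have "\<dots> = (1 + \<theta> * u / a) / b - 1"
    using \<theta> b a0 by (simp add: field_simps)
  also have "1 + \<theta> * u / a = b" using a0 by (simp add: \<theta>_def b_def)
  finally have "(1 - \<theta>) * ln (1 / (1 - \<theta>)) + \<theta> * ln (u / a) \<le> ln b"
    using b by (simp add: algebra_simps)
  then have "real N * ((1 - \<theta>) * ln (1 / (1 - \<theta>)) + \<theta> * ln (u / a)) \<le> real N * ln b"
    using N by (intro mult_left_mono) auto
  moreover have "real N * ((1 - \<theta>) * ln (1 / (1 - \<theta>)) + \<theta> * ln (u / a))
      = - (real N - a) * ln (1 - \<theta>) + a * (ln u - ln a)"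
  proof -
    have "real N * \<theta> = a" using N by (simp add: \<theta>_def)
    moreover have "real N * ((1 - \<theta>) * x + \<theta> * y) = (real N - real N * \<theta>) * x + (real N * \<theta>) * y" for x y
      by (simp add: algebra_simps)
    ultimately have eq: "real N * ((1 - \<theta>) * x + \<theta> * y) = (real N - a) * x + a * y" for x y
      by simp
    show ?thesis unfolding eq using \<theta> u a0 by (simp add: ln_div algebra_simps)
  qed
  ultimately have le: "a * ln u \<le> a * ln a + (real N - a) * ln (1 - \<theta>) + real N * ln b"
    by (simp add: algebra_simps)
  have "u powr a = exp (a * ln u)" using u by (simp add: powr_def)
  also have "\<dots> \<le> exp (a * ln a + (real N - a) * ln (1 - \<theta>) + real N * ln b)" using le by simp
  also have "\<dots> = approx_const N a * b ^ N"
    using a0 \<theta> b by (simp add: approx_const_def exp_add powr_def \<theta>_def[symmetric] exp_of_nat_mult)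
  finally show ?thesis by (simp add: b_def)
qed

lemma Cap_exp_approx_ge:
  fixes z :: "real ^ 'n::finite"
  assumes N: "0 < N" and z: "z \<in> pos_vecs" and \<alpha>: "\<And>k. 0 \<le> \<alpha> $ k" "\<And>k. \<alpha> $ k < real N"
  shows "vpowr z \<alpha> / (\<Prod>k\<in>UNIV. approx_const N (\<alpha> $ k)) \<le> Cap \<alpha> (exp_approx N z)"
  unfolding Cap_def
proof (intro cINF_greatest pos_vecs_nonempty)
  fix t :: "real ^ 'n" assume t: "t \<in> pos_vecs"
  let ?c = "\<Prod>k\<in>UNIV. approx_const N (\<alpha> $ k)"
  have c: "0 < ?c" using \<alpha> by (intro prod_pos) (auto intro: approx_const_pos)
  have "vpowr z \<alpha> * vpowr t \<alpha> = (\<Prod>k\<in>UNIV. (z $ k * t $ k) powr (\<alpha> $ k))"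
    using z t by (simp add: vpowr_def prod.distrib powr_mult pos_vecs_def less_imp_le)
  also have "\<dots> \<le> (\<Prod>k\<in>UNIV. approx_const N (\<alpha> $ k) * (1 + z $ k * t $ k / real N) ^ N)"
    using z t \<alpha> by (intro prod_mono conjI powr_le_approx_const) (auto simp: pos_vecs_def)
  also have "\<dots> = ?c * poly_eval (exp_approx N z) t"
    by (simp add: prod.distrib poly_eval_exp_approx[OF N z])
  finally show "vpowr z \<alpha> / ?c \<le> poly_eval (exp_approx N z) t / vpowr t \<alpha>"
    using c vpowr_pos[OF t, of \<alpha>] by (simp add: field_simps)
qed

context stable_operator
begin

text \<open>Coefficient by coefficient the approximant lies below exp(z_1 x_1 + ... + z_n x_n), and
  the moments are non-negative.\<close>

lemma T_exp_approx_le: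
  assumes "0 < N" "z \<in> pos_vecs" "x \<in> pos_vecs"
  shows "poly_eval (T (exp_approx N z)) x \<le> symb_inf T z x"
proof -
  note m = admissible_moment[OF assms(3)]
  have "poly_eval (T (exp_approx N z)) x = (\<Sum>\<nu>\<in>degree_box N. exp_approx_coeff N z \<nu> * moment x \<nu>)"
    by (simp add: poly_eval_T mfun_def keys_exp_approx[OF assms(1,2)] lookup_exp_approx)
  also have "\<dots> \<le> (\<Sum>\<nu>\<in>degree_box N. exp_symbol (moment x) z \<nu>)"
  proof (rule sum_mono)
    fix \<nu> :: "nat ^ 'n"
    have "exp_approx_coeff N z \<nu> \<le> (\<Prod>k\<in>UNIV. z $ k ^ \<nu> $ k / fact (\<nu> $ k))"
      unfolding exp_approx_coeff_def using assms(2)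
      by (intro prod_mono conjI binomial_over_power_le) (auto simp: pos_vecs_def less_imp_le)
    also have "\<dots> = 1 / vfact \<nu> * mono_eval \<nu> z" by (simp add: vfact_def mono_eval_def prod_dividef)
    finally show "exp_approx_coeff N z \<nu> * moment x \<nu> \<le> exp_symbol (moment x) z \<nu>"
      unfolding exp_symbol_def by (intro mult_right_mono admissible_nonneg[OF m])
  qed
  also have "\<dots> \<le> infsum (exp_symbol (moment x) z) UNIV"
    by (intro finite_sum_le_infsum exp_symbol_summable m assms exp_symbol_nonneg) auto
  finally show ?thesis by (simp add: symb_inf_eq)
qed

lemma capacity_bound_tight:
  assumes \<alpha>: "\<And>k. 0 \<le> \<alpha> $ k"
  shows "(INF p\<in>{p. real_stable p \<and> nonneg_coeffs p \<and> \<alpha> \<in> Newt p}. Cap \<beta> (T p) / Cap \<alpha> p)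
      = exp_neg \<alpha> * self_power \<alpha> * Cap_symb \<alpha> \<beta> T"
proof -
  let ?P = "{p. real_stable p \<and> nonneg_coeffs p \<and> \<alpha> \<in> Newt p}"
  let ?R = "\<lambda>p. Cap \<beta> (T p) / Cap \<alpha> p"
  let ?c = "exp_neg \<alpha> * self_power \<alpha>"
  let ?I = "INF p\<in>?P. ?R p"
  have c: "0 < ?c"
    unfolding exp_neg_def self_power_def by (intro mult_pos_pos prod_pos) auto
  have approx: "exp_approx N z \<in> ?P" if "0 < N" "z \<in> pos_vecs" "\<And>k. \<alpha> $ k \<le> real N" for N z
    using that \<alpha> by (simp add: real_stable_exp_approx nonneg_coeffs_exp_approx Newt_exp_approx)
  \<comment> \<open>A real-valued infimum behaves as expected only on a non-empty set that is
    bounded below; hence this fact and \<open>ne\<close>.\<close>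
  have bdd: "bdd_below (?R ` ?P)"
    by (intro bdd_belowI2[of _ 0]) (auto intro!: divide_nonneg_nonneg Cap_nonneg nonneg_coeffs_T)
  have "eventually (\<lambda>N. (\<Sum>k\<in>UNIV. \<alpha> $ k) < real N \<and> 0 < N) sequentially"
    by (intro eventually_conj eventually_gt_at_top)
       (use filterlim_real_sequentially in \<open>simp add: filterlim_at_top_dense\<close>)
  moreover have "\<alpha> $ k < real N" if "(\<Sum>k\<in>UNIV. \<alpha> $ k) < real N" for k N
    using member_le_sum[of k UNIV "\<lambda>k. \<alpha> $ k"] \<alpha> that by simp
  ultimately have large: "eventually (\<lambda>N. 0 < N \<and> (\<forall>k. \<alpha> $ k < real N)) sequentially"
    by (auto elim!: eventually_mono)
  then obtain N0 where N0: "0 < N0" "\<And>k. \<alpha> $ k < real N0" by (auto simp: eventually_sequentially)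
  have one: "(\<chi> k. 1) \<in> (pos_vecs :: (real ^ 'n) set)" by (simp add: pos_vecs_def)
  have ne: "?P \<noteq> {}" using approx[OF N0(1) one] N0(2) by (force simp: less_imp_le)
  have "?I \<le> ?c * (symb_inf T z x / (vpowr z \<alpha> * vpowr x \<beta>))"
    if z: "z \<in> pos_vecs" and x: "x \<in> pos_vecs" for z x
  proof -
    define q where "q = symb_inf T z x / (vpowr z \<alpha> * vpowr x \<beta>)"
    have le: "?I \<le> (\<Prod>k\<in>UNIV. approx_const N (\<alpha> $ k)) * q" if N: "0 < N" "\<And>k. \<alpha> $ k < real N" for N
    proof -
      let ?p = "exp_approx N z" and ?b = "\<Prod>k\<in>UNIV. approx_const N (\<alpha> $ k)"
      have b: "0 < ?b" using \<alpha> N(2) by (intro prod_pos) (auto intro: approx_const_pos)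
      have P: "?p \<in> ?P" using N z by (intro approx) (auto simp: less_imp_le)
      \<comment> \<open>The numerator is an infimum, so testing it at the single point x suffices;
        the denominator needs the uniform lower bound \<open>Cap_exp_approx_ge\<close>.\<close>
      have "?I \<le> ?R ?p" by (rule cINF_lower[OF bdd P])
      also have "\<dots> \<le> (symb_inf T z x / vpowr x \<beta>) / (vpowr z \<alpha> / ?b)"
      proof (rule frac_le)
        show "0 \<le> symb_inf T z x / vpowr x \<beta>" using symb_inf_nonneg[OF x z] vpowr_pos[OF x, of \<beta>] by simp
        have "Cap \<beta> (T ?p) * vpowr x \<beta> \<le> poly_eval (T ?p) x"
          using P by (intro Cap_le nonneg_coeffs_T x) simp
        also have "\<dots> \<le> symb_inf T z x" by (rule T_exp_approx_le[OF N(1) z x])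
        finally show "Cap \<beta> (T ?p) \<le> symb_inf T z x / vpowr x \<beta>"
          using vpowr_pos[OF x, of \<beta>] by (simp add: pos_le_divide_eq)
        show "0 < vpowr z \<alpha> / ?b" using b vpowr_pos[OF z] by simp
        show "vpowr z \<alpha> / ?b \<le> Cap \<alpha> ?p" by (rule Cap_exp_approx_ge[OF N(1) z \<alpha> N(2)])
      qed
      also have "\<dots> = ?b * q" by (simp add: q_def mult_ac)
      finally show ?thesis .
    qed
    have "(\<lambda>N. (\<Prod>k\<in>UNIV. approx_const N (\<alpha> $ k)) * q) \<longlonglongrightarrow> (\<Prod>k\<in>UNIV. self_power1 (\<alpha> $ k)) * q"
      by (intro tendsto_intros approx_const_tendsto \<alpha>)
    moreover have "eventually (\<lambda>N. ?I \<le> (\<Prod>k\<in>UNIV. approx_const N (\<alpha> $ k)) * q) sequentially"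
      using large by eventually_elim (blast intro: le)
    ultimately have "?I \<le> (\<Prod>k\<in>UNIV. self_power1 (\<alpha> $ k)) * q"
      by (rule tendsto_lowerbound) simp
    then show ?thesis by (simp only: prod_self_power1 q_def)
  qed
  then have "?I / ?c \<le> Cap_symb \<alpha> \<beta> T"
    unfolding Cap_symb_def using c
    by (intro cINF_greatest) (auto simp: pos_divide_le_eq mult.commute pos_vecs_nonempty)
  then have "?I \<le> ?c * Cap_symb \<alpha> \<beta> T" using c by (simp add: pos_divide_le_eq mult.commute)
  moreover have "?c * Cap_symb \<alpha> \<beta> T \<le> ?I"
    using capacity_lower_bound[OF \<alpha>] by (intro cINF_greatest ne) auto
  ultimately show ?thesis by (rule antisym)
qed

end

theorem corollary4p14:
  fixes T :: "'n::finite rpoly \<Rightarrow> 'm::finite rpoly"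
    and \<alpha> :: "real ^ 'n" and \<beta> :: "real ^ 'm"
  assumes "linear T"
    and "op_rank T > 2"
    and "preserves_nonneg_coeffs T"
    and "preserves_real_stability T"
    and "\<forall>k. 0 \<le> \<alpha> $ k"
    and "\<forall>k. 0 \<le> \<beta> $ k"
  shows "(\<forall>p. real_stable p \<and> nonneg_coeffs p \<and> \<alpha> \<in> Newt p \<longrightarrow>
            Cap \<beta> (T p) / Cap \<alpha> p \<ge> exp_neg \<alpha> * self_power \<alpha> * Cap_symb \<alpha> \<beta> T)
       \<and> (INF p\<in>{p. real_stable p \<and> nonneg_coeffs p \<and> \<alpha> \<in> Newt p}. Cap \<beta> (T p) / Cap \<alpha> p)
            = exp_neg \<alpha> * self_power \<alpha> * Cap_symb \<alpha> \<beta> T"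
proof -
  interpret stable_operator T
    by (rule stable_operator.intro; fact assms)
  show ?thesis
    using capacity_lower_bound capacity_bound_tight assms(5) by blast
qed

end
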